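(* Let $A$ be a proper orthoalgebra. Then the poset $\mathrm{BSub}(A)$ of Boolean subalgebras of $A$ (which is an orthodomain) has enough directions, and the set $\mathrm{Dir}(\mathrm{BSub}(A))$ of directions of $\mathrm{BSub}(A)$, with its operations $\oplus$, $'$ and constants $0,1$, is an orthoalgebra isomorphic to $A$.
   Context: **Orthoalgebras.** An orthoalgebra is a set $A$ with a partial binary operation $\oplus$ (write $a\perp b$ when $a\oplus b$ is defined), a unary operation $'$ and constants $0,1$ such that: (1) $\oplus$ is commutative and associative in the usual sense for partial operations (if one side is defined so is the other and they are equal); (2) $a'$ is the unique element with $a\oplus a'$ defined and equal to $1$; (3) $a\oplus a$ is defined iff $a=0$. It is partially ordered by $a\le c$ iff $a\oplus b=c$ for some $b\perp a$. It is Boolean if it arises from a Boolean algebra by restricting the join to pairs of orthogonal elements. A morphism $f\colon A\to C$ preserves $'$ and satisfies: if $a\oplus b$ is defined then so is $f(a)\oplus f(b)$, and $f(a\oplus b)=f(a)\oplus f(b)$; an isomorphism is a morphism with an inverse morphism. A subalgebra is a subset containing $0,1$, closed under $'$ and under $\oplus$ (when defined); a Boolean subalgebra is a subalgebra that is a Boolean orthoalgebra. $\mathrm{BSub}(A)$ is the set of Boolean subalgebras ordered by inclusion. A block is a maximal Boolean subalgebra; it is small if it has at most $4$ elements. $A$ is proper if it has no small blocks. **Boolean domains.** $\mathrm{Sub}(B)$ is the lattice of Boolean subalgebras of a Boolean algebra $B$, ordered by inclusion. A Boolean domain is a lattice isomorphic to $\mathrm{Sub}(B)$ for some Boolean algebra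 $B$ (by a theorem of Grätzer et al., equivalently an algebraic lattice in which, for each compact $x$, $\downarrow x$ is isomorphic to the lattice of partitions of a finite set, finer partitions being larger). Its least and largest elements are $\bot,\top$. In a poset with least element, an element is basic if it is an atom or the least element. An element $x$ of a lattice is dual modular if $(x\vee y)\wedge z=x\vee(y\wedge z)$ for all $y$ and all $z\ge x$, and $(w\vee x)\wedge y=w\vee(x\wedge y)$ for all $w\le y$. A principal pair of a Boolean domain is an ordered pair $(y,z)$ of dual modular elements such that (1) $y=\top$ and $z$ is basic, or (2) $z=\top$ and $y$ is basic, or (3) $y\vee z=\top$ and $y\wedge z$ is a basic element that is not dual modular. It is a principal pair for the basic element $x$ if $y\wedge z=x$. **Orthodomains and directions.** $x\lessdot z$ means $z$ covers $x$. An orthodomain is a poset $X$ with least element $\bot$ such that: (1) every directed subset has a join; (2) $X$ is atomistic and its atoms are compact; (3) each $\downarrow x$ is a Boolean domain; (4) if $x,y$ are distinct atoms and $x,y\lessdot w$, then $x\vee y=w$. A direction for a basic element $x$ of $X$ is a map $d\colon\uparrow x\to X^2$ such that for all $y,z\in\uparrow x$: (1) $d(y)$ is a principal pair for $x$ in the Boolean domain $\downarrow y$; (2) if $y\le z$ and $d(z)=(v,w)$ then $d(y)=(y\wedge v,y\wedge w)$; (3) if $x\lessdot y,z$ and $d(y)=(x,y)$, $d(z)=(z,x)$, then $y\vee z$ exists and $y,z\lessdot y\vee z$. $\mathrm{Dir}(X)$ is the set of all directions for basic elements of $X$. $X$ is proper if no maximal element is basic; $X$ has enough directions if it is proper and each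 basic element has a direction (it then has exactly two). **Operations on $\mathrm{Dir}(X)$** (for $X$ an orthodomain with enough directions). If $d$ is a direction for $x$, then $d'$ is the direction for $x$ with $d'(w)=(z,y)$ when $d(w)=(y,z)$. $0$ and $1$ are the directions for $\bot$ given by $0(w)=(\bot,w)$, $1(w)=(w,\bot)$. Two atoms $x,y$ are near if they are distinct and their join exists and covers both; then there is exactly one further atom below $x\vee y$. The partial operation $\oplus$ is defined exactly in these cases: $d\oplus 0=d=0\oplus d$; $d\oplus d'=1$; and if $d$ is a direction for $x$, $e$ a direction for $y$, with $x,y$ near, $w=x\vee y$, $z$ the third atom below $w$, and $d(w)=(x,w)$, $e(w)=(y,w)$, then $d\oplus e$ is the direction for $z$ with $(d\oplus e)(w)=(w,z)$. *)

theory Defs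
  imports "HOL-Algebra.Lattice"
begin

section \<open>Orthoalgebras\<close>

text \<open>The partial operation is option-valued: \<open>osum A a b = None\<close> means that \<open>a \<oplus> b\<close> is undefined.
  Only its values on the carrier matter.\<close>

record 'a orthoalg = "'a partial_object" +
  osum :: "'a \<Rightarrow> 'a \<Rightarrow> 'a option"
  ocompl :: "'a \<Rightarrow> 'a"
  ozero :: 'a
  oone :: 'a

locale orthoalgebra =
  fixes A :: "'a orthoalg"
  assumes zero_closed: "ozero A \<in> carrier A"
    and one_closed: "oone A \<in> carrier A"
    and compl_closed: "a \<in> carrier A \<Longrightarrow> ocompl A a \<in> carrier A"
    and sum_closed: "\<lbrakk>a \<in> carrier A; b \<in> carrier A; osum A a b = Some c\<rbrakk> \<Longrightarrow> c \<in> carrier A"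
    and sum_comm: "\<lbrakk>a \<in> carrier A; b \<in> carrier A\<rbrakk> \<Longrightarrow> osum A a b = osum A b a"
    and sum_assoc: "\<lbrakk>a \<in> carrier A; b \<in> carrier A; c \<in> carrier A\<rbrakk> \<Longrightarrow>
      Option.bind (osum A a b) (\<lambda>u. osum A u c) = Option.bind (osum A b c) (\<lambda>v. osum A a v)"
    and sum_compl: "a \<in> carrier A \<Longrightarrow> osum A a (ocompl A a) = Some (oone A)"
    and compl_unique: "\<lbrakk>a \<in> carrier A; b \<in> carrier A; osum A a b = Some (oone A)\<rbrakk> \<Longrightarrow> b = ocompl A a"
    and sum_self: "a \<in> carrier A \<Longrightarrow> osum A a a \<noteq> None \<longleftrightarrow> a = ozero A"

definition orthoalg_hom :: "'a orthoalg \<Rightarrow> 'b orthoalg \<Rightarrow> ('a \<Rightarrow> 'b) set" where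
  "orthoalg_hom A C = {f \<in> carrier A \<rightarrow> carrier C.
     (\<forall>a\<in>carrier A. f (ocompl A a) = ocompl C (f a)) \<and>
     (\<forall>a\<in>carrier A. \<forall>b\<in>carrier A. \<forall>c. osum A a b = Some c \<longrightarrow> osum C (f a) (f b) = Some (f c))}"

definition orthoalg_isomorphic :: "'a orthoalg \<Rightarrow> 'b orthoalg \<Rightarrow> bool" where
  "orthoalg_isomorphic A C \<longleftrightarrow> (\<exists>f \<in> orthoalg_hom A C. \<exists>g \<in> orthoalg_hom C A.
     (\<forall>a\<in>carrier A. g (f a) = a) \<and> (\<forall>c\<in>carrier C. f (g c) = c))"

definition orthoalg_subalgebra :: "'a set \<Rightarrow> 'a orthoalg \<Rightarrow> bool" where
  "orthoalg_subalgebra S A \<longleftrightarrow> S \<subseteq> carrier A \<and> ozero A \<in> S \<and> oone A \<in> S \<and>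
     (\<forall>a\<in>S. ocompl A a \<in> S) \<and> (\<forall>a\<in>S. \<forall>b\<in>S. \<forall>c. osum A a b = Some c \<longrightarrow> c \<in> S)"

section \<open>Boolean algebras\<close>

text \<open>Carrier-based Boolean algebras; the one-element Boolean algebra is allowed.\<close>

definition is_complement :: "'b gorder \<Rightarrow> 'b \<Rightarrow> 'b \<Rightarrow> bool" where
  "is_complement B a b \<longleftrightarrow> a \<in> carrier B \<and> b \<in> carrier B \<and>
     a \<sqinter>\<^bsub>B\<^esub> b = \<bottom>\<^bsub>B\<^esub> \<and> a \<squnion>\<^bsub>B\<^esub> b = \<top>\<^bsub>B\<^esub>"

locale boolean_lattice = bounded_lattice B for B :: "'b gorder" (structure) +
  assumes meet_join_distrib: "\<lbrakk>a \<in> carrier B; b \<in> carrier B; c \<in> carrier B\<rbrakk> \<Longrightarrow>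
      a \<sqinter> (b \<squnion> c) = (a \<sqinter> b) \<squnion> (a \<sqinter> c)"
    and complemented: "a \<in> carrier B \<Longrightarrow> \<exists>b. is_complement B a b"

definition boolean_orthoalgebra :: "'a orthoalg \<Rightarrow> bool" where
  "boolean_orthoalgebra A \<longleftrightarrow> orthoalgebra A \<and>
     (\<exists>B. boolean_lattice B \<and> carrier B = carrier A \<and>
        ozero A = \<bottom>\<^bsub>B\<^esub> \<and> oone A = \<top>\<^bsub>B\<^esub> \<and>
        (\<forall>a\<in>carrier A. is_complement B a (ocompl A a)) \<and>
        (\<forall>a\<in>carrier A. \<forall>b\<in>carrier A.
           osum A a b = (if a \<sqinter>\<^bsub>B\<^esub> b = \<bottom>\<^bsub>B\<^esub> then Some (a \<squnion>\<^bsub>B\<^esub> b) else None)))"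

definition boolean_subalgebra :: "'a set \<Rightarrow> 'a orthoalg \<Rightarrow> bool" where
  "boolean_subalgebra S A \<longleftrightarrow>
     orthoalg_subalgebra S A \<and> boolean_orthoalgebra (A\<lparr>carrier := S\<rparr>)"

definition BSub :: "'a orthoalg \<Rightarrow> 'a set gorder" where
  "BSub A = \<lparr>carrier = {S. boolean_subalgebra S A}, eq = (=), le = (\<subseteq>)\<rparr>"

definition block :: "'a orthoalg \<Rightarrow> 'a set \<Rightarrow> bool" where
  "block A S \<longleftrightarrow> boolean_subalgebra S A \<and> (\<forall>T. boolean_subalgebra T A \<longrightarrow> S \<subseteq> T \<longrightarrow> T = S)"

definition proper_orthoalgebra :: "'a orthoalg \<Rightarrow> bool" where
  "proper_orthoalgebra A \<longleftrightarrow> (\<forall>S. block A S \<longrightarrow> \<not> (finite S \<and> card S \<le> 4))"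

section \<open>Posets and Boolean domains\<close>

definition downset :: "'x gorder \<Rightarrow> 'x \<Rightarrow> 'x gorder" where
  "downset X x = X\<lparr>carrier := {y \<in> carrier X. y \<sqsubseteq>\<^bsub>X\<^esub> x}\<rparr>"

definition upset :: "'x gorder \<Rightarrow> 'x \<Rightarrow> 'x set" where
  "upset X x = {y \<in> carrier X. x \<sqsubseteq>\<^bsub>X\<^esub> y}"

definition covers :: "'x gorder \<Rightarrow> 'x \<Rightarrow> 'x \<Rightarrow> bool" where
  \<comment> \<open>\<open>z\<close> covers \<open>x\<close>\<close>
  "covers X x z \<longleftrightarrow> x \<in> carrier X \<and> z \<in> carrier X \<and> x \<sqsubset>\<^bsub>X\<^esub> z \<and>
     \<not> (\<exists>y\<in>carrier X. x \<sqsubset>\<^bsub>X\<^esub> y \<and> y \<sqsubset>\<^bsub>X\<^esub> z)"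

definition atom :: "'x gorder \<Rightarrow> 'x \<Rightarrow> bool" where
  "atom X x \<longleftrightarrow> covers X \<bottom>\<^bsub>X\<^esub> x"

definition basic :: "'x gorder \<Rightarrow> 'x \<Rightarrow> bool" where
  "basic X x \<longleftrightarrow> atom X x \<or> x = \<bottom>\<^bsub>X\<^esub>"

definition bool_subalgebras :: "'b gorder \<Rightarrow> 'b set gorder" where
  "bool_subalgebras B = \<lparr>carrier = {S. S \<subseteq> carrier B \<and> \<bottom>\<^bsub>B\<^esub> \<in> S \<and> \<top>\<^bsub>B\<^esub> \<in> S \<and>
       (\<forall>a\<in>S. \<forall>b\<in>S. a \<sqinter>\<^bsub>B\<^esub> b \<in> S \<and> a \<squnion>\<^bsub>B\<^esub> b \<in> S) \<and>
       (\<forall>a\<in>S. \<forall>b. is_complement B a b \<longrightarrow> b \<in> S)},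
     eq = (=), le = (\<subseteq>)\<rparr>"

text \<open>The Boolean algebra \<open>B\<close> is sought on the type \<open>'x \<times> bool\<close>. This is no restriction:
  \<open>a \<mapsto> {0, a, a', 1}\<close> is at most two-to-one from \<open>B\<close> to its lattice of subalgebras, so a Boolean
  algebra on any type whose subalgebra lattice is isomorphic to \<open>L\<close> has at most
  \<open>2 \<cdot> |carrier L|\<close> elements and can be transported to \<open>'x \<times> bool\<close>.\<close>

definition boolean_domain :: "'x gorder \<Rightarrow> bool" where
  "boolean_domain L \<longleftrightarrow> lattice L \<and>
     (\<exists>(B :: ('x \<times> bool) gorder) f. boolean_lattice B \<and>
        order_emb L (bool_subalgebras B) f \<and>
        bij_betw f (carrier L) (carrier (bool_subalgebras B)))"

definition dual_modular :: "'x gorder \<Rightarrow> 'x \<Rightarrow> bool" where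
  "dual_modular L x \<longleftrightarrow> x \<in> carrier L \<and>
     (\<forall>y\<in>carrier L. \<forall>z\<in>carrier L. x \<sqsubseteq>\<^bsub>L\<^esub> z \<longrightarrow>
        (x \<squnion>\<^bsub>L\<^esub> y) \<sqinter>\<^bsub>L\<^esub> z = x \<squnion>\<^bsub>L\<^esub> (y \<sqinter>\<^bsub>L\<^esub> z)) \<and>
     (\<forall>w\<in>carrier L. \<forall>y\<in>carrier L. w \<sqsubseteq>\<^bsub>L\<^esub> y \<longrightarrow>
        (w \<squnion>\<^bsub>L\<^esub> x) \<sqinter>\<^bsub>L\<^esub> y = w \<squnion>\<^bsub>L\<^esub> (x \<sqinter>\<^bsub>L\<^esub> y))"

definition principal_pair :: "'x gorder \<Rightarrow> 'x \<Rightarrow> 'x \<Rightarrow> bool" where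
  "principal_pair L y z \<longleftrightarrow> dual_modular L y \<and> dual_modular L z \<and>
     (y = \<top>\<^bsub>L\<^esub> \<and> basic L z \<or>
      z = \<top>\<^bsub>L\<^esub> \<and> basic L y \<or>
      y \<squnion>\<^bsub>L\<^esub> z = \<top>\<^bsub>L\<^esub> \<and> basic L (y \<sqinter>\<^bsub>L\<^esub> z) \<and> \<not> dual_modular L (y \<sqinter>\<^bsub>L\<^esub> z))"

definition principal_pair_for :: "'x gorder \<Rightarrow> 'x \<Rightarrow> 'x \<Rightarrow> 'x \<Rightarrow> bool" where
  "principal_pair_for L x y z \<longleftrightarrow> principal_pair L y z \<and> y \<sqinter>\<^bsub>L\<^esub> z = x"

section \<open>Orthodomains and directions\<close>

definition directed_in :: "'x gorder \<Rightarrow> 'x set \<Rightarrow> bool" where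
  "directed_in X D \<longleftrightarrow> D \<subseteq> carrier X \<and> D \<noteq> {} \<and>
     (\<forall>x\<in>D. \<forall>y\<in>D. \<exists>z\<in>D. x \<sqsubseteq>\<^bsub>X\<^esub> z \<and> y \<sqsubseteq>\<^bsub>X\<^esub> z)"

definition compact_in :: "'x gorder \<Rightarrow> 'x \<Rightarrow> bool" where
  "compact_in X x \<longleftrightarrow> x \<in> carrier X \<and>
     (\<forall>D s. directed_in X D \<longrightarrow> is_lub X s D \<longrightarrow> x \<sqsubseteq>\<^bsub>X\<^esub> s \<longrightarrow> (\<exists>y\<in>D. x \<sqsubseteq>\<^bsub>X\<^esub> y))"

locale orthodomain = partial_order X + weak_partial_order_bottom X
  for X :: "'x gorder" (structure) +
  assumes directed_join: "directed_in X D \<Longrightarrow> \<exists>s. is_lub X s D"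
    and atomistic: "x \<in> carrier X \<Longrightarrow> is_lub X x {a. atom X a \<and> a \<sqsubseteq> x}"
    and atoms_compact: "atom X a \<Longrightarrow> compact_in X a"
    and boolean_downset: "x \<in> carrier X \<Longrightarrow> boolean_domain (downset X x)"
    and atoms_join: "\<lbrakk>atom X x; atom X y; x \<noteq> y; covers X x w; covers X y w\<rbrakk> \<Longrightarrow> is_lub X w {x, y}"

text \<open>A map \<open>\<up>x \<rightarrow> X\<^sup>2\<close> is represented by a partial function with domain \<open>\<up>x\<close>,
  so that equality of directions is equality in HOL.\<close>

type_synonym 'x direction = "'x \<Rightarrow> ('x \<times> 'x) option"

definition is_direction :: "'x gorder \<Rightarrow> 'x \<Rightarrow> 'x direction \<Rightarrow> bool" where
  "is_direction X x d \<longleftrightarrow> basic X x \<and> dom d = upset X x \<and>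
     (\<forall>y\<in>upset X x. \<exists>v w. d y = Some (v, w) \<and> principal_pair_for (downset X y) x v w) \<and>
     (\<forall>y\<in>upset X x. \<forall>z\<in>upset X x. \<forall>v w. y \<sqsubseteq>\<^bsub>X\<^esub> z \<longrightarrow> d z = Some (v, w) \<longrightarrow>
        d y = Some (y \<sqinter>\<^bsub>X\<^esub> v, y \<sqinter>\<^bsub>X\<^esub> w)) \<and>
     (\<forall>y\<in>upset X x. \<forall>z\<in>upset X x.
        covers X x y \<longrightarrow> covers X x z \<longrightarrow> d y = Some (x, y) \<longrightarrow> d z = Some (z, x) \<longrightarrow>
        (\<exists>s. is_lub X s {y, z} \<and> covers X y s \<and> covers X z s))"

definition directions :: "'x gorder \<Rightarrow> 'x direction set" where
  "directions X = {d. \<exists>x. is_direction X x d}"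

definition proper_poset :: "'x gorder \<Rightarrow> bool" where
  "proper_poset X \<longleftrightarrow>
     (\<forall>x\<in>carrier X. (\<forall>y\<in>carrier X. x \<sqsubseteq>\<^bsub>X\<^esub> y \<longrightarrow> y = x) \<longrightarrow> \<not> basic X x)"

definition enough_directions :: "'x gorder \<Rightarrow> bool" where
  "enough_directions X \<longleftrightarrow> proper_poset X \<and> (\<forall>x. basic X x \<longrightarrow> (\<exists>d. is_direction X x d))"

definition dir_compl :: "'x direction \<Rightarrow> 'x direction" where
  "dir_compl d = (\<lambda>w. map_option prod.swap (d w))"

definition dir_zero :: "'x gorder \<Rightarrow> 'x direction" where
  "dir_zero X = (\<lambda>w. if w \<in> carrier X then Some (\<bottom>\<^bsub>X\<^esub>, w) else None)"

definition dir_one :: "'x gorder \<Rightarrow> 'x direction" where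
  "dir_one X = (\<lambda>w. if w \<in> carrier X then Some (w, \<bottom>\<^bsub>X\<^esub>) else None)"

definition near :: "'x gorder \<Rightarrow> 'x \<Rightarrow> 'x \<Rightarrow> bool" where
  "near X x y \<longleftrightarrow> atom X x \<and> atom X y \<and> x \<noteq> y \<and>
     (\<exists>w. is_lub X w {x, y} \<and> covers X x w \<and> covers X y w)"

definition near_summable :: "'x gorder \<Rightarrow> 'x direction \<Rightarrow> 'x direction \<Rightarrow> 'x \<Rightarrow> 'x \<Rightarrow> bool" where
  "near_summable X d e x y \<longleftrightarrow> is_direction X x d \<and> is_direction X y e \<and> near X x y \<and>
     d (x \<squnion>\<^bsub>X\<^esub> y) = Some (x, x \<squnion>\<^bsub>X\<^esub> y) \<and> e (x \<squnion>\<^bsub>X\<^esub> y) = Some (y, x \<squnion>\<^bsub>X\<^esub> y)"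

definition dir_sum :: "'x gorder \<Rightarrow> 'x direction \<Rightarrow> 'x direction \<Rightarrow> 'x direction option" where
  "dir_sum X d e =
     (if e = dir_zero X then Some d
      else if d = dir_zero X then Some e
      else if e = dir_compl d then Some (dir_one X)
      else if \<exists>x y. near_summable X d e x y then
        Some (THE f. \<exists>x y z. near_summable X d e x y \<and>
          atom X z \<and> z \<sqsubseteq>\<^bsub>X\<^esub> x \<squnion>\<^bsub>X\<^esub> y \<and> z \<noteq> x \<and> z \<noteq> y \<and>
          is_direction X z f \<and> f (x \<squnion>\<^bsub>X\<^esub> y) = Some (x \<squnion>\<^bsub>X\<^esub> y, z))
      else None)"

definition Dir :: "'x gorder \<Rightarrow> 'x direction orthoalg" where
  "Dir X = \<lparr>carrier = directions X, osum = dir_sum X, ocompl = dir_compl,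
     ozero = dir_zero X, oone = dir_one X\<rparr>"

end

theory Submission
  imports Defs
begin

text \<open>
  Write \<open>quad a = {0, a, a', 1}\<close>. The basic elements of \<open>BSub A\<close> are exactly the sets
  \<open>quad a\<close>, so the poset \<open>BSub A\<close> sees the elements of \<open>A\<close> only up to the
  exchange of \<open>a\<close> and \<open>a'\<close>. A direction breaks this tie. An element \<open>a\<close> cuts every
  Boolean subalgebra \<open>y\<close> that contains it into two pieces, \<open>\<down>a \<union> \<up>a'\<close> and
  \<open>\<down>a' \<union> \<up>a\<close> (computed in \<open>y\<close>), and the order in which the pieces are listed
  distinguishes \<open>a\<close> from \<open>a'\<close>. The map \<open>direction_of\<close> sends \<open>a\<close> to this family
  of ordered pairs. Once it is known to be a bijection onto the directions that carries \<open>\<oplus>\<close>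
  to the sum of directions, the orthoalgebra structure is transported along it.

  Three facts carry the argument.

  Inside one Boolean subalgebra: the dual modular elements of the lattice of subalgebras of a Boolean
  algebra are subalgebras \<open>I \<union> I'\<close> with \<open>I\<close> an ideal (\<open>dual_modular_ideal\<close>), and
  the principal pairs for \<open>quad a\<close> are therefore the two pieces above, in either order
  (\<open>principal_pair_for_iff\<close>). These computations take place in a Stone representation, where
  elements are sets.

  Between Boolean subalgebras: a subalgebra is Boolean if and only if any two of its elements have a
  Mackey decomposition and pairwise orthogonal triples have a sum (\<open>boolean_subalgebra_iff\<close>).
  Each condition concerns finitely many elements at a time, so it survives directed unions. Conversely,
  a finite orthogonal family with sum 1 generates a Boolean subalgebra isomorphic to its power set
  (\<open>span_representation\<close>), and merging two members of the family yields a subalgebra that it covers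
  (\<open>span_merge_covers\<close>).

  Globally: at each \<open>y\<close> a direction chooses one of the two orders, and the choice is the same for
  all \<open>y\<close> (\<open>direction_eq_direction_of\<close>). Restriction reduces this to two covers of
  \<open>quad a\<close>. Either they sit on opposite sides of \<open>a\<close>, and then \<open>b \<oplus> c = a'\<close> and
  \<open>e \<oplus> f = a\<close> give a sixteen-element Boolean subalgebra above both
  (\<open>opposite_covers_join\<close>), or the third axiom for directions provides an upper bound if the
  choices differ. In both cases the choice at the upper bound settles the matter.

  Properness makes \<open>quad a\<close> lie strictly below some Boolean subalgebra, where the two orders of the
  pair differ; this is why \<open>direction_of\<close> is injective.
\<close>

section \<open>Sets of subsets ordered by inclusion\<close>

definition incl_order :: "'x set set \<Rightarrow> 'x set gorder" where
  "incl_order C = \<lparr>carrier = C, eq = (=), le = (\<subseteq>)\<rparr>"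

lemma incl_order_simps [simp]:
  "carrier (incl_order C) = C" "x .=\<^bsub>incl_order C\<^esub> y \<longleftrightarrow> x = y" "x \<sqsubseteq>\<^bsub>incl_order C\<^esub> y \<longleftrightarrow> x \<subseteq> y"
  by (simp_all add: incl_order_def)

lemma incl_order_lless [simp]: "x \<sqsubset>\<^bsub>incl_order C\<^esub> y \<longleftrightarrow> x \<subset> y"
  by (auto simp: lless_def)

lemma partial_order_incl_order: "partial_order (incl_order C)"
  by unfold_locales (auto simp: incl_order_def)

lemma is_lub_incl_order:
  "is_lub (incl_order C) s D \<longleftrightarrow>
     s \<in> C \<and> (\<forall>x\<in>D \<inter> C. x \<subseteq> s) \<and> (\<forall>t\<in>C. (\<forall>x\<in>D \<inter> C. x \<subseteq> t) \<longrightarrow> s \<subseteq> t)"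
  unfolding least_def Upper_def by simp blast

lemma is_glb_incl_order:
  "is_glb (incl_order C) s D \<longleftrightarrow>
     s \<in> C \<and> (\<forall>x\<in>D \<inter> C. s \<subseteq> x) \<and> (\<forall>t\<in>C. (\<forall>x\<in>D \<inter> C. t \<subseteq> x) \<longrightarrow> t \<subseteq> s)"
  unfolding greatest_def Lower_def by simp blast

lemma join_eqI: "partial_order L \<Longrightarrow> is_lub L s {x, y} \<Longrightarrow> x \<squnion>\<^bsub>L\<^esub> y = s"
  unfolding join_def sup_def by (metis partial_order.least_unique someI_ex)

lemma meet_eqI: "partial_order L \<Longrightarrow> is_glb L s {x, y} \<Longrightarrow> x \<sqinter>\<^bsub>L\<^esub> y = s"
  unfolding meet_def inf_def by (metis partial_order.greatest_unique someI_ex)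

lemma bottom_eqI: "partial_order L \<Longrightarrow> least L b (carrier L) \<Longrightarrow> \<bottom>\<^bsub>L\<^esub> = b"
  unfolding bottom_def by (metis partial_order.least_unique someI_ex)

lemma top_eqI: "partial_order L \<Longrightarrow> greatest L b (carrier L) \<Longrightarrow> \<top>\<^bsub>L\<^esub> = b"
  unfolding top_def by (metis partial_order.greatest_unique someI_ex)

lemma join_incl_order:
  "\<lbrakk>s \<in> C; x \<subseteq> s; y \<subseteq> s; \<And>t. t \<in> C \<Longrightarrow> x \<subseteq> t \<Longrightarrow> y \<subseteq> t \<Longrightarrow> s \<subseteq> t; x \<in> C; y \<in> C\<rbrakk>
    \<Longrightarrow> x \<squnion>\<^bsub>incl_order C\<^esub> y = s"
  by (rule join_eqI[OF partial_order_incl_order]) (auto simp: is_lub_incl_order)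

lemma meet_incl_order: "\<lbrakk>x \<in> C; y \<in> C; x \<inter> y \<in> C\<rbrakk> \<Longrightarrow> x \<sqinter>\<^bsub>incl_order C\<^esub> y = x \<inter> y"
  by (rule meet_eqI[OF partial_order_incl_order]) (auto simp: is_glb_incl_order)

lemma bottom_incl_order: "b \<in> C \<Longrightarrow> (\<And>x. x \<in> C \<Longrightarrow> b \<subseteq> x) \<Longrightarrow> \<bottom>\<^bsub>incl_order C\<^esub> = b"
  by (rule bottom_eqI[OF partial_order_incl_order]) (auto simp: least_def)

lemma top_incl_order: "b \<in> C \<Longrightarrow> (\<And>x. x \<in> C \<Longrightarrow> x \<subseteq> b) \<Longrightarrow> \<top>\<^bsub>incl_order C\<^esub> = b"
  by (rule top_eqI[OF partial_order_incl_order]) (auto simp: greatest_def)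

lemma covers_incl_order:
  "covers (incl_order C) x y \<longleftrightarrow> x \<in> C \<and> y \<in> C \<and> x \<subset> y \<and> (\<forall>z\<in>C. x \<subseteq> z \<longrightarrow> z \<subseteq> y \<longrightarrow> z = x \<or> z = y)"
  unfolding covers_def by simp blast

lemma downset_incl_order: "downset (incl_order C) x = incl_order {y \<in> C. y \<subseteq> x}"
  by (simp add: downset_def incl_order_def)

lemma upset_incl_order: "upset (incl_order C) x = {y \<in> C. x \<subseteq> y}"
  by (simp add: upset_def incl_order_def)

section \<open>Boolean algebras represented by sets\<close>

text \<open>A Boolean algebra on \<open>S\<close>, given by an embedding \<open>h\<close> into the subsets of \<open>h one\<close>. Identities
  and inclusions between elements become statements about sets.\<close>

locale set_representation =
  fixes S :: "'a set" and zer one :: 'a and cm :: "'a \<Rightarrow> 'a" and h :: "'a \<Rightarrow> 'c set"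
  assumes inj: "inj_on h S"
    and zer_in [simp, intro]: "zer \<in> S" and one_in [simp, intro]: "one \<in> S"
    and cm_in [simp, intro]: "a \<in> S \<Longrightarrow> cm a \<in> S"
    and h_zer [simp]: "h zer = {}"
    and h_le_one: "a \<in> S \<Longrightarrow> h a \<subseteq> h one"
    and h_cm [simp]: "a \<in> S \<Longrightarrow> h (cm a) = h one - h a"
    and meet_ex: "\<lbrakk>a \<in> S; b \<in> S\<rbrakk> \<Longrightarrow> \<exists>c\<in>S. h c = h a \<inter> h b"
begin

lemma eqI: "a \<in> S \<Longrightarrow> b \<in> S \<Longrightarrow> h a = h b \<Longrightarrow> a = b"
  using inj by (auto dest: inj_onD)

lemma h_eq_iff: "a \<in> S \<Longrightarrow> b \<in> S \<Longrightarrow> h a = h b \<longleftrightarrow> a = b"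
  using inj by (auto dest: inj_onD)

definition mt :: "'a \<Rightarrow> 'a \<Rightarrow> 'a" where "mt a b = inv_into S h (h a \<inter> h b)"

lemma mt_in [simp, intro]: "a \<in> S \<Longrightarrow> b \<in> S \<Longrightarrow> mt a b \<in> S"
  unfolding mt_def using meet_ex by (metis image_eqI inv_into_into)

lemma h_mt [simp]: "a \<in> S \<Longrightarrow> b \<in> S \<Longrightarrow> h (mt a b) = h a \<inter> h b"
  unfolding mt_def using meet_ex by (metis image_eqI f_inv_into_f)

definition jn :: "'a \<Rightarrow> 'a \<Rightarrow> 'a" where "jn a b = cm (mt (cm a) (cm b))"

lemma jn_in [simp, intro]: "a \<in> S \<Longrightarrow> b \<in> S \<Longrightarrow> jn a b \<in> S"
  by (simp add: jn_def)

lemma h_jn [simp]: "a \<in> S \<Longrightarrow> b \<in> S \<Longrightarrow> h (jn a b) = h a \<union> h b"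
  using h_le_one by (auto simp: jn_def)

lemma cm_cm [simp]: "a \<in> S \<Longrightarrow> cm (cm a) = a"
  by (rule eqI) (use h_le_one in auto)

lemma cm_one [simp]: "cm one = zer" and cm_zer [simp]: "cm zer = one"
  by (rule eqI; simp)+

definition alg :: "'a gorder" where
  "alg = \<lparr>carrier = S, eq = (=), le = (\<lambda>x y. h x \<subseteq> h y)\<rparr>"

lemma alg_simps [simp]:
  "carrier alg = S" "x .=\<^bsub>alg\<^esub> y \<longleftrightarrow> x = y" "x \<sqsubseteq>\<^bsub>alg\<^esub> y \<longleftrightarrow> h x \<subseteq> h y"
  by (simp_all add: alg_def)

lemma alg_partial_order: "partial_order alg"
  by unfold_locales (auto simp: alg_def intro: eqI)

lemma alg_lub: "a \<in> S \<Longrightarrow> b \<in> S \<Longrightarrow> is_lub alg (jn a b) {a, b}"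
  by (auto simp: least_def Upper_def)

lemma alg_glb: "a \<in> S \<Longrightarrow> b \<in> S \<Longrightarrow> is_glb alg (mt a b) {a, b}"
  by (auto simp: greatest_def Lower_def)

lemma alg_ops [simp]:
  "a \<in> S \<Longrightarrow> b \<in> S \<Longrightarrow> a \<squnion>\<^bsub>alg\<^esub> b = jn a b"
  "a \<in> S \<Longrightarrow> b \<in> S \<Longrightarrow> a \<sqinter>\<^bsub>alg\<^esub> b = mt a b"
  "\<bottom>\<^bsub>alg\<^esub> = zer" "\<top>\<^bsub>alg\<^esub> = one"
     apply (rule join_eqI[OF alg_partial_order alg_lub]; simp)
    apply (rule meet_eqI[OF alg_partial_order alg_glb]; simp)
   apply (rule bottom_eqI[OF alg_partial_order]; simp add: least_def)
  apply (rule top_eqI[OF alg_partial_order]; simp add: greatest_def h_le_one)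
  done

lemma alg_complement: "is_complement alg a b \<longleftrightarrow> a \<in> S \<and> b = cm a"
proof -
  have "b = cm a" if "a \<in> S" "b \<in> S" "mt a b = zer" "jn a b = one"
  proof -
    have "h a \<inter> h b = {}" "h a \<union> h b = h one"
      using that by (metis h_mt h_zer) (use that in \<open>metis h_jn\<close>)
    then show ?thesis using that by (intro eqI) auto
  qed
  moreover have "mt a (cm a) = zer" "jn a (cm a) = one" if "a \<in> S"
    using that h_le_one[OF that] by (auto intro!: eqI)
  ultimately show ?thesis by (auto simp: is_complement_def)
qed

text \<open>The order pulled back along \<open>h\<close> meets the lattice-theoretic definition of Boolean algebras, with meet,
  join and complement computed by intersection, union and difference.\<close>

lemma alg_boolean_lattice: "boolean_lattice alg"
proof -
  interpret partial_order alg by (rule alg_partial_order)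
  show ?thesis
  proof
    show "\<exists>s. is_lub alg s {x, y}" if "x \<in> carrier alg" "y \<in> carrier alg" for x y
      using alg_lub that by auto
    show "\<exists>s. is_glb alg s {x, y}" if "x \<in> carrier alg" "y \<in> carrier alg" for x y
      using alg_glb that by auto
    show "\<exists>b. least alg b (carrier alg)" by (auto simp: least_def intro!: exI[of _ zer])
    show "\<exists>b. greatest alg b (carrier alg)" using h_le_one
      by (auto simp: greatest_def intro!: exI[of _ one])
    show "a \<sqinter>\<^bsub>alg\<^esub> (b \<squnion>\<^bsub>alg\<^esub> c) = a \<sqinter>\<^bsub>alg\<^esub> b \<squnion>\<^bsub>alg\<^esub> (a \<sqinter>\<^bsub>alg\<^esub> c)"
      if "a \<in> carrier alg" "b \<in> carrier alg" "c \<in> carrier alg" for a b c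
      using that by (auto intro!: eqI)
    show "\<exists>b. is_complement alg a b" if "a \<in> carrier alg" for a
      using that by (auto simp: alg_complement)
  qed
qed

definition sub :: "'a set \<Rightarrow> bool" where
  "sub T \<longleftrightarrow> T \<subseteq> S \<and> one \<in> T \<and> (\<forall>a\<in>T. cm a \<in> T) \<and> (\<forall>a\<in>T. \<forall>b\<in>T. mt a b \<in> T)"

lemma subD:
  assumes "sub T"
  shows "T \<subseteq> S" "one \<in> T" "zer \<in> T" "a \<in> T \<Longrightarrow> cm a \<in> T"
    "a \<in> T \<Longrightarrow> b \<in> T \<Longrightarrow> mt a b \<in> T" "a \<in> T \<Longrightarrow> b \<in> T \<Longrightarrow> jn a b \<in> T"
  using assms unfolding sub_def jn_def by (auto simp: cm_one[symmetric] simp del: cm_one)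

lemma bool_subalgebras_alg: "bool_subalgebras alg = incl_order {T. sub T}"
proof -
  have "T \<subseteq> S \<and> zer \<in> T \<and> one \<in> T \<and>
       (\<forall>a\<in>T. \<forall>b\<in>T. a \<sqinter>\<^bsub>alg\<^esub> b \<in> T \<and> a \<squnion>\<^bsub>alg\<^esub> b \<in> T) \<and>
       (\<forall>a\<in>T. \<forall>b. is_complement alg a b \<longrightarrow> b \<in> T) \<longleftrightarrow> sub T" for T
  proof
    assume "sub T"
    then show "T \<subseteq> S \<and> zer \<in> T \<and> one \<in> T \<and>
       (\<forall>a\<in>T. \<forall>b\<in>T. a \<sqinter>\<^bsub>alg\<^esub> b \<in> T \<and> a \<squnion>\<^bsub>alg\<^esub> b \<in> T) \<and>
       (\<forall>a\<in>T. \<forall>b. is_complement alg a b \<longrightarrow> b \<in> T)"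
      using subD[of T] by (auto simp: alg_complement subset_iff)
  qed (auto simp: sub_def alg_complement subset_iff)
  then show ?thesis by (simp add: bool_subalgebras_def incl_order_def)
qed

end

section \<open>The lattice of subalgebras\<close>

context set_representation
begin

lemma sub_all: "sub S"
  by (auto simp: sub_def)

lemma sub_Inter: "\<lbrakk>\<T> \<noteq> {}; \<And>T. T \<in> \<T> \<Longrightarrow> sub T\<rbrakk> \<Longrightarrow> sub (\<Inter>\<T>)"
  unfolding sub_def by blast

lemma sub_Int: "sub T \<Longrightarrow> sub U \<Longrightarrow> sub (T \<inter> U)"
  unfolding sub_def by blast

definition gen :: "'a set \<Rightarrow> 'a set" where "gen X = \<Inter>{T. sub T \<and> X \<subseteq> T}"

lemma sub_gen: "X \<subseteq> S \<Longrightarrow> sub (gen X)"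
  unfolding gen_def using sub_all by (intro sub_Inter) auto

lemma gen_upper: "X \<subseteq> gen X" and gen_least: "sub T \<Longrightarrow> X \<subseteq> T \<Longrightarrow> gen X \<subseteq> T"
  unfolding gen_def by auto

abbreviation Sub :: "'a set gorder" where "Sub \<equiv> incl_order {T. sub T}"

lemma Sub_join: "sub T \<Longrightarrow> sub U \<Longrightarrow> T \<squnion>\<^bsub>Sub\<^esub> U = gen (T \<union> U)"
  using gen_upper[of "T \<union> U"] gen_least[of _ "T \<union> U"] sub_gen[of "T \<union> U"]
  by (intro join_incl_order) (auto simp: subD(1))

lemma Sub_meet: "sub T \<Longrightarrow> sub U \<Longrightarrow> T \<sqinter>\<^bsub>Sub\<^esub> U = T \<inter> U"
  by (rule meet_incl_order) (auto simp: sub_Int)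

lemma sub_two: "sub {zer, one}"
proof -
  have "mt a b \<in> {zer, one}" if "a \<in> {zer, one}" "b \<in> {zer, one}" for a b
  proof -
    have "mt a b = (if a = one then b else zer)"
      using that by (intro eqI) auto
    then show ?thesis using that by auto
  qed
  then show ?thesis by (auto simp: sub_def)
qed

lemma Sub_bottom: "\<bottom>\<^bsub>Sub\<^esub> = {zer, one}"
  by (rule bottom_incl_order) (use sub_two in \<open>auto simp: subD\<close>)

lemma Sub_top: "\<top>\<^bsub>Sub\<^esub> = S"
  by (rule top_incl_order) (use sub_all in \<open>auto dest: subD(1)\<close>)

lemma Sub_lattice: "lattice Sub"
proof -
  interpret partial_order Sub by (rule partial_order_incl_order)
  show ?thesis
  proof
    fix T U assume "T \<in> carrier Sub" "U \<in> carrier Sub"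
    then have T: "sub T" "sub U" by auto
    then show "\<exists>s. is_lub Sub s {T, U}"
      using gen_upper[of "T \<union> U"] gen_least[of _ "T \<union> U"] sub_gen[of "T \<union> U"]
      by (intro exI[of _ "gen (T \<union> U)"]) (auto simp: is_lub_incl_order subD(1))
    show "\<exists>s. is_glb Sub s {T, U}"
      using T sub_Int[of T U] by (intro exI[of _ "T \<inter> U"]) (auto simp: is_glb_incl_order)
  qed
qed

definition four :: "'a \<Rightarrow> 'a set" where "four a = {zer, one, a, cm a}"

text \<open>The subalgebra \<open>\<down>a \<union> \<up>a'\<close>; that is, \<open>I \<union> I'\<close> for the principal ideal
  \<open>I = \<down>a\<close>.\<close>

definition down_up :: "'a \<Rightarrow> 'a set" where "down_up a = {t \<in> S. h t \<subseteq> h a \<or> h one - h a \<subseteq> h t}"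

lemma sub_down_up: "a \<in> S \<Longrightarrow> sub (down_up a)"
  unfolding sub_def down_up_def using h_le_one by auto

lemma four_cm: "a \<in> S \<Longrightarrow> four (cm a) = four a"
  by (auto simp: four_def)

lemma down_up_Int_down_up: "a \<in> S \<Longrightarrow> down_up a \<inter> down_up (cm a) = four a"
proof
  assume a: "a \<in> S"
  note le = h_le_one[OF a]
  show "four a \<subseteq> down_up a \<inter> down_up (cm a)"
    using a le by (auto simp: four_def down_up_def)
  show "down_up a \<inter> down_up (cm a) \<subseteq> four a"
  proof
    fix t assume "t \<in> down_up a \<inter> down_up (cm a)"
    then have t: "t \<in> S" and "h t = {} \<or> h t = h a \<or> h t = h one - h a \<or> h t = h one"
      using a le h_le_one[of t] unfolding down_up_def by auto
    then have "h t = h zer \<or> h t = h a \<or> h t = h (cm a) \<or> h t = h one" using a by simp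
    then show "t \<in> four a" using t a by (auto simp: four_def h_eq_iff simp del: h_cm h_zer)
  qed
qed

lemma sub_four: "a \<in> S \<Longrightarrow> sub (four a)"
  using sub_Int[OF sub_down_up sub_down_up, of a "cm a"] by (simp add: down_up_Int_down_up)

lemma h_four: "x \<in> four a \<Longrightarrow> a \<in> S \<Longrightarrow> h x = {} \<or> h x = h one \<or> h x = h a \<or> h x = h one - h a"
  by (auto simp: four_def)

lemma four_sub: "sub T \<Longrightarrow> a \<in> T \<Longrightarrow> four a \<subseteq> T"
  by (auto simp: four_def subD)

lemma basic_four:
  assumes "a \<in> S" shows "basic Sub (four a)"
proof (cases "a \<in> {zer, one}")
  case True
  then show ?thesis by (auto simp: basic_def Sub_bottom four_def)
next
  case False
  have "z = {zer, one} \<or> z = four a" if z: "sub z" "{zer, one} \<subseteq> z" "z \<subseteq> four a" for z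
  proof (cases "a \<in> z \<or> cm a \<in> z")
    case True
    then have "a \<in> z" using subD(4)[OF z(1), of "cm a"] assms by auto
    then show ?thesis using four_sub z by blast
  qed (use z in \<open>auto simp: four_def\<close>)
  then have "atom Sub (four a)"
    using False assms by (auto simp: atom_def Sub_bottom covers_incl_order sub_two sub_four) (auto simp: four_def)
  then show ?thesis by (simp add: basic_def)
qed

text \<open>An element of \<open>down_up a \<squnion> Y\<close> is arbitrary below \<open>a\<close>, while its part outside
  \<open>a\<close> must be cut out by an element of \<open>Y\<close>.\<close>

lemma gen_down_up_Un:
  assumes a: "a \<in> S" and Y: "sub Y"
  shows "gen (down_up a \<union> Y) = {t \<in> S. \<exists>s\<in>Y. h t - h a = h s - h a}" (is "_ = ?J")
proof
  note Y' = subD[OF Y]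
  have "sub ?J" unfolding sub_def
  proof (intro conjI ballI)
    show "one \<in> ?J" using Y' by auto
  next
    fix t assume "t \<in> ?J"
    then obtain s where "t \<in> S" "s \<in> Y" "h t - h a = h s - h a" by auto
    then show "cm t \<in> ?J" using Y' by (auto 0 3 intro!: bexI[of _ "cm s"] simp: subset_iff)
  next
    fix t u assume "t \<in> ?J" "u \<in> ?J"
    then obtain s r where st: "t \<in> S" "s \<in> Y" "h t - h a = h s - h a"
      "u \<in> S" "r \<in> Y" "h u - h a = h r - h a" by auto
    moreover have "s \<in> S" "r \<in> S" using st Y'(1) by auto
    ultimately have "h (mt t u) - h a = h (mt s r) - h a" by auto
    then show "mt t u \<in> ?J" using st Y' by blast
  qed auto
  moreover have "down_up a \<subseteq> ?J"
  proof
    fix t assume t: "t \<in> down_up a"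
    then have "h t - h a = h zer - h a \<or> h t - h a = h one - h a"
      using h_le_one[of t] by (auto simp: down_up_def)
    then show "t \<in> ?J" using t Y'(2,3) unfolding down_up_def by blast
  qed
  moreover have "Y \<subseteq> ?J" using Y'(1) by auto
  ultimately show "gen (down_up a \<union> Y) \<subseteq> ?J" by (intro gen_least) auto
  show "?J \<subseteq> gen (down_up a \<union> Y)"
  proof
    fix t assume "t \<in> ?J"
    then obtain s where t: "t \<in> S" "s \<in> Y" "h t - h a = h s - h a" by auto
    have G: "sub (gen (down_up a \<union> Y))" using sub_gen Y'(1) subD(1)[OF sub_down_up[OF a]] by auto
    have s: "s \<in> S" using t Y' by auto
    have "mt t a \<in> gen (down_up a \<union> Y)" "cm a \<in> gen (down_up a \<union> Y)" "s \<in> gen (down_up a \<union> Y)"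
      using gen_upper[of "down_up a \<union> Y"] t a by (auto simp: down_up_def)
    then have "jn (mt t a) (mt s (cm a)) \<in> gen (down_up a \<union> Y)" by (simp add: subD(4-6)[OF G])
    moreover have "jn (mt t a) (mt s (cm a)) = t"
      using t a s h_le_one[of t] h_le_one[of s] by (intro eqI) auto
    ultimately show "t \<in> gen (down_up a \<union> Y)" by simp
  qed
qed

text \<open>Both modular laws come from the description of the join by \<open>gen_down_up_Un\<close>: an element of the join and
  the element \<open>s\<close> that witnesses its membership differ only below \<open>a\<close>, and everything below
  \<open>a\<close> belongs to \<open>down_up a\<close>.\<close>

lemma dual_modular_down_up:
  assumes a: "a \<in> S"
  shows "dual_modular Sub (down_up a)"
  unfolding dual_modular_def
proof (intro conjI ballI impI)
  show "down_up a \<in> carrier Sub" using sub_down_up[OF a] by simp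
next
  fix Y Z assume YZ: "Y \<in> carrier Sub" "Z \<in> carrier Sub" "down_up a \<sqsubseteq>\<^bsub>Sub\<^esub> Z"
  then have Y: "sub Y" and Z: "sub Z" and le: "down_up a \<subseteq> Z" by auto
  have "gen (down_up a \<union> Y) \<inter> Z = gen (down_up a \<union> (Y \<inter> Z))"
  proof
    show "gen (down_up a \<union> Y) \<inter> Z \<subseteq> gen (down_up a \<union> (Y \<inter> Z))"
    proof
      fix t assume "t \<in> gen (down_up a \<union> Y) \<inter> Z"
      then obtain s where t: "t \<in> S" "t \<in> Z" "s \<in> Y" "h t - h a = h s - h a"
        by (auto simp: gen_down_up_Un a Y)
      have s: "s \<in> S" using t subD(1)[OF Y] by auto
      have "mt s a \<in> Z" "cm a \<in> Z" using le a s by (auto simp: down_up_def)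
      then have "jn (mt s a) (mt t (cm a)) \<in> Z" using t by (simp add: subD(4-6)[OF Z])
      moreover have "jn (mt s a) (mt t (cm a)) = s"
        using t a s h_le_one[of t] h_le_one[of s] by (intro eqI) auto
      ultimately show "t \<in> gen (down_up a \<union> (Y \<inter> Z))"
        using t by (auto simp: gen_down_up_Un a Y Z sub_Int)
    qed
    show "gen (down_up a \<union> (Y \<inter> Z)) \<subseteq> gen (down_up a \<union> Y) \<inter> Z"
      using gen_least[OF Z, of "down_up a \<union> (Y \<inter> Z)"] le by (auto simp: gen_down_up_Un a Y Z sub_Int)
  qed
  then show "(down_up a \<squnion>\<^bsub>Sub\<^esub> Y) \<sqinter>\<^bsub>Sub\<^esub> Z = down_up a \<squnion>\<^bsub>Sub\<^esub> (Y \<sqinter>\<^bsub>Sub\<^esub> Z)"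
    using Y Z by (simp add: Sub_join Sub_meet sub_down_up a sub_Int sub_gen subD(1))
next
  fix W Y assume WY: "W \<in> carrier Sub" "Y \<in> carrier Sub" "W \<sqsubseteq>\<^bsub>Sub\<^esub> Y"
  then have W: "sub W" and Y: "sub Y" and le: "W \<subseteq> Y" by auto
  have "gen (down_up a \<union> W) \<inter> Y = gen (W \<union> (down_up a \<inter> Y))"
  proof
    have G: "sub (gen (W \<union> (down_up a \<inter> Y)))"
      using subD(1)[OF W] subD(1)[OF Y] by (intro sub_gen) auto
    show "gen (down_up a \<union> W) \<inter> Y \<subseteq> gen (W \<union> (down_up a \<inter> Y))"
    proof
      fix t assume "t \<in> gen (down_up a \<union> W) \<inter> Y"
      then obtain s where t: "t \<in> S" "t \<in> Y" "s \<in> W" "h t - h a = h s - h a"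
        by (auto simp: gen_down_up_Un a W)
      have s: "s \<in> S" using t subD(1)[OF W] by auto
      have hh: "h t \<subseteq> h one" "h s \<subseteq> h one" using t s h_le_one by auto
      \<comment> \<open>\<open>u\<close> and \<open>v\<close> are the two halves of the symmetric difference of \<open>s\<close> and \<open>t\<close>, which lies below \<open>a\<close>.\<close>
      define u v where "u = mt t (cm s)" and "v = mt s (cm t)"
      have "s \<in> Y" using t le by blast
      then have "u \<in> Y" "v \<in> Y" using t(2) subD(4,5)[OF Y] unfolding u_def v_def by blast+
      moreover have "h u \<subseteq> h a" "h v \<subseteq> h a" "u \<in> S" "v \<in> S"
        using t(1,4) s by (auto simp: u_def v_def)
      ultimately have "u \<in> down_up a \<inter> Y" "v \<in> down_up a \<inter> Y"
        by (simp_all add: down_up_def)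
      then have "u \<in> gen (W \<union> (down_up a \<inter> Y))" "v \<in> gen (W \<union> (down_up a \<inter> Y))" "s \<in> gen (W \<union> (down_up a \<inter> Y))"
        using gen_upper[of "W \<union> (down_up a \<inter> Y)"] t by auto
      then have "jn (mt s (cm v)) u \<in> gen (W \<union> (down_up a \<inter> Y))" by (simp add: subD(4-6)[OF G])
      moreover have "jn (mt s (cm v)) u = t"
      proof (rule eqI)
        have "h s \<inter> (h one - h s \<inter> (h one - h t)) \<union> h t \<inter> (h one - h s) = h t"
          using hh by blast
        then show "h (jn (mt s (cm v)) u) = h t" using t s by (simp add: u_def v_def)
      qed (use t s in \<open>simp_all add: u_def v_def\<close>)
      ultimately show "t \<in> gen (W \<union> (down_up a \<inter> Y))" by simp
    qed
    show "gen (W \<union> (down_up a \<inter> Y)) \<subseteq> gen (down_up a \<union> W) \<inter> Y"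
    proof (rule gen_least)
      have "down_up a \<union> W \<subseteq> S" using subD(1)[OF W] subD(1)[OF sub_down_up[OF a]] by blast
      then show "sub (gen (down_up a \<union> W) \<inter> Y)" by (intro sub_Int sub_gen Y)
      show "W \<union> (down_up a \<inter> Y) \<subseteq> gen (down_up a \<union> W) \<inter> Y"
        using gen_upper[of "down_up a \<union> W"] le by blast
    qed
  qed
  then show "(W \<squnion>\<^bsub>Sub\<^esub> down_up a) \<sqinter>\<^bsub>Sub\<^esub> Y = W \<squnion>\<^bsub>Sub\<^esub> (down_up a \<sqinter>\<^bsub>Sub\<^esub> Y)"
    using W Y by (simp add: Sub_join Sub_meet sub_down_up a sub_Int sub_gen subD(1) Un_commute)
qed

section \<open>Dual modular elements and principal pairs\<close>

lemma dual_modular_sub: "dual_modular Sub M \<Longrightarrow> sub M"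
  unfolding dual_modular_def by simp

text \<open>A dual modular subalgebra contains, with each \<open>c\<close>, everything below \<open>c\<close> or everything below
  \<open>c'\<close>. Hence it has the form \<open>I \<union> I'\<close> for the ideal \<open>I\<close> of those \<open>c\<close>
  whose lower set it contains.\<close>

lemma dual_modular_ideal:
  assumes M: "dual_modular Sub M" and c: "c \<in> M"
  shows "(\<forall>t\<in>S. h t \<subseteq> h c \<longrightarrow> t \<in> M) \<or> (\<forall>t\<in>S. h t \<subseteq> h (cm c) \<longrightarrow> t \<in> M)"
proof -
  have sM: "sub M" using M by (rule dual_modular_sub)
  note M' = subD[OF sM]
  have cS: "c \<in> S" using c M' by auto
  \<comment> \<open>The second modular law for \<open>four b \<subseteq> down_up b\<close>: as \<open>b \<sqinter> c\<close> lies in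
    \<open>(four b \<squnion> M) \<sqinter> down_up b\<close>, it is generated by \<open>b\<close> and \<open>M \<inter> down_up b\<close>.\<close>
  have key: "mt b c \<in> M \<or> mt b (cm c) \<in> M" if b: "b \<in> S" for b
  proof -
    have le: "four b \<subseteq> down_up b" using down_up_Int_down_up[OF b] by auto
    have sF: "four b \<union> M \<subseteq> S" "four b \<union> (M \<inter> down_up b) \<subseteq> S"
      using subD(1)[OF sub_four[OF b]] M'(1) by auto
    have "(four b \<squnion>\<^bsub>Sub\<^esub> M) \<sqinter>\<^bsub>Sub\<^esub> down_up b = four b \<squnion>\<^bsub>Sub\<^esub> (M \<sqinter>\<^bsub>Sub\<^esub> down_up b)"
      using M le b by (auto simp: dual_modular_def sub_four sub_down_up)
    then have eq: "gen (four b \<union> M) \<inter> down_up b = gen (four b \<union> (M \<inter> down_up b))"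
      using sM b sub_gen[OF sF(1)] by (simp add: Sub_join Sub_meet sub_four sub_down_up sub_Int)
    have "b \<in> gen (four b \<union> M)" "c \<in> gen (four b \<union> M)"
      using gen_upper[of "four b \<union> M"] c by (auto simp: four_def)
    then have "mt b c \<in> gen (four b \<union> M)" using subD(5)[OF sub_gen[OF sF(1)]] by blast
    moreover have "mt b c \<in> down_up b" using b cS by (auto simp: down_up_def)
    ultimately have in_gen: "mt b c \<in> gen (four b \<union> (M \<inter> down_up b))" using eq by blast
    \<comment> \<open>An explicit subalgebra containing \<open>four b \<union> (M \<inter> down_up b)\<close>; on the part below \<open>b\<close> it is
      generated by the elements of \<open>M\<close> below \<open>b\<close>.\<close>
    define U where "U = {t \<in> S. \<exists>d\<in>M. h d \<subseteq> h b \<and> (h t \<inter> h b = h d \<or> h t \<inter> h b = h b - h d)}"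
    have UI: "t \<in> U" if "t \<in> S" "d \<in> M" "h d \<subseteq> h b" "h t \<inter> h b = h d \<or> h t \<inter> h b = h b - h d" for t d
      using that by (auto simp: U_def)
    have bo: "h b \<subseteq> h one" using h_le_one[OF b] .
    have "sub U" unfolding sub_def
    proof (intro conjI ballI)
      show "U \<subseteq> S" by (auto simp: U_def)
      show "one \<in> U" by (rule UI[of _ zer]) (use M' bo in auto)
    next
      fix t assume "t \<in> U"
      then obtain d where d: "t \<in> S" "d \<in> M" "h d \<subseteq> h b" "h t \<inter> h b = h d \<or> h t \<inter> h b = h b - h d"
        by (auto simp: U_def)
      show "cm t \<in> U" by (rule UI[of _ d]) (use d bo in auto)
    next
      fix t u assume "t \<in> U" "u \<in> U"
      then obtain d e where d: "t \<in> S" "d \<in> M" "h d \<subseteq> h b" "h t \<inter> h b = h d \<or> h t \<inter> h b = h b - h d"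
        and e: "u \<in> S" "e \<in> M" "h e \<subseteq> h b" "h u \<inter> h b = h e \<or> h u \<inter> h b = h b - h e"
        by (auto simp: U_def)
      have de: "d \<in> S" "e \<in> S" using d e M'(1) by auto
      have cl: "mt d e \<in> M" "mt d (cm e) \<in> M" "mt e (cm d) \<in> M" "jn d e \<in> M"
        using d(2) e(2) by (simp_all add: M'(4-6))
      consider "h t \<inter> h b = h d" "h u \<inter> h b = h e" | "h t \<inter> h b = h d" "h u \<inter> h b = h b - h e"
        | "h t \<inter> h b = h b - h d" "h u \<inter> h b = h e" | "h t \<inter> h b = h b - h d" "h u \<inter> h b = h b - h e"
        using d e by blast
      then show "mt t u \<in> U"
      proof cases
        case 1 show ?thesis by (rule UI[OF _ cl(1)]) (use d e de 1 bo in auto)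
      next
        case 2 show ?thesis by (rule UI[OF _ cl(2)]) (use d e de 2 bo in auto)
      next
        case 3 show ?thesis by (rule UI[OF _ cl(3)]) (use d e de 3 bo in auto)
      next
        case 4 show ?thesis by (rule UI[OF _ cl(4)]) (use d e de 4 bo in auto)
      qed
    qed
    moreover have "four b \<subseteq> U"
    proof -
      have "b \<in> U" by (rule UI[of _ zer]) (use M' b in auto)
      then show ?thesis using \<open>sub U\<close> four_sub by blast
    qed
    moreover have "M \<inter> down_up b \<subseteq> U"
    proof
      fix t assume t: "t \<in> M \<inter> down_up b"
      then have tS: "t \<in> S" using M' by auto
      show "t \<in> U"
      proof (cases "h t \<subseteq> h b")
        case True
        show ?thesis by (rule UI[of _ t]) (use t tS True in auto)
      next
        case False
        then have "h one - h b \<subseteq> h t" using t by (auto simp: down_up_def)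
        then show ?thesis by (intro UI[of _ "cm t"]) (use t tS bo M' in auto)
      qed
    qed
    ultimately have "mt b c \<in> U" using gen_least[of U "four b \<union> (M \<inter> down_up b)"] in_gen by blast
    then obtain d where d: "d \<in> M" "h d \<subseteq> h b" "h b \<inter> h c = h d \<or> h b \<inter> h c = h b - h d"
      using b cS by (auto simp: U_def)
    have dS: "d \<in> S" using d M' by auto
    have "mt b c = d \<or> mt b (cm c) = d"
      using d(3)
    proof
      assume "h b \<inter> h c = h d"
      then have "mt b c = d" using b cS dS by (intro eqI) auto
      then show ?thesis ..
    next
      assume "h b \<inter> h c = h b - h d"
      then have "h b \<inter> (h one - h c) = h d" using d(2) bo by auto
      then have "mt b (cm c) = d" using b cS dS by (intro eqI) auto
      then show ?thesis ..
    qed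
    then show ?thesis using d by auto
  qed
  show ?thesis
  proof (rule ccontr)
    assume "\<not> ?thesis"
    then obtain p q where p: "p \<in> S" "h p \<subseteq> h c" "p \<notin> M" and q: "q \<in> S" "h q \<subseteq> h (cm c)" "q \<notin> M"
      by blast
    \<comment> \<open>The element \<open>b = p \<squnion> q\<close> violates \<open>key\<close>.\<close>
    have "mt (jn p q) c = p" "mt (jn p q) (cm c) = q"
      using p q cS by (auto intro!: eqI)
    then show False using key[of "jn p q"] p q by auto
  qed
qed

text \<open>If nothing lies strictly between \<open>0\<close> and \<open>a\<close>, the pair of pieces degenerates to
  \<open>four a\<close> and the whole algebra: every element is disjoint from \<open>a\<close> or above it.\<close>

lemma down_up_eq_four:
  assumes a: "a \<in> S" and *: "\<And>t. t \<in> S \<Longrightarrow> h t \<subseteq> h a \<Longrightarrow> t \<in> four a"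
  shows "down_up a = four a" "down_up (cm a) = S"
proof -
  have sa: "sub (four a)" using a by (rule sub_four)
  have "down_up a \<subseteq> four a"
  proof
    fix t assume t: "t \<in> down_up a"
    show "t \<in> four a"
    proof (cases "h t \<subseteq> h a")
      case False
      then have "h (cm t) \<subseteq> h a" "cm t \<in> S" using t h_le_one[of t] by (auto simp: down_up_def)
      then have "cm (cm t) \<in> four a" using * subD(4)[OF sa] by blast
      then show ?thesis using t by (simp add: down_up_def)
    qed (use t * in \<open>auto simp: down_up_def\<close>)
  qed
  then show "down_up a = four a" using down_up_Int_down_up[OF a] by auto
  show "down_up (cm a) = S"
  proof
    show "S \<subseteq> down_up (cm a)"
    proof
      fix t assume t: "t \<in> S"
      have "mt t a \<in> four a" using * t a by auto
      then have "h t \<inter> h a = {} \<or> h t \<inter> h a = h one \<or> h t \<inter> h a = h a \<or> h t \<inter> h a = h one - h a"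
        using t a h_four[of "mt t a" a] by auto
      then show "t \<in> down_up (cm a)" using t a h_le_one[of t] h_le_one[of a] by (auto simp: down_up_def)
    qed
  qed (auto simp: down_up_def)
qed

lemma down_up_eq_if_dual_modular_four:
  assumes a: "a \<in> S" and M: "dual_modular Sub (four a)"
  shows "down_up a = four a \<and> down_up (cm a) = S \<or> down_up (cm a) = four a \<and> down_up a = S"
  using dual_modular_ideal[OF M, of a] down_up_eq_four[OF a] down_up_eq_four[of "cm a"] a
  by (auto simp: four_def insert_commute)

text \<open>If \<open>y\<close> were to contain the lower set of some \<open>t\<close> that reaches beyond \<open>a\<close>, then
  \<open>t \<sqinter> a'\<close> would lie in \<open>y \<inter> z = four a\<close> and so equal \<open>a'\<close> or \<open>0\<close>; the
  first makes \<open>y\<close> everything and \<open>z = four a\<close> dual modular.\<close>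

lemma down_up_eq_if_ideals:
  assumes a: "a \<in> S" and y: "dual_modular Sub y" and z: "dual_modular Sub z"
    and yz: "y \<inter> z = four a" and nd: "\<not> dual_modular Sub (four a)"
    and ay: "\<And>t. t \<in> S \<Longrightarrow> h t \<subseteq> h a \<Longrightarrow> t \<in> y"
    and az: "\<And>t. t \<in> S \<Longrightarrow> h t \<subseteq> h (cm a) \<Longrightarrow> t \<in> z"
  shows "y = down_up a"
proof
  have sy: "sub y" using y by (rule dual_modular_sub)
  have small: "t \<in> down_up a" if t: "t \<in> S" and dn: "\<And>s. s \<in> S \<Longrightarrow> h s \<subseteq> h t \<Longrightarrow> s \<in> y" for t
  proof -
    have "mt t (cm a) \<in> four a" using yz dn az t a by auto
    moreover have "mt t (cm a) \<noteq> cm a \<or> a = one"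
    proof (rule ccontr)
      assume *: "\<not> ?thesis"
      then have "h (cm a) \<subseteq> h t" using h_mt[of t "cm a"] t a by (metis Int_lower1 cm_in)
      have "S \<subseteq> y"
      proof
        fix s assume s: "s \<in> S"
        have "mt s (cm a) \<in> y" "mt s a \<in> y"
          using dn[of "mt s (cm a)"] ay[of "mt s a"] \<open>h (cm a) \<subseteq> h t\<close> s a by auto
        then have "jn (mt s (cm a)) (mt s a) \<in> y" by (simp add: subD(4-6)[OF sy])
        moreover have "jn (mt s (cm a)) (mt s a) = s"
          using s a h_le_one[of s] by (intro eqI) auto
        ultimately show "s \<in> y" by simp
      qed
      moreover have "z \<subseteq> S" using subD(1)[OF dual_modular_sub[OF z]] .
      ultimately have "z = four a" using yz by auto
      then show False using z nd by simp
    qed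
    ultimately have "a = one \<or> mt t (cm a) = zer \<or> mt t (cm a) = one \<or> mt t (cm a) = a"
      by (auto simp: four_def)
    then have "a = one \<or> h (mt t (cm a)) = {} \<or> h (mt t (cm a)) = h one \<or> h (mt t (cm a)) = h a"
      by (metis h_zer)
    then show ?thesis using t a h_le_one[of t] by (auto simp: down_up_def)
  qed
  show "y \<subseteq> down_up a"
  proof
    fix t assume t: "t \<in> y"
    then have tS: "t \<in> S" using subD(1)[OF sy] by auto
    have "t \<in> down_up a \<or> cm t \<in> down_up a"
      using dual_modular_ideal[OF y t] small[OF tS] small[OF cm_in[OF tS]] by blast
    then show "t \<in> down_up a" using subD(4)[OF sub_down_up[OF a], of "cm t"] tS by auto
  qed
  show "down_up a \<subseteq> y"
  proof
    fix t assume t: "t \<in> down_up a"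
    show "t \<in> y"
    proof (cases "h t \<subseteq> h a")
      case False
      then have "h (cm t) \<subseteq> h a" "cm t \<in> S" using t h_le_one[of t] by (auto simp: down_up_def)
      then have "cm (cm t) \<in> y" using ay subD(4)[OF sy] by blast
      then show ?thesis using t by (simp add: down_up_def)
    qed (use t ay in \<open>auto simp: down_up_def\<close>)
  qed
qed

lemma eq_down_up_if_dual_modular_four:
  assumes a: "a \<in> S" and d: "dual_modular Sub (four a)"
    and P: "y = S \<and> z = four a \<or> z = S \<and> y = four a"
  shows "y = down_up a \<and> z = down_up (cm a) \<or> y = down_up (cm a) \<and> z = down_up a"
  using down_up_eq_if_dual_modular_four[OF a d] P by auto

text \<open>The ideals that define the two members of a principal pair split \<open>a\<close> and \<open>a'\<close> between them:
  if both contained the lower set of \<open>a\<close>, then \<open>\<down>a \<subseteq> four a\<close>, and \<open>four a\<close> would be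
  dual modular. The first two clauses in the definition of principal pairs cover the degenerate case in
  which \<open>four a\<close> is dual modular.\<close>

lemma principal_pair_for_iff:
  assumes a: "a \<in> S"
  shows "principal_pair_for Sub (four a) y z \<longleftrightarrow>
    y = down_up a \<and> z = down_up (cm a) \<or> y = down_up (cm a) \<and> z = down_up a"
proof
  assume pp: "principal_pair_for Sub (four a) y z"
  then have y: "dual_modular Sub y" and z: "dual_modular Sub z"
    unfolding principal_pair_for_def principal_pair_def by blast+
  then have sy: "sub y" "sub z" by (auto intro: dual_modular_sub)
  have yz: "y \<inter> z = four a" using pp by (simp add: principal_pair_for_def Sub_meet sy)
  consider (1) "y = S" | (2) "z = S" | (3) "\<not> dual_modular Sub (four a)"
    using pp yz unfolding principal_pair_for_def principal_pair_def Sub_top Sub_meet[OF sy] by metis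
  then show "y = down_up a \<and> z = down_up (cm a) \<or> y = down_up (cm a) \<and> z = down_up a"
  proof cases
    case 1
    then have "z = four a" using yz subD(1)[OF sy(2)] by auto
    then show ?thesis using eq_down_up_if_dual_modular_four[OF a] 1 z by auto
  next
    case 2
    then have "y = four a" using yz subD(1)[OF sy(1)] by auto
    then show ?thesis using eq_down_up_if_dual_modular_four[OF a] 2 y by auto
  next
    case 3
    define dn where "dn c M \<longleftrightarrow> (\<forall>t\<in>S. h t \<subseteq> h c \<longrightarrow> t \<in> M)" for c M
    have no: "\<not> (dn c y \<and> dn c z)" if c: "c \<in> S" "four c = four a" for c
    proof
      assume *: "dn c y \<and> dn c z"
      have "down_up c = four c"
      proof (rule down_up_eq_four(1)[OF c(1)])
        fix t assume "t \<in> S" "h t \<subseteq> h c"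
        then have "t \<in> y \<inter> z" using * by (auto simp: dn_def)
        then show "t \<in> four c" using yz c by simp
      qed
      then show False using dual_modular_down_up[OF c(1)] c 3 by simp
    qed
    have "a \<in> y" "a \<in> z" using yz by (auto simp: four_def)
    then have "dn a y \<or> dn (cm a) y" "dn a z \<or> dn (cm a) z"
      using dual_modular_ideal[OF y] dual_modular_ideal[OF z] by (auto simp: dn_def)
    then consider "dn a y" "dn (cm a) z" | "dn (cm a) y" "dn a z"
      using no[of a] no[of "cm a"] a four_cm by auto
    then show ?thesis
    proof cases
      case 1
      have "y = down_up a"
        using 1 by (intro down_up_eq_if_ideals[OF a y z yz 3]) (auto simp: dn_def)
      moreover have "z = down_up (cm a)"
        using 1 yz 3 a
        by (intro down_up_eq_if_ideals[of "cm a", OF _ z y]) (auto simp: dn_def four_cm)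
      ultimately show ?thesis by simp
    next
      case 2
      have "z = down_up a"
        using 2 yz by (intro down_up_eq_if_ideals[OF a z y _ 3]) (auto simp: dn_def)
      moreover have "y = down_up (cm a)"
        using 2 yz 3 a
        by (intro down_up_eq_if_ideals[of "cm a", OF _ y z]) (auto simp: dn_def four_cm)
      ultimately show ?thesis by simp
    qed
  qed
next
  have *: "principal_pair_for Sub (four c) (down_up c) (down_up (cm c))" if c: "c \<in> S" for c
  proof -
    have meet: "down_up c \<sqinter>\<^bsub>Sub\<^esub> down_up (cm c) = four c" using c by (simp add: Sub_meet sub_down_up down_up_Int_down_up)
    have "gen (down_up c \<union> down_up (cm c)) = S"
    proof -
      have "\<exists>s\<in>down_up (cm c). h t - h c = h s - h c" if t: "t \<in> S" for t
        using t c h_le_one[OF t] by (intro bexI[of _ "mt t (cm c)"]) (auto simp: down_up_def)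
      then show ?thesis using c by (auto simp: gen_down_up_Un sub_down_up)
    qed
    then have "down_up c \<squnion>\<^bsub>Sub\<^esub> down_up (cm c) = S" using c by (simp add: Sub_join sub_down_up)
    then have "principal_pair Sub (down_up c) (down_up (cm c))"
      unfolding principal_pair_def
      using down_up_eq_if_dual_modular_four[OF c] meet dual_modular_down_up c basic_four[OF c] Sub_top by auto
    then show ?thesis using meet by (simp add: principal_pair_for_def)
  qed
  assume "y = down_up a \<and> z = down_up (cm a) \<or> y = down_up (cm a) \<and> z = down_up a"
  then show "principal_pair_for Sub (four a) y z"
    using *[OF a] *[of "cm a"] a four_cm[OF a] by auto
qed

end

section \<open>Stone representation of orthocomplemented semilattices\<close>

text \<open>A meet semilattice with an involution such that disjointness means \<open>a \<le> b'\<close>. This is already a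
  Boolean algebra, but distributivity need not be verified beforehand: it follows from the
  representation by prime filters.\<close>

locale ortho_semilattice =
  fixes S :: "'a set" and le :: "'a \<Rightarrow> 'a \<Rightarrow> bool" and cm :: "'a \<Rightarrow> 'a" and zer :: 'a
  assumes refl: "a \<in> S \<Longrightarrow> le a a"
    and trans: "\<lbrakk>a \<in> S; b \<in> S; c \<in> S; le a b; le b c\<rbrakk> \<Longrightarrow> le a c"
    and antisym: "\<lbrakk>a \<in> S; b \<in> S; le a b; le b a\<rbrakk> \<Longrightarrow> a = b"
    and zer_in: "zer \<in> S" and zer_le: "a \<in> S \<Longrightarrow> le zer a"
    and cm_in: "a \<in> S \<Longrightarrow> cm a \<in> S" and cm_cm: "a \<in> S \<Longrightarrow> cm (cm a) = a"
    and glb: "\<lbrakk>a \<in> S; b \<in> S\<rbrakk> \<Longrightarrow>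
      \<exists>q\<in>S. le q a \<and> le q b \<and> (\<forall>c\<in>S. le c a \<longrightarrow> le c b \<longrightarrow> le c q)"
    and disjoint: "\<lbrakk>a \<in> S; b \<in> S\<rbrakk> \<Longrightarrow> le a (cm b) \<longleftrightarrow> (\<forall>c\<in>S. le c a \<longrightarrow> le c b \<longrightarrow> c = zer)"
begin

definition proper_filter :: "'a set \<Rightarrow> bool" where
  "proper_filter G \<longleftrightarrow> G \<subseteq> S \<and> G \<noteq> {} \<and> zer \<notin> G \<and>
     (\<forall>a\<in>G. \<forall>b\<in>S. le a b \<longrightarrow> b \<in> G) \<and> (\<forall>a\<in>G. \<forall>b\<in>G. \<exists>c\<in>G. le c a \<and> le c b)"

definition prime_filter :: "'a set \<Rightarrow> bool" where
  "prime_filter G \<longleftrightarrow> proper_filter G \<and> (\<forall>a\<in>S. a \<in> G \<or> cm a \<in> G)"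

text \<open>The upward closure of the meets of \<open>a\<close> with members of \<open>G\<close> is proper: if such a meet
  vanishes, then \<open>g \<le> a'\<close>, and \<open>a'\<close> belongs to \<open>G\<close>.\<close>

lemma proper_filter_extend:
  assumes G: "proper_filter G" and a: "a \<in> S" and ca: "cm a \<notin> G"
  shows "\<exists>F. proper_filter F \<and> G \<subseteq> F \<and> a \<in> F"
proof -
  have GS: "G \<subseteq> S" and up: "\<And>x y. x \<in> G \<Longrightarrow> y \<in> S \<Longrightarrow> le x y \<Longrightarrow> y \<in> G"
    and dir: "\<And>x y. x \<in> G \<Longrightarrow> y \<in> G \<Longrightarrow> \<exists>c\<in>G. le c x \<and> le c y" and ne: "G \<noteq> {}"
    using G unfolding proper_filter_def by blast+
  define is_meet where "is_meet q g \<longleftrightarrow> q \<in> S \<and> le q g \<and> le q a \<and> (\<forall>c\<in>S. le c g \<longrightarrow> le c a \<longrightarrow> le c q)" for q g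
  \<comment> \<open>\<open>is_meet q g\<close>: \<open>q\<close> is the meet of \<open>g\<close> and \<open>a\<close>.\<close>
  define F where "F = {t \<in> S. \<exists>g\<in>G. \<exists>q. is_meet q g \<and> le q t}"
  have ex: "\<exists>q. is_meet q g" if "g \<in> G" for g
    using glb[of g a] that a GS unfolding is_meet_def by blast
  have "G \<subseteq> F"
  proof
    fix t assume t: "t \<in> G"
    then obtain q where "is_meet q t" using ex by blast
    then show "t \<in> F" using t GS unfolding F_def is_meet_def by blast
  qed
  moreover have "a \<in> F"
  proof -
    obtain g q where "g \<in> G" "is_meet q g" using ne ex by blast
    then show ?thesis using a unfolding F_def is_meet_def by blast
  qed
  moreover have "proper_filter F"
    unfolding proper_filter_def
  proof (intro conjI ballI impI)
    show "F \<subseteq> S" by (auto simp: F_def)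
    show "F \<noteq> {}" using \<open>a \<in> F\<close> by auto
    show "zer \<notin> F"
    proof
      assume "zer \<in> F"
      then obtain g q where gq: "g \<in> G" "is_meet q g" "le q zer" by (auto simp: F_def)
      then have "q = zer" using antisym[of q zer] zer_le[of q] zer_in unfolding is_meet_def by blast
      then have "\<forall>c\<in>S. le c g \<longrightarrow> le c a \<longrightarrow> c = zer"
        using gq(2) antisym zer_le zer_in unfolding is_meet_def by blast
      then have "le g (cm a)" using disjoint gq GS a by blast
      then show False using up gq ca cm_in a by blast
    qed
    show "b \<in> F" if "t \<in> F" "b \<in> S" "le t b" for t b
      using that trans unfolding F_def is_meet_def by blast
    show "\<exists>c\<in>F. le c t \<and> le c u" if t: "t \<in> F" and u: "u \<in> F" for t u
    proof -
      obtain g q where g: "g \<in> G" "is_meet q g" "le q t" "t \<in> S" using t by (auto simp: F_def)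
      obtain k r where k: "k \<in> G" "is_meet r k" "le r u" "u \<in> S" using u by (auto simp: F_def)
      obtain l where l: "l \<in> G" "le l g" "le l k" using dir g k by blast
      obtain s where s: "is_meet s l" using ex l by blast
      have "s \<in> S" "le s a" "le s l" using s by (auto simp: is_meet_def)
      then have "le s g" "le s k" using trans[of s l g] trans[of s l k] l g k GS by auto
      then have "le s q" "le s r" using g k \<open>s \<in> S\<close> \<open>le s a\<close> by (auto simp: is_meet_def)
      then have "le s t" "le s u"
        using trans[of s q t] trans[of s r u] g k \<open>s \<in> S\<close> by (auto simp: is_meet_def)
      moreover have "s \<in> F" using s l \<open>s \<in> S\<close> refl unfolding F_def by blast
      ultimately show ?thesis by blast
    qed
  qed
  ultimately show ?thesis by blast
qed

lemma prime_filter_exists: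
  assumes c: "c \<in> S" "c \<noteq> zer"
  shows "\<exists>G. prime_filter G \<and> c \<in> G"
proof -
  let ?A = "{G. proper_filter G \<and> c \<in> G}"
  have "proper_filter {t \<in> S. le c t}"
    unfolding proper_filter_def
    using c refl trans antisym zer_le zer_in by blast
  then have "?A \<noteq> {}" using c refl by blast
  moreover have "\<Union>\<C> \<in> ?A" if "\<C> \<noteq> {}" "subset.chain ?A \<C>" for \<C>
  proof -
    have ch: "\<C> \<subseteq> ?A" "\<And>X Y. X \<in> \<C> \<Longrightarrow> Y \<in> \<C> \<Longrightarrow> X \<subseteq> Y \<or> Y \<subseteq> X"
      using that(2) unfolding subset.chain_def by auto
    have "proper_filter (\<Union>\<C>)"
      unfolding proper_filter_def
    proof (intro conjI ballI impI)
      show "\<Union>\<C> \<subseteq> S" "zer \<notin> \<Union>\<C>" "\<Union>\<C> \<noteq> {}"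
        using ch(1) that(1) unfolding proper_filter_def by auto
      show "b \<in> \<Union>\<C>" if "a \<in> \<Union>\<C>" "b \<in> S" "le a b" for a b
        using ch(1) that unfolding proper_filter_def by blast
      show "\<exists>d\<in>\<Union>\<C>. le d a \<and> le d b" if ab: "a \<in> \<Union>\<C>" "b \<in> \<Union>\<C>" for a b
      proof -
        obtain X where X: "X \<in> \<C>" "a \<in> X" "b \<in> X" using ab ch(2) by blast
        then have "\<exists>d\<in>X. le d a \<and> le d b" using ch(1) unfolding proper_filter_def by blast
        then show ?thesis using X by blast
      qed
    qed
    then show ?thesis using ch(1) that(1) by blast
  qed
  ultimately obtain G where G: "proper_filter G" "c \<in> G"
    and max: "\<And>F. proper_filter F \<Longrightarrow> c \<in> F \<Longrightarrow> G \<subseteq> F \<Longrightarrow> F = G"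
    using subset_Zorn_nonempty[of ?A] by blast
  have "a \<in> G \<or> cm a \<in> G" if "a \<in> S" for a
    using proper_filter_extend[OF G(1) that] max G(2) by blast
  then show ?thesis using G by (auto simp: prime_filter_def)
qed

definition stone :: "'a \<Rightarrow> 'a set set" where "stone a = {G. prime_filter G \<and> a \<in> G}"

lemma prime_filter_not_both: "prime_filter G \<Longrightarrow> a \<in> S \<Longrightarrow> a \<in> G \<Longrightarrow> cm a \<notin> G"
proof
  assume G: "prime_filter G" "a \<in> S" "a \<in> G" "cm a \<in> G"
  then obtain c where c: "c \<in> G" "le c a" "le c (cm a)" "c \<in> S" "zer \<notin> G"
    unfolding prime_filter_def proper_filter_def by blast
  then have "c = zer" using disjoint[of a "cm a"] cm_in cm_cm refl G by auto
  then show False using c by simp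
qed

lemma stone_le:
  assumes "a \<in> S" "b \<in> S" shows "le a b \<longleftrightarrow> stone a \<subseteq> stone b"
proof
  show "le a b \<Longrightarrow> stone a \<subseteq> stone b"
    using assms unfolding stone_def prime_filter_def proper_filter_def by blast
  assume sub: "stone a \<subseteq> stone b"
  show "le a b"
  proof (rule ccontr)
    assume "\<not> le a b"
    then have "\<not> le a (cm (cm b))" using assms cm_cm by simp
    then obtain c where c: "c \<in> S" "le c a" "le c (cm b)" "c \<noteq> zer"
      using disjoint[of a "cm b"] assms cm_in by blast
    then obtain G where G: "prime_filter G" "c \<in> G" using prime_filter_exists by blast
    then have "a \<in> G" "cm b \<in> G"
      using c assms cm_in unfolding prime_filter_def proper_filter_def by blast+
    then show False using sub prime_filter_not_both[of G b] G assms by (auto simp: stone_def)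
  qed
qed

text \<open>The points are prime filters. Complements are respected because a prime filter contains exactly one of
  \<open>a\<close>, \<open>a'\<close>, and injectivity holds because \<open>a \<le> b\<close> fails only if \<open>a\<close> and
  \<open>b'\<close> have a nonzero common lower bound.\<close>

lemma stone_representation: "set_representation S zer (cm zer) cm stone"
proof
  show "inj_on stone S" using stone_le antisym by (auto intro!: inj_onI)
  show "zer \<in> S" "cm zer \<in> S" using zer_in cm_in by auto
  show "stone zer = {}" by (auto simp: stone_def prime_filter_def proper_filter_def)
  have one: "stone (cm zer) = {G. prime_filter G}"
    using zer_in by (auto simp: stone_def prime_filter_def proper_filter_def)
  fix a assume a: "a \<in> S"
  show "cm a \<in> S" using a cm_in by auto
  show "stone a \<subseteq> stone (cm zer)" unfolding one by (auto simp: stone_def)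
  show "stone (cm a) = stone (cm zer) - stone a"
    unfolding one using prime_filter_not_both[OF _ a] a by (auto simp: stone_def prime_filter_def)
  fix b assume b: "b \<in> S"
  obtain q where q: "q \<in> S" "le q a" "le q b" "\<forall>c\<in>S. le c a \<longrightarrow> le c b \<longrightarrow> le c q"
    using glb a b by blast
  have "stone q = stone a \<inter> stone b"
  proof
    show "stone q \<subseteq> stone a \<inter> stone b" using q a b stone_le by auto
    show "stone a \<inter> stone b \<subseteq> stone q"
    proof
      fix G assume "G \<in> stone a \<inter> stone b"
      then have G: "prime_filter G" "a \<in> G" "b \<in> G" by (auto simp: stone_def)
      then obtain c where "c \<in> G" "le c a" "le c b" "c \<in> S"
        unfolding prime_filter_def proper_filter_def by blast
      then have "q \<in> G" using q G unfolding prime_filter_def proper_filter_def by blast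
      then show "G \<in> stone q" using G by (simp add: stone_def)
    qed
  qed
  then show "\<exists>c\<in>S. stone c = stone a \<inter> stone b" using q by blast
qed

end

context orthoalgebra
begin

section \<open>The partial sum of an orthoalgebra\<close>

abbreviation Z ("\<zero>") where "\<zero> \<equiv> ozero A"
abbreviation I ("\<one>") where "\<one> \<equiv> oone A"

declare zero_closed [simp] one_closed [simp] compl_closed [simp]

lemma assoc_left:
  assumes "a \<in> carrier A" "b \<in> carrier A" "c \<in> carrier A" "osum A a b = Some u" "osum A u c = Some w"
  obtains v where "osum A b c = Some v" "osum A a v = Some w"
  using sum_assoc[OF assms(1-3)] assms(4,5) by (cases "osum A b c") auto

lemma compl_compl [simp]: "a \<in> carrier A \<Longrightarrow> ocompl A (ocompl A a) = a"
  using compl_unique[of "ocompl A a" a] sum_compl[of a] sum_comm[of a "ocompl A a"] by auto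

lemma compl_one [simp]: "ocompl A (oone A) = ozero A"
proof -
  let ?o = "ocompl A (oone A)"
  have "osum A (oone A) ?o = Some (oone A)" using sum_compl by simp
  then obtain v where "osum A ?o ?o = Some v"
    using assoc_left[of "oone A" ?o ?o "oone A" "oone A"] by auto
  then show ?thesis using sum_self[of ?o] by simp
qed

lemma compl_zero [simp]: "ocompl A (ozero A) = oone A"
  using compl_compl[of "oone A"] by simp

lemma sum_zero [simp]: "a \<in> carrier A \<Longrightarrow> osum A a (ozero A) = Some a"
proof -
  assume a: "a \<in> carrier A"
  have "osum A (ocompl A a) a = Some (oone A)" using sum_compl[of "ocompl A a"] a by simp
  moreover have "osum A (oone A) (ozero A) = Some (oone A)" using sum_compl[of "oone A"] by simp
  ultimately obtain v where v: "osum A a (ozero A) = Some v" "osum A (ocompl A a) v = Some (oone A)"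
    using assoc_left[of "ocompl A a" a "ozero A"] a by auto
  then have "v = a" using compl_unique[of "ocompl A a" v] sum_closed[OF _ _ v(1)] a by simp
  then show ?thesis using v by simp
qed

lemma sum_zero_left [simp]: "a \<in> carrier A \<Longrightarrow> osum A (ozero A) a = Some a"
  using sum_comm[of a "ozero A"] by simp

lemma sum_eq_zero:
  assumes "a \<in> carrier A" "b \<in> carrier A" "osum A a b = Some (ozero A)"
  shows "a = ozero A" "b = ozero A"
proof -
  have *: "x = ozero A" if x: "x \<in> carrier A" "y \<in> carrier A" "osum A y x = Some (ozero A)" for x y
  proof -
    obtain v where "osum A x x = Some v"
      using assoc_left[of y x x "ozero A" x] x by auto
    then show ?thesis using sum_self[of x] x by simp
  qed
  show "a = ozero A" "b = ozero A" using *[of a b] *[of b a] assms sum_comm[of a b] by auto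
qed

text \<open>The partial sum as a total operation on \<open>'a option\<close>. Making \<open>Some 0\<close> neutral even for
  \<open>None\<close> and for elements outside the carrier turns it into a commutative monoid without side
  conditions, so associative-commutative rewriting and finite sums are available.\<close>

definition opt_sum :: "'a option \<Rightarrow> 'a option \<Rightarrow> 'a option" where
  "opt_sum x y = (if x = Some \<zero> then y else if y = Some \<zero> then x else
     (case (x, y) of (Some a, Some b) \<Rightarrow> if a \<in> carrier A \<and> b \<in> carrier A then osum A a b else None
       | _ \<Rightarrow> None))"

lemma opt_sum_Some [simp]: "a \<in> carrier A \<Longrightarrow> b \<in> carrier A \<Longrightarrow> opt_sum (Some a) (Some b) = osum A a b"
  by (auto simp: opt_sum_def)

lemma opt_sum_None [simp]: "opt_sum None x = None" "opt_sum x None = None"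
  by (auto simp: opt_sum_def split: option.splits)

lemma opt_sum_zero [simp]: "opt_sum (Some \<zero>) x = x" "opt_sum x (Some \<zero>) = x"
  by (auto simp: opt_sum_def)

lemma opt_sum_outside:
  "x \<notin> carrier A \<Longrightarrow> y \<noteq> Some \<zero> \<Longrightarrow> opt_sum (Some x) y = None"
  "x \<notin> carrier A \<Longrightarrow> y \<noteq> Some \<zero> \<Longrightarrow> opt_sum y (Some x) = None"
  by (auto simp: opt_sum_def split: option.splits)

lemma opt_sum_eq_zero: "opt_sum x y = Some \<zero> \<longleftrightarrow> x = Some \<zero> \<and> y = Some \<zero>"
  by (auto simp: opt_sum_def dest: sum_eq_zero split: option.splits if_splits)

lemma opt_sum_comm: "opt_sum x y = opt_sum y x"
  by (auto simp: opt_sum_def intro: sum_comm split: option.splits)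

lemma opt_sum_assoc: "opt_sum (opt_sum x y) z = opt_sum x (opt_sum y z)"
proof (cases "x = Some \<zero> \<or> y = Some \<zero> \<or> z = Some \<zero>")
  case False
  show ?thesis
  proof (cases "\<exists>a\<in>carrier A. \<exists>b\<in>carrier A. \<exists>c\<in>carrier A. x = Some a \<and> y = Some b \<and> z = Some c")
    case True
    then obtain a b c where abc: "a \<in> carrier A" "b \<in> carrier A" "c \<in> carrier A"
      and x: "x = Some a" "y = Some b" "z = Some c" by blast
    have "opt_sum (osum A a b) (Some c) = Option.bind (osum A a b) (\<lambda>u. osum A u c)"
      using abc sum_closed[OF abc(1,2)] by (cases "osum A a b") simp_all
    moreover have "opt_sum (Some a) (osum A b c) = Option.bind (osum A b c) (\<lambda>v. osum A a v)"
      using abc sum_closed[OF abc(2,3)] by (cases "osum A b c") simp_all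
    ultimately show ?thesis using sum_assoc[OF abc] abc x by simp
  next
    case out: False
    have N: "opt_sum u v = None" if "u \<noteq> Some \<zero>" "v \<noteq> Some \<zero>"
      "\<not> (\<exists>a\<in>carrier A. u = Some a) \<or> \<not> (\<exists>a\<in>carrier A. v = Some a)" for u v
      using that by (cases u; cases v) (auto simp: opt_sum_outside)
    have "opt_sum (opt_sum x y) z = None"
      using out False N[of x y] N[of "opt_sum x y" z] opt_sum_eq_zero by (metis opt_sum_None(1))
    moreover have "opt_sum x (opt_sum y z) = None"
      using out False N[of y z] N[of x "opt_sum y z"] opt_sum_eq_zero by (metis opt_sum_None(2))
    ultimately show ?thesis by simp
  qed
qed auto

sublocale opt_sum: comm_monoid opt_sum "Some \<zero>"
  by unfold_locales (rule opt_sum_assoc, rule opt_sum_comm, simp)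

lemmas opt_sum_ac = opt_sum.assoc opt_sum.commute opt_sum.left_commute

lemma opt_sum_closed: "opt_sum x y = Some c \<Longrightarrow> set_option x \<subseteq> carrier A \<Longrightarrow> set_option y \<subseteq> carrier A \<Longrightarrow> c \<in> carrier A"
  by (auto simp: opt_sum_def intro: sum_closed split: option.splits if_splits)

lemma opt_sum_carrier: "set_option x \<subseteq> carrier A \<Longrightarrow> set_option y \<subseteq> carrier A \<Longrightarrow> set_option (opt_sum x y) \<subseteq> carrier A"
  using opt_sum_closed[of x y] by (cases "opt_sum x y") auto

lemma opt_sum_defined: "opt_sum x y \<noteq> None \<Longrightarrow> x \<noteq> None \<and> y \<noteq> None"
  by (metis opt_sum_None)

lemma opt_sum_one: "a \<in> carrier A \<Longrightarrow> set_option x \<subseteq> carrier A \<Longrightarrow> opt_sum (Some a) x = Some \<one> \<Longrightarrow> x = Some (ocompl A a)"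
  by (cases x) (auto intro: compl_unique)

definition orth :: "'a \<Rightarrow> 'a \<Rightarrow> bool" where "orth a b \<longleftrightarrow> osum A a b \<noteq> None"

definition leq :: "'a \<Rightarrow> 'a \<Rightarrow> bool" where "leq a b \<longleftrightarrow> orth a (ocompl A b)"

lemma orth_sym: "a \<in> carrier A \<Longrightarrow> b \<in> carrier A \<Longrightarrow> orth a b \<Longrightarrow> orth b a"
  using sum_comm[of a b] by (simp add: orth_def)

lemma leq_iff:
  assumes a: "a \<in> carrier A" and b: "b \<in> carrier A"
  shows "leq a b \<longleftrightarrow> (\<exists>c\<in>carrier A. osum A a c = Some b)"
proof
  assume "leq a b"
  then obtain e where e: "osum A a (ocompl A b) = Some e" by (auto simp: leq_def orth_def)
  then have eA: "e \<in> carrier A" using sum_closed[OF a _ e] b by simp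
  have "opt_sum (Some (ocompl A b)) (opt_sum (Some a) (Some (ocompl A e))) = opt_sum (opt_sum (Some a) (Some (ocompl A b))) (Some (ocompl A e))"
    by (simp only: opt_sum_ac)
  also have "\<dots> = Some \<one>" using a b e eA sum_compl by simp
  finally have "opt_sum (Some a) (Some (ocompl A e)) = Some (ocompl A (ocompl A b))"
    using a b eA by (intro opt_sum_one opt_sum_carrier) auto
  then show "\<exists>c\<in>carrier A. osum A a c = Some b" using a b eA by auto
next
  assume "\<exists>c\<in>carrier A. osum A a c = Some b"
  then obtain c where c: "c \<in> carrier A" "osum A a c = Some b" by auto
  have "opt_sum (opt_sum (Some a) (Some (ocompl A b))) (Some c) = opt_sum (opt_sum (Some a) (Some c)) (Some (ocompl A b))"
    by (simp only: opt_sum_ac)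
  also have "\<dots> = Some \<one>" using a b c sum_compl by simp
  finally show "leq a b" using opt_sum_defined[of "opt_sum (Some a) (Some (ocompl A b))"] a b
    by (auto simp: leq_def orth_def)
qed

lemma leq_refl: "a \<in> carrier A \<Longrightarrow> leq a a"
  by (simp add: leq_def orth_def sum_compl)

lemma orth_mono:
  assumes "a \<in> carrier A" "b \<in> carrier A" "c \<in> carrier A" "leq a b" "orth b c" shows "orth a c"
proof -
  obtain d where d: "d \<in> carrier A" "osum A a d = Some b" using assms leq_iff[of a b] by blast
  have "opt_sum (opt_sum (Some a) (Some c)) (Some d) = opt_sum (opt_sum (Some a) (Some d)) (Some c)"
    by (simp only: opt_sum_ac)
  then have "opt_sum (opt_sum (Some a) (Some c)) (Some d) \<noteq> None" using assms d by (simp add: orth_def)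
  then have "opt_sum (Some a) (Some c) \<noteq> None" using opt_sum_defined by blast
  then show ?thesis using assms by (simp add: orth_def)
qed

lemma leq_trans: "\<lbrakk>a \<in> carrier A; b \<in> carrier A; c \<in> carrier A; leq a b; leq b c\<rbrakk> \<Longrightarrow> leq a c"
  unfolding leq_def by (rule orth_mono[of a b]) (auto simp: leq_def)

lemma leq_antisym:
  assumes ab: "a \<in> carrier A" "b \<in> carrier A" "leq a b" "leq b a" shows "a = b"
proof -
  obtain c d where c: "c \<in> carrier A" "osum A a c = Some b" and d: "d \<in> carrier A" "osum A b d = Some a"
    using assms leq_iff[of a b] leq_iff[of b a] by blast
  have "opt_sum (Some a) (opt_sum (Some c) (Some d)) = opt_sum (opt_sum (Some a) (Some c)) (Some d)"
    by (simp only: opt_sum_assoc)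
  then have *: "opt_sum (Some a) (opt_sum (Some c) (Some d)) = Some a"
    using ab c d by simp
  then obtain u where u: "opt_sum (Some c) (Some d) = Some u"
    by (cases "opt_sum (Some c) (Some d)") auto
  then have uA: "u \<in> carrier A" using opt_sum_closed[OF u] c d by simp
  have "opt_sum (Some a) (opt_sum (Some u) (Some u)) = opt_sum (opt_sum (Some a) (Some u)) (Some u)"
    by (simp only: opt_sum_assoc)
  then have "opt_sum (Some a) (opt_sum (Some u) (Some u)) = Some a"
    using * u by simp
  then have "opt_sum (Some u) (Some u) \<noteq> None" by (metis option.distinct(1) opt_sum_None(2))
  then have "u = \<zero>" using sum_self uA by simp
  then have "c = \<zero>" using u opt_sum_eq_zero by auto
  then show ?thesis using c ab by simp
qed

end

section \<open>Recognizing Boolean subalgebras\<close>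

text \<open>A subset of an orthoalgebra together with a representation by sets under which \<open>\<oplus>\<close> is disjoint
  union.\<close>

locale boolean_representation =
  orthoalgebra A + set_representation S "ozero A" "oone A" "ocompl A" h
  for A :: "'a orthoalg" and S :: "'a set" and h :: "'a \<Rightarrow> 'c set" +
  assumes S_carrier: "S \<subseteq> carrier A"
    and orth_h: "\<lbrakk>a \<in> S; b \<in> S\<rbrakk> \<Longrightarrow> osum A a b \<noteq> None \<longleftrightarrow> h a \<inter> h b = {}"
    and sum_in: "\<lbrakk>a \<in> S; b \<in> S; osum A a b = Some c\<rbrakk> \<Longrightarrow> c \<in> S"
    and h_sum: "\<lbrakk>a \<in> S; b \<in> S; osum A a b = Some c\<rbrakk> \<Longrightarrow> h c = h a \<union> h b"

lemma (in orthoalgebra) subalgebra_orthoalgebra: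
  assumes "orthoalg_subalgebra S A"
  shows "orthoalgebra (A\<lparr>carrier := S\<rparr>)"
proof -
  have S: "S \<subseteq> carrier A" "ozero A \<in> S" "oone A \<in> S" "\<And>a. a \<in> S \<Longrightarrow> ocompl A a \<in> S"
    "\<And>a b c. a \<in> S \<Longrightarrow> b \<in> S \<Longrightarrow> osum A a b = Some c \<Longrightarrow> c \<in> S"
    using assms unfolding orthoalg_subalgebra_def by blast+
  then have C: "\<And>a. a \<in> S \<Longrightarrow> a \<in> carrier A" by blast
  show ?thesis
  proof
    fix a b c assume "a \<in> carrier (A\<lparr>carrier := S\<rparr>)" "b \<in> carrier (A\<lparr>carrier := S\<rparr>)"
      "osum (A\<lparr>carrier := S\<rparr>) a b = Some c"
    then show "c \<in> carrier (A\<lparr>carrier := S\<rparr>)" using S(5)[of a b c] by simp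
  next
    fix a b c assume "a \<in> carrier (A\<lparr>carrier := S\<rparr>)" "b \<in> carrier (A\<lparr>carrier := S\<rparr>)"
      "c \<in> carrier (A\<lparr>carrier := S\<rparr>)"
    then show "Option.bind (osum (A\<lparr>carrier := S\<rparr>) a b) (\<lambda>u. osum (A\<lparr>carrier := S\<rparr>) u c) =
      Option.bind (osum (A\<lparr>carrier := S\<rparr>) b c) (osum (A\<lparr>carrier := S\<rparr>) a)"
      using sum_assoc[of a b c] C by simp
  qed (use S(2-4) C in \<open>auto simp: sum_compl sum_self intro: sum_comm compl_unique simp del: not_None_eq\<close>)
qed

context boolean_representation
begin

lemma in_carrier [simp]: "a \<in> S \<Longrightarrow> a \<in> carrier A"
  using S_carrier by blast

lemma osum_eq: "a \<in> S \<Longrightarrow> b \<in> S \<Longrightarrow> osum A a b = (if h a \<inter> h b = {} then Some (jn a b) else None)"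
proof (cases "osum A a b")
  case (Some c)
  assume "a \<in> S" "b \<in> S"
  moreover have "c = jn a b" using sum_in[of a b c] h_sum[of a b c] Some calculation by (intro eqI) auto
  ultimately show ?thesis using Some orth_h[of a b] by auto
qed (use orth_h[of a b] in auto)

lemma leq_h: "a \<in> S \<Longrightarrow> b \<in> S \<Longrightarrow> leq a b \<longleftrightarrow> h a \<subseteq> h b"
  using orth_h[of a "ocompl A b"] h_le_one[of a] unfolding leq_def orth_def by auto

lemma subalgebra: "orthoalg_subalgebra S A"
  using S_carrier by (auto simp: orthoalg_subalgebra_def intro: sum_in)

lemma boolean_subalgebra: "boolean_subalgebra S A"
  unfolding boolean_subalgebra_def boolean_orthoalgebra_def
proof (intro conjI exI[of _ alg] ballI)
  show "orthoalg_subalgebra S A" by (rule subalgebra)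
  then show "orthoalgebra (A\<lparr>carrier := S\<rparr>)" by (rule subalgebra_orthoalgebra)
  show "boolean_lattice alg" by (rule alg_boolean_lattice)
next
  fix a b assume ab: "a \<in> carrier (A\<lparr>carrier := S\<rparr>)" "b \<in> carrier (A\<lparr>carrier := S\<rparr>)"
  then have "mt a b = \<zero> \<longleftrightarrow> h a \<inter> h b = {}"
    using h_eq_iff[of "mt a b" \<zero>] by simp
  then show "osum (A\<lparr>carrier := S\<rparr>) a b =
    (if a \<sqinter>\<^bsub>alg\<^esub> b = \<bottom>\<^bsub>alg\<^esub> then Some (a \<squnion>\<^bsub>alg\<^esub> b) else None)"
    using ab by (simp add: osum_eq)
qed (simp_all add: alg_complement)

end

context orthoalgebra
begin

text \<open>Compatibility of all pairs, in the sense of Mackey.\<close>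

definition mackey :: "'a set \<Rightarrow> bool" where
  "mackey S \<longleftrightarrow> (\<forall>a\<in>S. \<forall>b\<in>S. \<exists>p\<in>S. \<exists>q\<in>S. \<exists>r\<in>S.
     osum A p q = Some a \<and> osum A q r = Some b \<and> orth a r)"

text \<open>This does not follow from compatibility of pairs. In the orthoalgebra whose atoms are the points of the
  Fano plane, with \<open>a \<oplus> b = c'\<close> for every line \<open>{a, b, c}\<close>, all pairs have a Mackey decomposition,
  but three points that are not on a line are pairwise orthogonal without having a sum.\<close>

definition coherent :: "'a set \<Rightarrow> bool" where
  "coherent S \<longleftrightarrow> (\<forall>a\<in>S. \<forall>b\<in>S. \<forall>c\<in>S. \<forall>u. osum A a b = Some u \<longrightarrow> orth a c \<longrightarrow> orth b c \<longrightarrow> orth u c)"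

text \<open>Under coherence, the common summand of a Mackey decomposition is the greatest lower bound.\<close>

lemma mackey_meet:
  assumes sub: "orthoalg_subalgebra S A" and coh: "coherent S"
    and pqr: "p \<in> S" "q \<in> S" "r \<in> S" "osum A p q = Some a" "osum A q r = Some b" "orth a r"
    and c: "c \<in> S" "leq c a" "leq c b"
  shows "leq c q"
proof -
  have S: "S \<subseteq> carrier A" "\<And>x. x \<in> S \<Longrightarrow> ocompl A x \<in> S"
    "\<And>x y z. x \<in> S \<Longrightarrow> y \<in> S \<Longrightarrow> osum A x y = Some z \<Longrightarrow> z \<in> S"
    using sub unfolding orthoalg_subalgebra_def by blast+
  have ab: "a \<in> S" "b \<in> S" using S(3) pqr by blast+
  obtain w where w: "osum A a r = Some w" using pqr(6) by (auto simp: orth_def)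
  have wS: "w \<in> S" using S(3) ab pqr w by blast
  \<comment> \<open>With \<open>p \<oplus> q \<oplus> r \<oplus> s = 1\<close> one has \<open>b' = p \<oplus> s\<close> and \<open>q' = b' \<oplus> r\<close>; coherence is applied to
    \<open>b'\<close>, \<open>r\<close> and \<open>c\<close>.\<close>
  define s where "s = ocompl A w"
  have sS: "s \<in> S" unfolding s_def using S(2) wS by blast
  have car: "p \<in> carrier A" "q \<in> carrier A" "r \<in> carrier A" "a \<in> carrier A" "b \<in> carrier A"
    "s \<in> carrier A" "w \<in> carrier A" "c \<in> carrier A"
    using S(1) pqr ab sS wS c by blast+
  have one: "opt_sum (opt_sum (opt_sum (Some p) (Some q)) (Some r)) (Some s) = Some \<one>"
    using car pqr w sum_compl[of w] by (simp add: s_def)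
  have "opt_sum (Some b) (opt_sum (Some p) (Some s)) = opt_sum (opt_sum (Some q) (Some r)) (opt_sum (Some p) (Some s))"
    using car pqr by simp
  also have "\<dots> = opt_sum (opt_sum (opt_sum (Some p) (Some q)) (Some r)) (Some s)" by (simp only: opt_sum_ac)
  finally have b': "opt_sum (Some p) (Some s) = Some (ocompl A b)"
    using one car by (intro opt_sum_one opt_sum_carrier) auto
  have "opt_sum (Some a) (opt_sum (Some r) (Some s)) = opt_sum (opt_sum (Some p) (Some q)) (opt_sum (Some r) (Some s))"
    using car pqr by simp
  also have "\<dots> = opt_sum (opt_sum (opt_sum (Some p) (Some q)) (Some r)) (Some s)" by (simp only: opt_sum_ac)
  finally have a': "opt_sum (Some r) (Some s) = Some (ocompl A a)"
    using one car by (intro opt_sum_one opt_sum_carrier) auto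
  have "opt_sum (Some q) (opt_sum (opt_sum (Some p) (Some s)) (Some r)) = opt_sum (opt_sum (opt_sum (Some p) (Some q)) (Some r)) (Some s)"
    by (simp only: opt_sum_ac)
  then have q': "opt_sum (opt_sum (Some p) (Some s)) (Some r) = Some (ocompl A q)"
    using one car by (intro opt_sum_one opt_sum_carrier) auto
  then have "osum A (ocompl A b) r = Some (ocompl A q)" using b' car by simp
  moreover have "orth (ocompl A b) c" using c car by (auto simp: leq_def intro: orth_sym)
  moreover have "orth r c"
  proof -
    have "leq r (ocompl A a)" using a' car sS leq_iff[of r "ocompl A a"] by auto
    moreover have "orth (ocompl A a) c" using c car by (auto simp: leq_def intro: orth_sym)
    ultimately show ?thesis using orth_mono[of r "ocompl A a" c] car by simp
  qed
  ultimately have "orth (ocompl A q) c"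
    using coh S(2) ab(2) pqr(3) c(1) unfolding coherent_def by blast
  then show ?thesis using car by (auto simp: leq_def intro: orth_sym)
qed

text \<open>Mackey decompositions supply meets, and \<open>q = 0\<close> in a decomposition means that \<open>a\<close> and
  \<open>b\<close> are orthogonal. So the subalgebra is an orthocomplemented semilattice of the kind
  represented above. Coherence is used again to see that \<open>\<oplus>\<close> is the join.\<close>

lemma exists_boolean_representation:
  assumes sub: "orthoalg_subalgebra S A" and mac: "mackey S" and coh: "coherent S"
  shows "\<exists>h :: 'a \<Rightarrow> 'a set set. boolean_representation A S h"
proof -
  have S: "S \<subseteq> carrier A" "\<zero> \<in> S" "\<one> \<in> S" "\<And>x. x \<in> S \<Longrightarrow> ocompl A x \<in> S"
    "\<And>x y z. x \<in> S \<Longrightarrow> y \<in> S \<Longrightarrow> osum A x y = Some z \<Longrightarrow> z \<in> S"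
    using sub unfolding orthoalg_subalgebra_def by blast+
  have C: "\<And>x. x \<in> S \<Longrightarrow> x \<in> carrier A" using S by blast
  have leq_sum: "leq a c" "leq b c" if "a \<in> S" "b \<in> S" "osum A a b = Some c" for a b c
    using that leq_iff[of a c] leq_iff[of b c] C sum_comm[of a b] S(5)[OF that] by auto
  have glb: "\<exists>q\<in>S. leq q a \<and> leq q b \<and> (\<forall>c\<in>S. leq c a \<longrightarrow> leq c b \<longrightarrow> leq c q) \<and> (q = \<zero> \<longrightarrow> orth a b)"
    if ab: "a \<in> S" "b \<in> S" for a b
  proof -
    obtain p q r where pqr: "p \<in> S" "q \<in> S" "r \<in> S" "osum A p q = Some a" "osum A q r = Some b" "orth a r"
      using mac ab unfolding mackey_def by blast
    have "leq q a" using leq_sum(2)[OF pqr(1,2,4)] .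
    moreover have "leq q b" using leq_sum(1)[OF pqr(2,3,5)] .
    moreover have "orth a b" if "q = \<zero>" using pqr that C by auto
    ultimately show ?thesis using pqr(2) mackey_meet[OF sub coh pqr] by blast
  qed
  have disj: "orth a b \<longleftrightarrow> (\<forall>c\<in>S. leq c a \<longrightarrow> leq c b \<longrightarrow> c = \<zero>)" if ab: "a \<in> S" "b \<in> S" for a b
  proof
    assume o: "orth a b"
    show "\<forall>c\<in>S. leq c a \<longrightarrow> leq c b \<longrightarrow> c = \<zero>"
    proof (intro ballI impI)
      fix c assume c: "c \<in> S" "leq c a" "leq c b"
      then have "orth c b" using orth_mono[of c a b] o ab C by blast
      then have "orth c c" using orth_mono[of c b c] orth_sym[of c b] c ab C by blast
      then show "c = \<zero>" using sum_self c C by (simp add: orth_def)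
    qed
  next
    assume "\<forall>c\<in>S. leq c a \<longrightarrow> leq c b \<longrightarrow> c = \<zero>"
    then show "orth a b" using glb[OF ab] by blast
  qed
  interpret L: ortho_semilattice S leq "ocompl A" \<zero>
  proof
    show "leq \<zero> a" if "a \<in> S" for a using that C S(4) by (simp add: leq_def orth_def)
    show "\<exists>q\<in>S. leq q a \<and> leq q b \<and> (\<forall>c\<in>S. leq c a \<longrightarrow> leq c b \<longrightarrow> leq c q)" if "a \<in> S" "b \<in> S" for a b
      using glb[OF that] by blast
    show "leq a (ocompl A b) \<longleftrightarrow> (\<forall>c\<in>S. leq c a \<longrightarrow> leq c b \<longrightarrow> c = \<zero>)" if "a \<in> S" "b \<in> S" for a b
      using disj[OF that] that C by (simp add: leq_def)
  qed (use S(2,4) C in \<open>auto intro: leq_trans leq_antisym leq_refl\<close>)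
  interpret R: set_representation S \<zero> \<one> "ocompl A" L.stone
    using L.stone_representation by simp
  have "boolean_representation A S L.stone"
  proof (unfold_locales)
    show "S \<subseteq> carrier A" by (rule S(1))
    fix a b assume ab: "a \<in> S" "b \<in> S"
    have "osum A a b \<noteq> None \<longleftrightarrow> leq a (ocompl A b)" using ab C by (simp add: leq_def orth_def)
    also have "\<dots> \<longleftrightarrow> L.stone a \<inter> L.stone b = {}"
      using L.stone_le[of a "ocompl A b"] ab S(4) R.h_le_one[of a] by auto
    finally show "osum A a b \<noteq> None \<longleftrightarrow> L.stone a \<inter> L.stone b = {}" .
    fix c assume c: "osum A a b = Some c"
    then show cS: "c \<in> S" using ab S(5) by blast
    have "L.stone a \<subseteq> L.stone c" "L.stone b \<subseteq> L.stone c"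
      using leq_sum[OF ab c] L.stone_le ab cS by blast+
    moreover have "L.stone c \<subseteq> L.stone (R.jn a b)"
    proof -
      have "orth a (ocompl A (R.jn a b))" "orth b (ocompl A (R.jn a b))"
        using L.stone_le[of a "R.jn a b"] L.stone_le[of b "R.jn a b"] ab by (auto simp: leq_def)
      then have "leq c (R.jn a b)"
        using coh ab c S(4)[OF R.jn_in[OF ab]] unfolding coherent_def leq_def by blast
      then show ?thesis using L.stone_le[of c "R.jn a b"] ab cS by blast
    qed
    ultimately show "L.stone c = L.stone a \<union> L.stone b" using ab by auto
  qed
  then show ?thesis by blast
qed

text \<open>In a Boolean algebra, \<open>a \<sqinter> b'\<close>, \<open>a \<sqinter> b\<close> and \<open>b \<sqinter> a'\<close> form a Mackey
  decomposition, and coherence is distributivity.\<close>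

lemma boolean_subalgebra_mackey_coherent:
  assumes "boolean_subalgebra S A"
  shows "orthoalg_subalgebra S A" "mackey S" "coherent S"
proof -
  show "orthoalg_subalgebra S A" using assms by (simp add: boolean_subalgebra_def)
  then have S: "S \<subseteq> carrier A" "\<zero> \<in> S" "\<one> \<in> S" "\<And>x. x \<in> S \<Longrightarrow> ocompl A x \<in> S"
    unfolding orthoalg_subalgebra_def by blast+
  obtain B where B: "boolean_lattice B" and cB: "carrier B = S" and z: "\<zero> = \<bottom>\<^bsub>B\<^esub>"
    and co: "\<And>a. a \<in> S \<Longrightarrow> is_complement B a (ocompl A a)"
    and sm: "\<And>a b. a \<in> S \<Longrightarrow> b \<in> S \<Longrightarrow>
       osum A a b = (if a \<sqinter>\<^bsub>B\<^esub> b = \<bottom>\<^bsub>B\<^esub> then Some (a \<squnion>\<^bsub>B\<^esub> b) else None)"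
    using assms unfolding boolean_subalgebra_def boolean_orthoalgebra_def by auto
  interpret B: boolean_lattice B by (rule B)
  have cl [simp]: "a \<sqinter>\<^bsub>B\<^esub> b \<in> S" "a \<squnion>\<^bsub>B\<^esub> b \<in> S" if "a \<in> S" "b \<in> S" for a b
    using that cB B.meet_closed[of a b] B.join_closed[of a b] by auto
  have comm: "a \<sqinter>\<^bsub>B\<^esub> b = b \<sqinter>\<^bsub>B\<^esub> a" for a b by (rule meet_comm)
  have assoc: "(a \<sqinter>\<^bsub>B\<^esub> b) \<sqinter>\<^bsub>B\<^esub> c = a \<sqinter>\<^bsub>B\<^esub> (b \<sqinter>\<^bsub>B\<^esub> c)" if "a \<in> S" "b \<in> S" "c \<in> S" for a b c
    using B.weak_meet_assoc[of a b c] that cB B.eq_is_equal by simp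
  have cm: "a \<sqinter>\<^bsub>B\<^esub> ocompl A a = \<bottom>\<^bsub>B\<^esub>" "a \<squnion>\<^bsub>B\<^esub> ocompl A a = \<top>\<^bsub>B\<^esub>" if "a \<in> S" for a
    using co[OF that] by (auto simp: is_complement_def)
  have bot: "a \<sqinter>\<^bsub>B\<^esub> \<bottom>\<^bsub>B\<^esub> = \<bottom>\<^bsub>B\<^esub>" if "a \<in> S" for a
    using B.bottom_meet[of a] that cB B.eq_is_equal comm by simp
  have top: "a \<sqinter>\<^bsub>B\<^esub> \<top>\<^bsub>B\<^esub> = a" if "a \<in> S" for a
    using B.top_meet[of a] that cB B.eq_is_equal comm by simp
  have botj: "\<bottom>\<^bsub>B\<^esub> \<squnion>\<^bsub>B\<^esub> a = a" if "a \<in> S" for a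
    using B.bottom_join[of a] that cB B.eq_is_equal by simp
  have dist: "a \<sqinter>\<^bsub>B\<^esub> (b \<squnion>\<^bsub>B\<^esub> c) = (a \<sqinter>\<^bsub>B\<^esub> b) \<squnion>\<^bsub>B\<^esub> (a \<sqinter>\<^bsub>B\<^esub> c)" if "a \<in> S" "b \<in> S" "c \<in> S" for a b c
    using B.meet_join_distrib[of a b c] that cB by simp
  have jc: "a \<squnion>\<^bsub>B\<^esub> b = b \<squnion>\<^bsub>B\<^esub> a" for a b by (rule join_comm)
  show "mackey S"
    unfolding mackey_def
  proof (intro ballI)
    fix a b assume ab: "a \<in> S" "b \<in> S"
    have key: "osum A (x \<sqinter>\<^bsub>B\<^esub> ocompl A y) (x \<sqinter>\<^bsub>B\<^esub> y) = Some x" if xy: "x \<in> S" "y \<in> S" for x y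
    proof -
      have "(x \<sqinter>\<^bsub>B\<^esub> ocompl A y) \<sqinter>\<^bsub>B\<^esub> (x \<sqinter>\<^bsub>B\<^esub> y) = x \<sqinter>\<^bsub>B\<^esub> (x \<sqinter>\<^bsub>B\<^esub> (y \<sqinter>\<^bsub>B\<^esub> ocompl A y))"
        using xy S(4) assoc comm by (metis cl(1))
      also have "\<dots> = \<bottom>\<^bsub>B\<^esub>" using xy cm bot by simp
      finally have 1: "(x \<sqinter>\<^bsub>B\<^esub> ocompl A y) \<sqinter>\<^bsub>B\<^esub> (x \<sqinter>\<^bsub>B\<^esub> y) = \<bottom>\<^bsub>B\<^esub>" .
      have "(x \<sqinter>\<^bsub>B\<^esub> ocompl A y) \<squnion>\<^bsub>B\<^esub> (x \<sqinter>\<^bsub>B\<^esub> y) = x \<sqinter>\<^bsub>B\<^esub> (ocompl A y \<squnion>\<^bsub>B\<^esub> y)"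
        using dist xy S(4) by simp
      also have "\<dots> = x" using cm top xy jc by simp
      finally show ?thesis using sm 1 xy S(4) by simp
    qed
    have "osum A (b \<sqinter>\<^bsub>B\<^esub> a) (b \<sqinter>\<^bsub>B\<^esub> ocompl A a) = Some b"
      using key[OF ab(2,1)] sum_comm[of "b \<sqinter>\<^bsub>B\<^esub> a" "b \<sqinter>\<^bsub>B\<^esub> ocompl A a"] ab S(1,4)
      by (metis cl(1) subsetD)
    moreover have "orth a (b \<sqinter>\<^bsub>B\<^esub> ocompl A a)"
    proof -
      have "a \<sqinter>\<^bsub>B\<^esub> (b \<sqinter>\<^bsub>B\<^esub> ocompl A a) = b \<sqinter>\<^bsub>B\<^esub> (a \<sqinter>\<^bsub>B\<^esub> ocompl A a)"
        using ab S(4) assoc comm by metis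
      then show ?thesis using ab cm bot sm S(4) by (simp add: orth_def)
    qed
    ultimately show "\<exists>p\<in>S. \<exists>q\<in>S. \<exists>r\<in>S. osum A p q = Some a \<and> osum A q r = Some b \<and> orth a r"
      using key[OF ab] cl[OF ab] cl(1)[OF ab(1) S(4)[OF ab(2)]] cl(1)[OF ab(2) S(4)[OF ab(1)]]
      unfolding comm[of b a] by blast
  qed
  show "coherent S"
    unfolding coherent_def
  proof (intro ballI allI impI)
    fix a b c u assume abc: "a \<in> S" "b \<in> S" "c \<in> S" and u: "osum A a b = Some u"
      and o: "orth a c" "orth b c"
    have ac: "c \<sqinter>\<^bsub>B\<^esub> a = \<bottom>\<^bsub>B\<^esub>" "c \<sqinter>\<^bsub>B\<^esub> b = \<bottom>\<^bsub>B\<^esub>" and "u = a \<squnion>\<^bsub>B\<^esub> b"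
      using o u sm[of a b] sm[of a c] sm[of b c] abc comm[of c a] comm[of c b]
      by (auto simp: orth_def split: if_splits)
    have "u \<sqinter>\<^bsub>B\<^esub> c = c \<sqinter>\<^bsub>B\<^esub> (a \<squnion>\<^bsub>B\<^esub> b)" using \<open>u = _\<close> comm by simp
    also have "\<dots> = \<bottom>\<^bsub>B\<^esub>" using dist[of c a b] abc ac botj[of "\<bottom>\<^bsub>B\<^esub>"] S(2) z by simp
    finally have "u \<sqinter>\<^bsub>B\<^esub> c = \<bottom>\<^bsub>B\<^esub>" .
    then show "orth u c" using sm[of u c] abc \<open>u = _\<close> by (simp add: orth_def)
  qed
qed

lemma boolean_subalgebra_iff:
  "boolean_subalgebra S A \<longleftrightarrow> orthoalg_subalgebra S A \<and> mackey S \<and> coherent S"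
  using boolean_subalgebra_mackey_coherent exists_boolean_representation
    boolean_representation.boolean_subalgebra by blast

lemma boolean_subalgebra_representation:
  assumes "boolean_subalgebra S A"
  obtains h :: "'a \<Rightarrow> 'a set set" where "boolean_representation A S h"
  using assms boolean_subalgebra_iff exists_boolean_representation by blast

end

context boolean_representation
begin

lemma boolean_subalgebra_sub:
  assumes "sub T" shows "boolean_subalgebra T A"
proof -
  note T = subD[OF assms]
  have TS: "\<And>a. a \<in> T \<Longrightarrow> a \<in> S" using T(1) by blast
  interpret T: set_representation T \<zero> \<one> "ocompl A" h
  proof
    show "inj_on h T" using inj T(1) by (rule inj_on_subset)
    show "\<exists>c\<in>T. h c = h a \<inter> h b" if "a \<in> T" "b \<in> T" for a b
      using that T(5)[of a b] TS by (intro bexI[of _ "mt a b"]) auto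
  qed (use T TS h_le_one in auto)
  interpret T: boolean_representation A T h
  proof
    show "T \<subseteq> carrier A" using T(1) S_carrier by blast
    fix a b assume ab: "a \<in> T" "b \<in> T"
    show "osum A a b \<noteq> None \<longleftrightarrow> h a \<inter> h b = {}" using orth_h ab TS by blast
    fix c assume c: "osum A a b = Some c"
    show "h c = h a \<union> h b" using h_sum c ab TS by blast
    show "c \<in> T" using c osum_eq[of a b] ab TS T(6)[of a b] by (auto split: if_splits)
  qed
  show ?thesis by (rule T.boolean_subalgebra)
qed

text \<open>The operations of a Boolean subalgebra \<open>T\<close> agree with those of \<open>S\<close>, because a Mackey
  decomposition inside \<open>T\<close> computes the meet in \<open>S\<close>. So the downset of \<open>S\<close> in
  \<open>BSub A\<close> is the lattice of subalgebras of the Boolean algebra \<open>S\<close>.\<close>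

lemma sub_iff: "sub T \<longleftrightarrow> boolean_subalgebra T A \<and> T \<subseteq> S"
proof
  assume "sub T"
  then show "boolean_subalgebra T A \<and> T \<subseteq> S" using boolean_subalgebra_sub subD(1) by blast
next
  assume *: "boolean_subalgebra T A \<and> T \<subseteq> S"
  then have T: "\<one> \<in> T" "\<And>a. a \<in> T \<Longrightarrow> ocompl A a \<in> T" "mackey T"
    using boolean_subalgebra_iff unfolding orthoalg_subalgebra_def by blast+
  have "mt a b \<in> T" if ab: "a \<in> T" "b \<in> T" for a b
  proof -
    obtain p q r where pqr: "p \<in> T" "q \<in> T" "r \<in> T" "osum A p q = Some a" "osum A q r = Some b" "orth a r"
      using T(3) ab unfolding mackey_def by blast
    have S: "p \<in> S" "q \<in> S" "r \<in> S" "a \<in> S" "b \<in> S" using pqr ab * by blast+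
    have "h a = h p \<union> h q" "h b = h q \<union> h r" "h a \<inter> h r = {}" "h p \<inter> h q = {}"
      using h_sum pqr S orth_h[of a r] orth_h[of p q] by (auto simp: orth_def)
    then have "h a \<inter> h b = h q" by blast
    then have "mt a b = q" using S by (intro eqI) auto
    then show ?thesis using pqr by simp
  qed
  then show "sub T" using T * by (auto simp: sub_def)
qed

lemma downset_BSub: "downset (BSub A) S = Sub"
proof -
  have "BSub A = incl_order {T. boolean_subalgebra T A}" by (simp add: BSub_def incl_order_def)
  then show ?thesis using sub_iff by (simp add: downset_incl_order)
qed

end

section \<open>Finite orthogonal partitions of the unit\<close>

context orthoalgebra
begin

sublocale psum: comm_monoid_set opt_sum "Some \<zero>" ..

definition partition :: "'a set \<Rightarrow> bool" where
  "partition P \<longleftrightarrow> finite P \<and> P \<subseteq> carrier A \<and> \<zero> \<notin> P \<and> psum.F Some P = Some \<one>"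

text \<open>The value is meaningful when the sum is defined, in particular for subsets of a partition.\<close>

definition fsum :: "'a set \<Rightarrow> 'a" where "fsum X = the (psum.F Some X)"

definition span :: "'a set \<Rightarrow> 'a set" where "span P = fsum ` Pow P"

lemma psum_carrier: "finite X \<Longrightarrow> X \<subseteq> carrier A \<Longrightarrow> set_option (psum.F Some X) \<subseteq> carrier A"
proof (induction X rule: finite_induct)
  case (insert x X)
  then show ?case using opt_sum_carrier[of "Some x" "psum.F Some X"] by simp
qed simp

lemma
  assumes P: "partition P" and X: "X \<subseteq> P"
  shows F_eq: "psum.F Some X = Some (fsum X)" and fsum_carrier: "fsum X \<in> carrier A"
proof -
  have fin: "finite P" "P \<subseteq> carrier A" using P by (auto simp: partition_def)
  have "psum.F Some P = opt_sum (psum.F Some (P - X)) (psum.F Some X)"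
    using psum.subset_diff[OF X fin(1)] .
  then have "psum.F Some X \<noteq> None" using P opt_sum_defined[of "psum.F Some (P - X)" "psum.F Some X"] by (simp add: partition_def)
  then show F: "psum.F Some X = Some (fsum X)" by (auto simp: fsum_def)
  show "fsum X \<in> carrier A"
    using psum_carrier[of X] F X fin finite_subset[OF X] by auto
qed

lemma fsum_Un:
  assumes P: "partition P" and X: "X \<subseteq> P" and Y: "Y \<subseteq> P" and XY: "X \<inter> Y = {}"
  shows "osum A (fsum X) (fsum Y) = Some (fsum (X \<union> Y))"
proof -
  have fin: "finite X" "finite Y" using P X Y finite_subset by (auto simp: partition_def)
  have "psum.F Some (X \<union> Y) = opt_sum (psum.F Some X) (psum.F Some Y)"
    by (rule psum.union_disjoint[OF fin XY])
  then show ?thesis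
    using F_eq[OF P] fsum_carrier[OF P] X Y by simp
qed

lemma fsum_empty [simp]: "fsum {} = \<zero>"
  by (simp add: fsum_def)

lemma fsum_singleton [simp]: "fsum {e} = e"
  by (simp add: fsum_def)

lemma fsum_all: "partition P \<Longrightarrow> fsum P = \<one>"
  by (simp add: partition_def fsum_def)

lemma fsum_mono:
  assumes P: "partition P" and X: "X \<subseteq> Y" "Y \<subseteq> P"
  shows "leq (fsum X) (fsum Y)"
proof -
  have "osum A (fsum X) (fsum (Y - X)) = Some (fsum Y)"
    using fsum_Un[OF P, of X "Y - X"] X by (auto simp: Un_absorb1)
  moreover have "fsum X \<in> carrier A" "fsum Y \<in> carrier A" "fsum (Y - X) \<in> carrier A"
    by (rule fsum_carrier[OF P]; use X in blast)+
  ultimately show ?thesis using leq_iff by blast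
qed

text \<open>Sums over subsets that share a member \<open>e\<close> are not orthogonal, since \<open>e \<oplus> e\<close> is undefined
  for \<open>e \<noteq> 0\<close>. This makes \<open>fsum\<close> injective on the power set.\<close>

lemma orth_fsum:
  assumes P: "partition P" and X: "X \<subseteq> P" and Y: "Y \<subseteq> P"
  shows "orth (fsum X) (fsum Y) \<longleftrightarrow> X \<inter> Y = {}"
proof
  assume o: "orth (fsum X) (fsum Y)"
  show "X \<inter> Y = {}"
  proof (rule ccontr)
    assume "X \<inter> Y \<noteq> {}"
    then obtain e where e: "e \<in> X" "e \<in> Y" by blast
    have c: "e \<in> carrier A" "e \<noteq> \<zero>" "fsum X \<in> carrier A" "fsum Y \<in> carrier A"
      using e P X fsum_carrier[OF P] Y by (auto simp: partition_def)
    have "leq e (fsum X)" "leq e (fsum Y)"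
      using fsum_mono[OF P, of "{e}"] e X Y by auto
    then have "orth e (fsum Y)" using orth_mono[of e "fsum X" "fsum Y"] o c by blast
    then have "orth e e" using orth_mono[of e "fsum Y" e] orth_sym \<open>leq e (fsum Y)\<close> c by blast
    then show False using sum_self c by (simp add: orth_def)
  qed
next
  assume "X \<inter> Y = {}"
  then show "orth (fsum X) (fsum Y)" using fsum_Un[OF P X Y] by (simp add: orth_def)
qed

lemma fsum_compl:
  assumes P: "partition P" and X: "X \<subseteq> P"
  shows "ocompl A (fsum X) = fsum (P - X)"
proof -
  have "osum A (fsum X) (fsum (P - X)) = Some \<one>"
    using fsum_Un[OF P X, of "P - X"] X fsum_all[OF P] by (simp add: Un_absorb1)
  then show ?thesis using compl_unique[of "fsum X" "fsum (P - X)"] fsum_carrier[OF P] X by auto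
qed

lemma inj_on_fsum:
  assumes P: "partition P" shows "inj_on fsum (Pow P)"
proof (rule inj_onI)
  have *: "X \<subseteq> Y" if "X \<in> Pow P" "Y \<in> Pow P" "fsum X = fsum Y" for X Y
  proof -
    have "orth (fsum X) (fsum (P - Y))" using orth_fsum[OF P, of Y "P - Y"] that by auto
    then show ?thesis using orth_fsum[OF P, of X "P - Y"] that by auto
  qed
  show "X = Y" if "X \<in> Pow P" "Y \<in> Pow P" "fsum X = fsum Y" for X Y
    using *[of X Y] *[of Y X] that by simp
qed

definition coords :: "'a set \<Rightarrow> 'a \<Rightarrow> 'a set" where "coords P = inv_into (Pow P) fsum"

lemma coords_fsum [simp]: "partition P \<Longrightarrow> X \<subseteq> P \<Longrightarrow> coords P (fsum X) = X"
  unfolding coords_def using inj_on_fsum[of P] by simp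

text \<open>Sums over two subsets are orthogonal exactly when the subsets are disjoint, so the subset sums add and
  complement like the subsets themselves.\<close>

lemma span_representation:
  assumes P: "partition P"
  shows "boolean_representation A (span P) (coords P)"
proof (unfold_locales)
  note [simp] = P
  have PP: "P \<subseteq> P" by simp
  show "\<zero> \<in> span P" unfolding span_def using fsum_empty by (metis Pow_bottom imageI)
  show "\<one> \<in> span P" unfolding span_def using fsum_all[OF P] by (metis Pow_top imageI)
  show "span P \<subseteq> carrier A" unfolding span_def using fsum_carrier[OF P] by auto
  show "inj_on (coords P) (span P)"
    unfolding span_def coords_def by (rule inj_on_inv_into) simp
  show "coords P \<zero> = {}" using coords_fsum[OF P, of "{}"] by simp
  have one: "coords P \<one> = P" using coords_fsum[OF P PP] fsum_all[OF P] by simp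
  fix a assume "a \<in> span P"
  then obtain X where X: "X \<subseteq> P" "a = fsum X" by (auto simp: span_def)
  show "ocompl A a \<in> span P" using X fsum_compl[OF P X(1)] by (auto simp: span_def)
  show "coords P a \<subseteq> coords P \<one>" using X one by simp
  show "coords P (ocompl A a) = coords P \<one> - coords P a"
    using X one fsum_compl[OF P X(1)] by simp
  fix b assume "b \<in> span P"
  then obtain Y where Y: "Y \<subseteq> P" "b = fsum Y" by (auto simp: span_def)
  have "X \<inter> Y \<subseteq> P" using X by auto
  then show "\<exists>c\<in>span P. coords P c = coords P a \<inter> coords P b"
    using X Y by (intro bexI[of _ "fsum (X \<inter> Y)"]) (auto simp: span_def)
  show *: "osum A a b \<noteq> None \<longleftrightarrow> coords P a \<inter> coords P b = {}"
    using orth_fsum[OF P X(1) Y(1)] X Y by (simp add: orth_def)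
  fix c assume c: "osum A a b = Some c"
  then have "X \<inter> Y = {}" using * X Y by simp
  then have "c = fsum (X \<union> Y)" using fsum_Un[OF P X(1) Y(1)] c X Y by simp
  then show "c \<in> span P" "coords P c = coords P a \<union> coords P b"
    using X Y by (auto simp: span_def)
qed

lemma span_boolean: "partition P \<Longrightarrow> boolean_subalgebra (span P) A"
  using boolean_representation.boolean_subalgebra[OF span_representation] .

lemma span_least:
  assumes P: "partition P" and U: "orthoalg_subalgebra U A" "P \<subseteq> U"
  shows "span P \<subseteq> U"
proof -
  have fin: "finite P" using P by (simp add: partition_def)
  have "fsum X \<in> U" if "X \<subseteq> P" for X
    using finite_subset[OF that fin] that
  proof (induction X rule: finite_induct)
    case empty then show ?case using U by (simp add: orthoalg_subalgebra_def)
  next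
    case (insert x X)
    then have "osum A x (fsum X) = Some (fsum (insert x X))"
      using fsum_Un[OF P, of "{x}" X] by simp
    then show ?case using U insert unfolding orthoalg_subalgebra_def by blast
  qed
  then show ?thesis by (auto simp: span_def)
qed

lemma span_upper: "P \<subseteq> span P"
  unfolding span_def using fsum_singleton by (metis Pow_iff empty_subsetI image_eqI insert_subset subsetI)

lemma partition_merge:
  assumes P: "partition P" and ef: "e \<in> P" "f \<in> P" "e \<noteq> f" "osum A e f = Some g"
  shows "partition (insert g (P - {e, f}))" "g \<notin> P - {e, f}"
    "\<And>X. X \<subseteq> P - {e, f} \<Longrightarrow> fsum (insert g X) = fsum ({e, f} \<union> X)"
proof -
  have fin: "finite P" "P \<subseteq> carrier A" "\<zero> \<notin> P" using P by (auto simp: partition_def)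
  have c: "e \<in> carrier A" "f \<in> carrier A" "e \<noteq> \<zero>" using ef fin by auto
  have g: "g = fsum {e, f}" using fsum_Un[OF P, of "{e}" "{f}"] ef by (simp add: insert_commute)
  have gc: "g \<in> carrier A" using sum_closed c ef by blast
  have g0: "g \<noteq> \<zero>" using sum_eq_zero[of e f] ef c by auto
  show gP: "g \<notin> P - {e, f}"
  proof
    assume "g \<in> P - {e, f}"
    then have "orth g g" using orth_fsum[OF P, of "{e, f}" "{g}"] ef by (auto simp: g[symmetric])
    then show False using sum_self gc g0 by (simp add: orth_def)
  qed
  have F: "psum.F Some (insert g X) = psum.F Some ({e, f} \<union> X)" if X: "X \<subseteq> P - {e, f}" for X
  proof -
    have fX: "finite X" using X fin finite_subset by blast
    have "g \<notin> X" using X gP by blast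
    then have "psum.F Some (insert g X) = opt_sum (opt_sum (Some e) (Some f)) (psum.F Some X)"
      using fX ef c by simp
    moreover have "psum.F Some ({e, f} \<union> X) = opt_sum (Some e) (opt_sum (Some f) (psum.F Some X))"
      using X ef fX by (subst psum.union_disjoint) (auto simp: opt_sum.assoc simp del: opt_sum_Some)
    ultimately show ?thesis by (simp only: opt_sum.assoc)
  qed
  then show "\<And>X. X \<subseteq> P - {e, f} \<Longrightarrow> fsum (insert g X) = fsum ({e, f} \<union> X)"
    by (simp add: fsum_def)
  have "{e, f} \<union> (P - {e, f}) = P" using ef by blast
  then have "psum.F Some (insert g (P - {e, f})) = Some \<one>"
    using F[of "P - {e, f}"] P by (simp add: partition_def)
  then show "partition (insert g (P - {e, f}))"
    using fin gc g0 by (auto simp: partition_def)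
qed

lemma BSub_incl_order: "BSub A = incl_order {S. boolean_subalgebra S A}"
  by (simp add: BSub_def incl_order_def)

lemma boolean_imp_sub: "boolean_subalgebra S A \<Longrightarrow> orthoalg_subalgebra S A"
  by (simp add: boolean_subalgebra_def)

text \<open>The merged partition generates the sums over those \<open>X\<close> that contain both or none of \<open>e\<close>,
  \<open>f\<close>. Any other element of \<open>span P\<close> separates \<open>e\<close> from \<open>f\<close>; its meet with
  \<open>g = e \<oplus> f\<close> is one of the two, and so both are obtained. This is the source of all covers below.\<close>

lemma span_merge_covers:
  assumes P: "partition P" and ef: "e \<in> P" "f \<in> P" "e \<noteq> f" "osum A e f = Some g"
  shows "covers (BSub A) (span (insert g (P - {e, f}))) (span P)"
proof -
  let ?M = "insert g (P - {e, f})"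
  interpret R: boolean_representation A "span P" "coords P" by (rule span_representation[OF P])
  have M: "partition ?M" and gP: "g \<notin> P - {e, f}"
    and fsM: "\<And>X. X \<subseteq> P - {e, f} \<Longrightarrow> fsum (insert g X) = fsum ({e, f} \<union> X)"
    using partition_merge[OF P ef] by blast+
  have g: "g = fsum {e, f}" using fsum_Un[OF P, of "{e}" "{f}"] ef by (simp add: insert_commute)
  have gS: "g \<in> span P" unfolding g span_def using ef by auto
  have in_span: "fsum X \<in> span P" if "X \<subseteq> P" for X using that by (auto simp: span_def)
  have eS: "e \<in> span P" "f \<in> span P" using span_upper ef by auto
  have co: "coords P e = {e}" "coords P f = {f}" "coords P g = {e, f}"
    using coords_fsum[OF P, of "{e}"] coords_fsum[OF P, of "{f}"] coords_fsum[OF P, of "{e, f}"] ef g by auto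
  have sub: "span ?M \<subseteq> span P"
    using span_upper gS by (intro span_least[OF M] boolean_imp_sub span_boolean[OF P]) blast
  have mem: "fsum X \<in> span ?M \<longleftrightarrow> (e \<in> X \<longleftrightarrow> f \<in> X)" if X: "X \<subseteq> P" for X
  proof
    assume "fsum X \<in> span ?M"
    then obtain Y where Y: "Y \<subseteq> ?M" "fsum X = fsum Y" by (auto simp: span_def)
    show "e \<in> X \<longleftrightarrow> f \<in> X"
    proof (cases "g \<in> Y")
      case True
      then have "fsum Y = fsum ({e, f} \<union> (Y - {g}))" using fsM[of "Y - {g}"] Y by (auto simp: insert_absorb)
      then have "coords P (fsum X) = coords P (fsum ({e, f} \<union> (Y - {g})))" using Y by simp
      moreover have "{e, f} \<union> (Y - {g}) \<subseteq> P" using ef Y by blast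
      ultimately have "X = {e, f} \<union> (Y - {g})" using X coords_fsum[OF P] by simp
      then show ?thesis by blast
    next
      case False
      then have "Y \<subseteq> P - {e, f}" using Y by blast
      moreover from this have "coords P (fsum X) = coords P (fsum Y)" "Y \<subseteq> P" using Y by auto
      ultimately show ?thesis using X coords_fsum[OF P] by auto
    qed
  next
    assume *: "e \<in> X \<longleftrightarrow> f \<in> X"
    show "fsum X \<in> span ?M"
    proof (cases "e \<in> X")
      case True
      then have "fsum X = fsum (insert g (X - {e, f}))"
        using fsM[of "X - {e, f}"] X * Diff_mono[OF X order_refl, of "{e, f}"] by (auto simp: insert_absorb)
      moreover have "insert g (X - {e, f}) \<subseteq> ?M" using X by blast
      ultimately show ?thesis by (auto simp: span_def)
    next
      case False
      then have "X \<subseteq> ?M" using X * by blast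
      then show ?thesis by (auto simp: span_def)
    qed
  qed
  have ne: "e \<notin> span ?M" using mem[of "{e}"] ef by simp
  have "V = span ?M \<or> V = span P"
    if V: "boolean_subalgebra V A" "span ?M \<subseteq> V" "V \<subseteq> span P" for V
  proof (cases "V = span ?M")
    case False
    have sV: "R.sub V" using R.sub_iff V by blast
    note V' = R.subD[OF sV]
    obtain t where t: "t \<in> V" "t \<notin> span ?M" using V False by blast
    then obtain X0 where X0: "X0 \<subseteq> P" "t = fsum X0" using V by (auto simp: span_def)
    \<comment> \<open>Replacing \<open>t\<close> by its complement if necessary, \<open>t\<close> lies above \<open>e\<close> and not above \<open>f\<close>.\<close>
    have "\<exists>X. X \<subseteq> P \<and> fsum X \<in> V \<and> e \<in> X \<and> f \<notin> X"
    proof (cases "e \<in> X0")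
      case True then show ?thesis using X0 t mem[of X0] by auto
    next
      case False
      then have "fsum (P - X0) \<in> V" using V'(4)[OF t(1)] fsum_compl[OF P X0(1)] X0 by simp
      then show ?thesis using False mem[of X0] t X0 ef by (intro exI[of _ "P - X0"]) auto
    qed
    then obtain X where X: "X \<subseteq> P" "fsum X \<in> V" "e \<in> X" "f \<notin> X" by blast
    have gV: "g \<in> V" using V(2) span_upper[of ?M] by blast
    have "R.mt (fsum X) g = e"
      using X co eS gS in_span[OF X(1)] coords_fsum[OF P X(1)] by (intro R.eqI) auto
    then have eV: "e \<in> V" using V'(5)[OF X(2) gV] by simp
    have cP: "coords P \<one> = P" using coords_fsum[OF P, of P] fsum_all[OF P] by simp
    have "R.mt g (ocompl A e) = f"
      using co eS gS ef cP by (intro R.eqI) auto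
    then have fV: "f \<in> V" using V'(5)[OF gV V'(4)[OF eV]] by simp
    have "P \<subseteq> V" using eV fV V(2) span_upper[of ?M] by blast
    then have "span P \<subseteq> V" using span_least[OF P boolean_imp_sub[OF V(1)]] by blast
    then show ?thesis using V by blast
  qed blast
  then show ?thesis
    unfolding BSub_incl_order covers_incl_order
    using span_boolean[OF P] span_boolean[OF M] sub ne eS by blast
qed

end

section \<open>Four-element subalgebras and their covers\<close>

context orthoalgebra
begin

text \<open>Like \<open>four\<close>, but without reference to a surrounding Boolean algebra.\<close>

definition quad :: "'a \<Rightarrow> 'a set" where "quad a = {\<zero>, \<one>, a, ocompl A a}"

text \<open>The piece \<open>\<down>a \<union> \<up>a'\<close> of \<open>S\<close>, expressed by the order of the orthoalgebra so that it is
  compatible with restriction to smaller subalgebras.\<close>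

definition down_up_in :: "'a set \<Rightarrow> 'a \<Rightarrow> 'a set" where "down_up_in S a = {t \<in> S. leq t a \<or> leq (ocompl A a) t}"

lemma quad_compl: "a \<in> carrier A \<Longrightarrow> quad (ocompl A a) = quad a"
  by (auto simp: quad_def)

lemma quad_eq_iff:
  assumes "a \<in> carrier A" "b \<in> carrier A"
  shows "quad a = quad b \<longleftrightarrow> b = a \<or> b = ocompl A a \<or> a \<in> {\<zero>, \<one>} \<and> b \<in> {\<zero>, \<one>}"
proof
  assume *: "quad a = quad b"
  have "b \<in> quad a" "a \<in> quad b" using * by (auto simp: quad_def)
  then show "b = a \<or> b = ocompl A a \<or> a \<in> {\<zero>, \<one>} \<and> b \<in> {\<zero>, \<one>}"
    using assms by (auto simp: quad_def)
qed (use assms in \<open>auto simp: quad_def\<close>)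

lemma quad_least: "orthoalg_subalgebra S A \<Longrightarrow> a \<in> S \<Longrightarrow> quad a \<subseteq> S"
  unfolding quad_def orthoalg_subalgebra_def by blast

lemma boolean_memD:
  assumes "boolean_subalgebra S A"
  shows "S \<subseteq> carrier A" "\<zero> \<in> S" "\<one> \<in> S" "a \<in> S \<Longrightarrow> ocompl A a \<in> S"
    "a \<in> S \<Longrightarrow> b \<in> S \<Longrightarrow> osum A a b = Some c \<Longrightarrow> c \<in> S" "a \<in> S \<Longrightarrow> a \<in> carrier A"
    "a \<in> S \<Longrightarrow> quad a \<subseteq> S"
proof -
  have S: "orthoalg_subalgebra S A" by (rule boolean_imp_sub[OF assms])
  then show "S \<subseteq> carrier A" "\<zero> \<in> S" "\<one> \<in> S" "a \<in> S \<Longrightarrow> ocompl A a \<in> S"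
    unfolding orthoalg_subalgebra_def by blast+
  then show "a \<in> S \<Longrightarrow> a \<in> carrier A" by blast
  show "a \<in> S \<Longrightarrow> b \<in> S \<Longrightarrow> osum A a b = Some c \<Longrightarrow> c \<in> S"
    using S unfolding orthoalg_subalgebra_def by blast
  show "a \<in> S \<Longrightarrow> quad a \<subseteq> S" by (rule quad_least[OF S])
qed

lemma leq_one: "a \<in> carrier A \<Longrightarrow> leq a \<one>"
  by (simp add: leq_def orth_def)

lemma zero_leq: "a \<in> carrier A \<Longrightarrow> leq \<zero> a"
  by (simp add: leq_def orth_def)

lemma orth_zero: "a \<in> carrier A \<Longrightarrow> orth a a \<Longrightarrow> a = \<zero>"
  using sum_self[of a] by (simp add: orth_def)

lemma orth_left:
  assumes "a \<in> carrier A" "b \<in> carrier A" "c \<in> carrier A" "osum A a b = Some u" "orth u c"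
  shows "orth a c" "orth b c"
proof -
  have u: "u \<in> carrier A" by (rule sum_closed[OF assms(1,2,4)])
  have "leq a u" "leq b u"
    using leq_iff[of a u] leq_iff[of b u] assms sum_comm[of a b] u by auto
  then show "orth a c" "orth b c" using orth_mono[of a u c] orth_mono[of b u c] u assms by simp_all
qed

lemma partition_pair:
  assumes "a \<in> carrier A" "a \<noteq> \<zero>" "a \<noteq> \<one>"
  shows "partition {a, ocompl A a}" "a \<noteq> ocompl A a"
proof -
  show "a \<noteq> ocompl A a" using assms orth_zero[of a] sum_compl[of a] by (auto simp: orth_def)
  moreover have "ocompl A a \<noteq> \<zero>" using assms compl_compl[of a] compl_zero by metis
  ultimately show "partition {a, ocompl A a}"
    using assms sum_compl by (simp add: partition_def)
qed

lemma partition_one: "\<zero> \<noteq> \<one> \<Longrightarrow> partition {\<one>}"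
  by (simp add: partition_def)

lemma partition_three:
  assumes c: "a \<in> carrier A" "b \<in> carrier A" "c \<in> carrier A" "a \<noteq> \<zero>" "b \<noteq> \<zero>" "c \<noteq> \<zero>"
    and s: "osum A b c = Some (ocompl A a)"
  shows "partition {a, b, c}" "a \<noteq> b" "a \<noteq> c" "b \<noteq> c"
proof -
  have "orth (ocompl A a) a" using c sum_comm[of "ocompl A a" a] sum_compl[of a] by (simp add: orth_def)
  then have "orth b a" "orth c a" using orth_left[OF c(2,3,1) s] by blast+
  then show d: "a \<noteq> b" "a \<noteq> c" "b \<noteq> c" using orth_zero c s by (auto simp: orth_def)
  then show "partition {a, b, c}" using c s sum_compl[of a] by (simp add: partition_def)
qed

lemma partition_three_sum:
  assumes "partition {a, b, c}" "a \<noteq> b" "a \<noteq> c" "b \<noteq> c"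
  shows "osum A a b = Some (ocompl A c)" "osum A b c = Some (ocompl A a)" "osum A a c = Some (ocompl A b)"
proof -
  have *: "osum A x y = Some (ocompl A z)" if "{x, y, z} = {a, b, c}" "x \<noteq> y" "x \<noteq> z" "y \<noteq> z" for x y z
  proof -
    have P: "partition {x, y, z}" using assms that by simp
    have "osum A x y = Some (fsum {x, y})" using fsum_Un[OF P, of "{x}" "{y}"] that(2) by (simp add: insert_commute)
    moreover have "ocompl A z = fsum ({x, y, z} - {z})" using fsum_compl[OF P, of "{z}"] by simp
    moreover have "{x, y, z} - {z} = {x, y}" using that by blast
    ultimately show ?thesis by simp
  qed
  show "osum A a b = Some (ocompl A c)" "osum A b c = Some (ocompl A a)" "osum A a c = Some (ocompl A b)"
    using assms by (intro *; blast)+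
qed

text \<open>Decompositions of \<open>a'\<close> and of \<open>a\<close> fit together, whatever larger Boolean subalgebras they come from.\<close>

lemma partition_four:
  assumes c: "a \<in> carrier A" "b \<in> carrier A" "c \<in> carrier A" "e \<in> carrier A" "f \<in> carrier A"
    "b \<noteq> \<zero>" "c \<noteq> \<zero>" "e \<noteq> \<zero>" "f \<noteq> \<zero>"
    and s: "osum A b c = Some (ocompl A a)" "osum A e f = Some a"
  shows "partition {b, c, e, f}" "b \<noteq> c" "b \<noteq> e" "b \<noteq> f" "c \<noteq> e" "c \<noteq> f" "e \<noteq> f"
proof -
  have 1: "orth (ocompl A a) a" using c sum_comm[of "ocompl A a" a] sum_compl[of a] by (simp add: orth_def)
  then have "orth b a" "orth c a" using orth_left[OF c(2,3,1) s(1)] by blast+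
  then have "orth a b" "orth a c" using orth_sym c by blast+
  then have "orth e b" "orth f b" "orth e c" "orth f c"
    using orth_left[OF c(4,5,2) s(2)] orth_left[OF c(4,5,3) s(2)] by blast+
  then show d: "b \<noteq> c" "b \<noteq> e" "b \<noteq> f" "c \<noteq> e" "c \<noteq> f" "e \<noteq> f"
    using orth_zero c s by (auto simp: orth_def)
  have "psum.F Some {b, c, e, f} = opt_sum (Some b) (opt_sum (Some c) (opt_sum (Some e) (Some f)))"
    using d by (simp del: opt_sum_Some)
  also have "\<dots> = opt_sum (opt_sum (Some b) (Some c)) (opt_sum (Some e) (Some f))"
    by (simp only: opt_sum.assoc)
  also have "\<dots> = Some \<one>" using c s 1 sum_compl[of a] sum_comm[of a "ocompl A a"] by simp
  finally show "partition {b, c, e, f}" using c by (simp add: partition_def)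
qed

lemma span_pair: "a \<in> carrier A \<Longrightarrow> a \<noteq> \<zero> \<Longrightarrow> a \<noteq> \<one> \<Longrightarrow> span {a, ocompl A a} = quad a"
proof -
  assume a: "a \<in> carrier A" "a \<noteq> \<zero>" "a \<noteq> \<one>"
  have "Pow {a, ocompl A a} = {{}, {a}, {ocompl A a}, {a, ocompl A a}}" by blast
  then show ?thesis using fsum_all[OF partition_pair(1)[OF a]] by (auto simp: span_def quad_def)
qed

lemma span_one: "\<zero> \<noteq> \<one> \<Longrightarrow> span {\<one>} = quad \<zero>"
proof -
  have "Pow {\<one>} = {{}, {\<one>}}" by blast
  then show ?thesis by (auto simp: span_def quad_def)
qed

lemma quad_boolean:
  assumes "a \<in> carrier A" "\<zero> \<noteq> \<one>" shows "boolean_subalgebra (quad a) A"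
proof (cases "a = \<zero> \<or> a = \<one>")
  case True
  then have "quad a = quad \<zero>" by (auto simp: quad_def)
  then show ?thesis using span_boolean[OF partition_one[OF assms(2)]] span_one[OF assms(2)] by simp
next
  case False
  then show ?thesis using span_boolean[OF partition_pair(1)[of a]] span_pair[of a] assms(1) by simp
qed

end

context boolean_representation
begin

lemma four_quad: "four a = quad a"
  by (simp add: four_def quad_def)

lemma down_up_in_eq: "a \<in> S \<Longrightarrow> down_up a = down_up_in S a"
  by (auto simp: down_up_def down_up_in_def leq_h)

end

context orthoalgebra
begin

lemma down_up_in_props:
  assumes S: "boolean_subalgebra S A" and a: "a \<in> S"
  shows "boolean_subalgebra (down_up_in S a) A" "down_up_in S a \<subseteq> S" "down_up_in S a \<inter> down_up_in S (ocompl A a) = quad a"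
    "down_up_in S a = quad a \<Longrightarrow> down_up_in S (ocompl A a) = S" "quad a \<subseteq> down_up_in S a"
    "principal_pair_for (downset (BSub A) S) (quad a) y z \<longleftrightarrow>
      y = down_up_in S a \<and> z = down_up_in S (ocompl A a) \<or> y = down_up_in S (ocompl A a) \<and> z = down_up_in S a"
proof -
  obtain h :: "'a \<Rightarrow> 'a set set" where "boolean_representation A S h"
    using boolean_subalgebra_representation[OF S] .
  then interpret R: boolean_representation A S h .
  have a': "ocompl A a \<in> S" using a by simp
  note Q = R.down_up_in_eq[OF a, symmetric] R.down_up_in_eq[OF a', symmetric] R.four_quad[of a, symmetric]
  show "boolean_subalgebra (down_up_in S a) A" "down_up_in S a \<subseteq> S" "down_up_in S a \<inter> down_up_in S (ocompl A a) = quad a"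
    unfolding Q using R.sub_down_up[OF a] R.sub_iff R.down_up_Int_down_up[OF a] by blast+
  then show "quad a \<subseteq> down_up_in S a" by blast
  show "principal_pair_for (downset (BSub A) S) (quad a) y z \<longleftrightarrow>
      y = down_up_in S a \<and> z = down_up_in S (ocompl A a) \<or> y = down_up_in S (ocompl A a) \<and> z = down_up_in S a"
    unfolding R.downset_BSub Q by (rule R.principal_pair_for_iff[OF a])
  show "down_up_in S (ocompl A a) = S" if "down_up_in S a = quad a"
  proof -
    have "t \<in> R.four a" if "t \<in> S" "h t \<subseteq> h a" for t
      using \<open>down_up_in S a = quad a\<close> that unfolding Q by (auto simp: R.down_up_def)
    then show ?thesis unfolding Q using R.down_up_eq_four(2)[OF a] by blast
  qed
qed

lemma down_up_in_restrict: "T \<subseteq> S \<Longrightarrow> down_up_in T a = T \<inter> down_up_in S a"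
  by (auto simp: down_up_in_def)

lemma down_up_in_span:
  assumes P: "partition P" and a: "a \<in> P"
  shows "down_up_in (span P) a = quad a"
proof -
  interpret R: boolean_representation A "span P" "coords P" by (rule span_representation[OF P])
  have aS: "a \<in> span P" using span_upper a by blast
  have ha: "coords P a = {a}" using coords_fsum[OF P, of "{a}"] a by simp
  have "R.down_up a = R.four a"
  proof (rule R.down_up_eq_four(1)[OF aS])
    fix t assume t: "t \<in> span P" "coords P t \<subseteq> coords P a"
    then have "coords P t = coords P \<zero> \<or> coords P t = coords P a" using ha R.h_zer by auto
    then show "t \<in> R.four a" using t(1) aS R.h_eq_iff R.zer_in by (auto simp: R.four_def simp del: R.h_zer)
  qed
  then show ?thesis using R.down_up_in_eq[OF aS] R.four_quad by simp
qed

text \<open>If \<open>a\<close> is an atom of the cover \<open>y\<close>, then \<open>t\<close> or \<open>t'\<close> is disjoint from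
  \<open>a\<close> and splits \<open>a'\<close>. The resulting three-member partition generates a subalgebra strictly
  above \<open>quad a\<close>, hence all of \<open>y\<close>.\<close>

lemma covers_quad_shape:
  assumes cov: "covers (BSub A) (quad a) y" and Q: "down_up_in y a = quad a"
    and a: "a \<in> carrier A" "a \<noteq> \<zero>" "a \<noteq> \<one>" and t: "t \<in> y" "t \<notin> quad a"
  obtains b c where "b = t \<or> b = ocompl A t" "b \<in> carrier A" "c \<in> carrier A" "b \<noteq> \<zero>" "c \<noteq> \<zero>"
    "osum A b c = Some (ocompl A a)" "y = span {a, b, c}"
proof -
  have y: "boolean_subalgebra y A" "quad a \<subseteq> y"
    and cov': "\<And>z. boolean_subalgebra z A \<Longrightarrow> quad a \<subseteq> z \<Longrightarrow> z \<subseteq> y \<Longrightarrow> z = quad a \<or> z = y"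
    using cov unfolding BSub_incl_order covers_incl_order by auto
  obtain h :: "'a \<Rightarrow> 'a set set" where "boolean_representation A y h"
    using boolean_subalgebra_representation[OF y(1)] .
  then interpret R: boolean_representation A y h .
  have ay: "a \<in> y" using y(2) by (auto simp: quad_def)
  have ha: "h a \<noteq> {}" "h a \<noteq> h \<one>"
    using R.h_eq_iff[OF ay R.zer_in] R.h_eq_iff[OF ay R.one_in] a by auto
  have "R.mt t a \<in> R.four a"
    using Q t ay R.leq_h unfolding R.four_quad by (auto simp: down_up_in_def)
  then have "h t \<inter> h a = {} \<or> h t \<inter> h a = h a"
    using R.h_four[of "R.mt t a" a] ha ay t R.h_le_one[OF ay] by auto
  then have "h t \<inter> h a = {} \<or> h (ocompl A t) \<inter> h a = {}" using t by auto
  then obtain b where b: "b = t \<or> b = ocompl A t" "b \<in> y" "h b \<inter> h a = {}"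
    using t(1) R.cm_in[OF t(1)] by blast
  have bq: "b \<notin> quad a"
  proof
    assume "b \<in> quad a"
    then have "ocompl A b \<in> quad a" using boolean_memD(6)[OF y(1)] ay by (auto simp: quad_def)
    then show False using \<open>b \<in> quad a\<close> b t by auto
  qed
  define c where "c = R.mt (ocompl A a) (ocompl A b)"
  have cy: "c \<in> y" using ay b by (simp add: c_def)
  have hc: "h c = h \<one> - h a - h b" using ay b by (auto simp: c_def)
  have le: "h b \<subseteq> h \<one>" "h a \<subseteq> h \<one>" using R.h_le_one ay b by auto
  have "R.jn b c = ocompl A a" using b cy ay le hc by (intro R.eqI) auto
  then have s: "osum A b c = Some (ocompl A a)"
    using R.osum_eq[OF b(2) cy] hc by auto
  have b0: "b \<noteq> \<zero>" using bq by (auto simp: quad_def)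
  have c0: "c \<noteq> \<zero>"
  proof
    assume "c = \<zero>"
    then have "b = ocompl A a" using s b(2) by simp
    then show False using bq by (simp add: quad_def)
  qed
  have car: "b \<in> carrier A" "c \<in> carrier A" using b cy by auto
  have P: "partition {a, b, c}" using partition_three[OF a(1) car a(2) b0 c0 s] by blast
  have "span {a, b, c} \<subseteq> y" using span_least[OF P boolean_imp_sub[OF y(1)]] ay b cy by auto
  moreover have "quad a \<subseteq> span {a, b, c}" "b \<in> span {a, b, c}"
    using span_upper[of "{a, b, c}"] boolean_memD(7)[OF span_boolean[OF P]] by auto
  ultimately have "y = span {a, b, c}" using cov'[OF span_boolean[OF P]] bq by blast
  then show thesis using that b(1) car b0 c0 s by blast
qed

lemma covers_quad_three:
  assumes c: "a \<in> carrier A" "b \<in> carrier A" "c \<in> carrier A" "a \<noteq> \<zero>" "b \<noteq> \<zero>" "c \<noteq> \<zero>"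
    and s: "osum A b c = Some (ocompl A a)"
  shows "covers (BSub A) (quad a) (span {a, b, c})"
proof -
  note P = partition_three[OF c s]
  have "a \<noteq> \<one>" using s c sum_eq_zero[of b c] by auto
  moreover have "{a, b, c} - {b, c} = {a}" using P by blast
  ultimately show ?thesis
    using span_merge_covers[OF P(1) _ _ P(4) s] span_pair c by (simp add: insert_commute)
qed

text \<open>An element outside \<open>quad a\<close> splits \<open>a\<close> or \<open>a'\<close> properly, unless \<open>quad a = {0, 1}\<close>, when
  it splits \<open>1\<close>.\<close>

lemma exists_cover_below:
  assumes nt: "\<zero> \<noteq> \<one>" and y: "boolean_subalgebra y A" and a: "quad a \<subset> y"
  shows "\<exists>w. covers (BSub A) (quad a) w \<and> w \<subseteq> y"
proof -
  have ay: "a \<in> y" using a by (auto simp: quad_def)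
  have aA: "a \<in> carrier A" using boolean_memD(6)[OF y] ay by simp
  obtain t where t: "t \<in> y" "t \<notin> quad a" using a by blast
  have tA: "t \<in> carrier A" using boolean_memD(6)[OF y] t by simp
  show ?thesis
  proof (cases "a = \<zero> \<or> a = \<one>")
    case True
    then have q: "quad a = quad \<zero>" by (auto simp: quad_def)
    then have t0: "t \<noteq> \<zero>" "t \<noteq> \<one>" using t by (auto simp: quad_def)
    note P = partition_pair[OF tA t0]
    have "{t, ocompl A t} - {t, ocompl A t} = {}" by blast
    then have "covers (BSub A) (quad a) (span {t, ocompl A t})"
      using span_merge_covers[OF P(1) _ _ P(2) sum_compl[OF tA]] span_one[OF nt] q by simp
    moreover have "span {t, ocompl A t} \<subseteq> y"
      using span_pair[OF tA t0] boolean_memD(7)[OF y t(1)] by simp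
    ultimately show ?thesis by blast
  next
    case False
    obtain h :: "'a \<Rightarrow> 'a set set" where "boolean_representation A y h"
      using boolean_subalgebra_representation[OF y] .
    then interpret R: boolean_representation A y h .
    have key: "\<exists>w. covers (BSub A) (quad c) w \<and> w \<subseteq> y"
      if c: "c \<in> y" "c \<noteq> \<zero>" "c \<noteq> \<one>" and tc: "h t \<inter> h c \<noteq> {}" "\<not> h c \<subseteq> h t" for c
    proof -
      define p q where "p = R.mt t c" and "q = R.mt (ocompl A t) c"
      have pq: "p \<in> y" "q \<in> y" "h p = h t \<inter> h c" "h q = h c - h t"
        using t c R.h_le_one[OF c(1)] by (auto simp: p_def q_def)
      have "R.jn p q = c" using pq c by (intro R.eqI) auto
      then have s: "osum A p q = Some (ocompl A (ocompl A c))"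
        using R.osum_eq[OF pq(1,2)] pq c by auto
      have 0: "p \<noteq> \<zero>" "q \<noteq> \<zero>" using pq(3,4) tc R.h_zer by (metis, metis Diff_eq_empty_iff)
      have c': "ocompl A c \<noteq> \<zero>" using c(3) compl_compl[OF R.in_carrier[OF c(1)]] compl_zero by metis
      have car: "p \<in> carrier A" "q \<in> carrier A" "ocompl A c \<in> carrier A" using pq c by auto
      have "covers (BSub A) (quad c) (span {ocompl A c, p, q})"
        using covers_quad_three[OF car(3,1,2) c' 0 s] quad_compl[OF R.in_carrier[OF c(1)]] by simp
      moreover have "span {ocompl A c, p, q} \<subseteq> y"
        using partition_three(1)[OF car(3,1,2) c' 0 s] pq c
        by (intro span_least boolean_imp_sub y) auto
      ultimately show ?thesis by blast
    qed
    show ?thesis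
    proof (cases "h t \<inter> h a \<noteq> {} \<and> \<not> h a \<subseteq> h t")
      case True
      then show ?thesis using key[OF ay] False by blast
    next
      case no: False
      have "h t \<noteq> h x" if "x \<in> quad a" for x
        using that t R.h_eq_iff[of t x] boolean_memD(7)[OF y ay] by (metis subsetD)
      then have hn: "h t \<noteq> {}" "h t \<noteq> h \<one>" "h t \<noteq> h a" "h t \<noteq> h \<one> - h a"
        using R.h_zer R.h_cm[OF ay] unfolding quad_def by (metis insertCI)+
      have c': "ocompl A a \<noteq> \<zero>" "ocompl A a \<noteq> \<one>"
        using False aA compl_compl[of a] compl_zero compl_one by metis+
      have "h t \<inter> h (ocompl A a) \<noteq> {}" "\<not> h (ocompl A a) \<subseteq> h t"
        using no hn R.h_le_one[OF ay] R.h_le_one[OF t(1)] ay by auto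
      then show ?thesis using key[OF R.cm_in[OF ay] c'] quad_compl[OF aA] by simp
    qed
  qed
qed

text \<open>The hypotheses say that \<open>a\<close> is an atom of \<open>y\<close> and \<open>a'\<close> one of \<open>z\<close>. So
  \<open>y\<close> splits \<open>a'\<close> into \<open>b \<oplus> c\<close> and \<open>z\<close> splits \<open>a\<close> into
  \<open>e \<oplus> f\<close>. The join is the sixteen-element algebra with atoms \<open>b\<close>, \<open>c\<close>,
  \<open>e\<close>, \<open>f\<close>, from which \<open>y\<close> and \<open>z\<close> arise by merging.\<close>

lemma opposite_covers_join:
  assumes a: "a \<in> carrier A"
    and y: "covers (BSub A) (quad a) y" "down_up_in y a = quad a"
    and z: "covers (BSub A) (quad a) z" "down_up_in z (ocompl A a) = quad a"
  shows "\<exists>s. is_lub (BSub A) s {y, z} \<and> covers (BSub A) y s \<and> covers (BSub A) z s"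
proof -
  have yb: "boolean_subalgebra y A" "quad a \<subset> y" and zb: "boolean_subalgebra z A" "quad a \<subset> z"
    using y(1) z(1) unfolding BSub_incl_order covers_incl_order by auto
  have a1: "a \<noteq> \<one>"
  proof
    assume "a = \<one>"
    then have "down_up_in y a = y" using leq_one boolean_memD(6)[OF yb(1)] by (auto simp: down_up_in_def)
    then show False using y yb by simp
  qed
  have a0: "a \<noteq> \<zero>"
  proof
    assume "a = \<zero>"
    then have "down_up_in z (ocompl A a) = z" using leq_one boolean_memD(6)[OF zb(1)] by (auto simp: down_up_in_def)
    then show False using z zb by simp
  qed
  have a': "ocompl A a \<in> carrier A" "ocompl A a \<noteq> \<zero>" "ocompl A a \<noteq> \<one>"
    using a a0 a1 compl_compl[of a] compl_zero compl_one by (metis compl_closed)+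
  obtain t where "t \<in> y" "t \<notin> quad a" using yb by blast
  then obtain b c where bc: "b \<in> carrier A" "c \<in> carrier A" "b \<noteq> \<zero>" "c \<noteq> \<zero>"
    "osum A b c = Some (ocompl A a)" "y = span {a, b, c}"
    using covers_quad_shape[OF y a a0 a1] by metis
  obtain u where "u \<in> z" "u \<notin> quad a" using zb by blast
  then obtain e f where ef: "e \<in> carrier A" "f \<in> carrier A" "e \<noteq> \<zero>" "f \<noteq> \<zero>"
    "osum A e f = Some a" "z = span {ocompl A a, e, f}"
    using covers_quad_shape[of "ocompl A a" z u] z a a' quad_compl by (metis compl_compl)
  note P = partition_four[OF a bc(1,2) ef(1,2) bc(3,4) ef(3,4) bc(5) ef(5)]
  let ?W = "span {b, c, e, f}"
  have "{b, c, e, f} - {e, f} = {b, c}" "{b, c, e, f} - {b, c} = {e, f}" using P by blast+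
  then have cov: "covers (BSub A) y ?W" "covers (BSub A) z ?W"
    using span_merge_covers[OF P(1) _ _ P(7) ef(5)] span_merge_covers[OF P(1) _ _ P(2) bc(5)] bc ef
    by simp_all
  moreover have "is_lub (BSub A) ?W {y, z}"
    unfolding BSub_incl_order is_lub_incl_order
  proof (intro conjI ballI impI)
    show "?W \<in> {S. boolean_subalgebra S A}" using span_boolean[OF P(1)] by simp
    show "x \<subseteq> ?W" if "x \<in> {y, z} \<inter> {S. boolean_subalgebra S A}" for x
      using cov that unfolding BSub_incl_order covers_incl_order by auto
    fix T assume T: "T \<in> {S. boolean_subalgebra S A}" "\<forall>x\<in>{y, z} \<inter> {S. boolean_subalgebra S A}. x \<subseteq> T"
    then have "y \<subseteq> T" "z \<subseteq> T" using yb zb by auto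
    then have "{b, c, e, f} \<subseteq> T" using span_upper[of "{a, b, c}"] span_upper[of "{ocompl A a, e, f}"] bc ef by auto
    then show "?W \<subseteq> T" using span_least[OF P(1)] boolean_imp_sub T by simp
  qed
  ultimately show ?thesis by blast
qed

end

section \<open>The orthodomain of Boolean subalgebras\<close>

context set_representation
begin

text \<open>The definition of a Boolean domain asks for a Boolean algebra on pairs of a set and a truth value; it is a
  copy of the given one along \<open>a \<mapsto> ({a}, True)\<close>.\<close>

lemma Sub_boolean_domain:
  "boolean_domain (incl_order {T. sub T} :: 'a set gorder)"
proof -
  define j :: "'a \<Rightarrow> 'a set \<times> bool" where "j a = ({a}, True)" for a
  define k :: "'a set \<times> bool \<Rightarrow> 'a" where "k p = the_elem (fst p)" for p
  have kj [simp]: "k (j a) = a" for a by (simp add: j_def k_def)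
  have jj [simp]: "j a = j b \<longleftrightarrow> a = b" for a b by (simp add: j_def)
  interpret J: set_representation "j ` S" "j zer" "j one" "\<lambda>p. j (cm (k p))" "\<lambda>p. h (k p)"
  proof
    show "inj_on (\<lambda>p. h (k p)) (j ` S)"
    proof (rule inj_onI)
      fix p q assume "p \<in> j ` S" "q \<in> j ` S" "h (k p) = h (k q)"
      moreover from this obtain a b where "a \<in> S" "b \<in> S" "p = j a" "q = j b" by blast
      ultimately show "p = q" using eqI[of a b] by simp
    qed
    show "h (k p) \<subseteq> h (k (j one))" if p: "p \<in> j ` S" for p
    proof -
      obtain x where "x \<in> S" "p = j x" using p by blast
      then show ?thesis using h_le_one[of x] by simp
    qed
    show "\<exists>c\<in>j ` S. h (k c) = h (k a) \<inter> h (k b)" if ab: "a \<in> j ` S" "b \<in> j ` S" for a b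
    proof -
      obtain x y where xy: "x \<in> S" "y \<in> S" "a = j x" "b = j y" using ab by blast
      then show ?thesis by (intro bexI[of _ "j (mt x y)"]) simp_all
    qed
  qed auto
  have mt: "J.mt (j a) (j b) = j (mt a b)" if "a \<in> S" "b \<in> S" for a b
    using that by (intro J.eqI) auto
  have sub: "J.sub (j ` T) \<longleftrightarrow> sub T" if "T \<subseteq> S" for T
  proof -
    have "(\<forall>a\<in>T. \<forall>b\<in>T. J.mt (j a) (j b) \<in> j ` T) \<longleftrightarrow> (\<forall>a\<in>T. \<forall>b\<in>T. mt a b \<in> T)"
      using that mt by (auto simp: subset_iff image_iff)
    then show ?thesis using that unfolding J.sub_def sub_def by (auto simp: image_iff)
  qed
  have sub_ex: "\<exists>T. sub T \<and> U = j ` T" if U: "J.sub U" for U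
  proof -
    have "U \<subseteq> j ` S" using U by (rule J.subD(1))
    then obtain T where "T \<subseteq> S" "U = j ` T" by (auto simp: subset_image_iff)
    then show ?thesis using sub U by blast
  qed
  have "inj j" by (simp add: inj_def)
  then have im: "j ` T \<subseteq> j ` U \<longleftrightarrow> T \<subseteq> U" for T U by (rule inj_image_subset_iff)
  have "order_emb Sub (bool_subalgebras J.alg) ((`) j)"
    unfolding order_emb_def J.bool_subalgebras_alg
    using im by (simp add: partial_order_incl_order[THEN partial_order.axioms(1)])
  moreover have "bij_betw ((`) j) (carrier Sub) (carrier (bool_subalgebras J.alg))"
    unfolding J.bool_subalgebras_alg bij_betw_def
  proof
    show "inj_on ((`) j) (carrier Sub)" using \<open>inj j\<close> by (simp add: inj_on_def inj_image_eq_iff)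
    show "(`) j ` carrier Sub = carrier (incl_order {T. J.sub T})"
    proof
      show "(`) j ` carrier Sub \<subseteq> carrier (incl_order {T. J.sub T})" using sub subD(1) by auto
      show "carrier (incl_order {T. J.sub T}) \<subseteq> (`) j ` carrier Sub" using sub_ex unfolding incl_order_simps by blast
    qed
  qed
  ultimately show ?thesis
    unfolding boolean_domain_def using Sub_lattice J.alg_boolean_lattice by blast
qed

end

locale proper_orthoalg = orthoalgebra A for A :: "'a orthoalg" +
  assumes proper: "proper_orthoalgebra A"
begin

lemma zero_neq_one [simp]: "\<zero> \<noteq> \<one>" "\<one> \<noteq> \<zero>"
proof -
  show "\<zero> \<noteq> \<one>"
  proof
    assume 01: "\<zero> = \<one>"
    have "a = \<zero>" if "a \<in> carrier A" for a
      using leq_antisym[of a \<zero>] leq_one[of a] zero_leq[of a] that 01 by simp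
    then have c: "carrier A \<subseteq> {\<zero>}" by blast
    have "partition {}" using 01 by (simp add: partition_def)
    then have "boolean_subalgebra {\<zero>} A" using span_boolean[of "{}"] by (simp add: span_def)
    moreover have "T = {\<zero>}" if "boolean_subalgebra T A" for T
      using boolean_memD(1,2)[OF that] c by blast
    ultimately have "block A {\<zero>}" unfolding block_def by blast
    then show False using proper unfolding proper_orthoalgebra_def by auto
  qed
  then show "\<one> \<noteq> \<zero>" by simp
qed

abbreviation X :: "'a set gorder" where "X \<equiv> BSub A"

lemmas quad_bool = quad_boolean[OF _ zero_neq_one(1)]

lemma X_carrier: "carrier X = {S. boolean_subalgebra S A}"
  by (simp add: BSub_incl_order)

lemma bottom_X: "\<bottom>\<^bsub>X\<^esub> = quad \<zero>"
  unfolding BSub_incl_order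
proof (rule bottom_incl_order)
  show "quad \<zero> \<in> {S. boolean_subalgebra S A}" using quad_bool by simp
  show "quad \<zero> \<subseteq> S" if "S \<in> {S. boolean_subalgebra S A}" for S
    using boolean_memD(7)[of S \<zero>] boolean_memD(2)[of S] that by simp
qed

lemma quad_zero_least: "boolean_subalgebra S A \<Longrightarrow> quad \<zero> \<subseteq> S"
  using boolean_memD(7)[of S \<zero>] boolean_memD(2)[of S] by simp

lemma atom_iff: "atom X x \<longleftrightarrow> (\<exists>a\<in>carrier A. a \<noteq> \<zero> \<and> a \<noteq> \<one> \<and> x = quad a)"
proof
  assume "atom X x"
  then have "covers (incl_order {S. boolean_subalgebra S A}) (quad \<zero>) x"
    unfolding atom_def bottom_X unfolding BSub_incl_order .
  then have x: "boolean_subalgebra x A" "quad \<zero> \<subset> x"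
    and at: "\<And>z. boolean_subalgebra z A \<Longrightarrow> quad \<zero> \<subseteq> z \<Longrightarrow> z \<subseteq> x \<Longrightarrow> z = quad \<zero> \<or> z = x"
    unfolding covers_incl_order by blast+
  obtain a where a: "a \<in> x" "a \<notin> quad \<zero>" using x by blast
  then have aA: "a \<in> carrier A" using boolean_memD(6)[OF x(1)] by blast
  have "quad a \<noteq> quad \<zero>" using a(2) by (auto simp: quad_def)
  then have "quad a = x"
    using at[OF quad_bool[OF aA]] quad_zero_least[OF quad_bool[OF aA]] boolean_memD(7)[OF x(1) a(1)] by blast
  then show "\<exists>a\<in>carrier A. a \<noteq> \<zero> \<and> a \<noteq> \<one> \<and> x = quad a"
    using aA a by (auto simp: quad_def)
next
  assume "\<exists>a\<in>carrier A. a \<noteq> \<zero> \<and> a \<noteq> \<one> \<and> x = quad a"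
  then obtain a where a: "a \<in> carrier A" "a \<noteq> \<zero>" "a \<noteq> \<one>" "x = quad a" by blast
  have "z = quad \<zero> \<or> z = quad a"
    if z: "boolean_subalgebra z A" "quad \<zero> \<subseteq> z" "z \<subseteq> quad a" for z
  proof (cases "a \<in> z \<or> ocompl A a \<in> z")
    case True
    then have "quad a \<subseteq> z"
      using boolean_memD(7)[OF z(1), of a] boolean_memD(7)[OF z(1), of "ocompl A a"] quad_compl[OF a(1)] by metis
    then show ?thesis using z by blast
  next
    case False
    then have "z \<subseteq> quad \<zero>" using z(3) by (auto simp: quad_def)
    then show ?thesis using z by blast
  qed
  moreover have "quad \<zero> \<subset> quad a" using a by (auto simp: quad_def)
  ultimately show "atom X x"
    unfolding atom_def bottom_X unfolding BSub_incl_order covers_incl_order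
    using a(4) quad_bool[OF a(1)] quad_bool[OF zero_closed] by blast
qed

lemma basic_iff: "basic X x \<longleftrightarrow> (\<exists>a\<in>carrier A. x = quad a)"
proof -
  have "quad a = quad \<zero>" if "a = \<zero> \<or> a = \<one>" for a using that by (auto simp: quad_def)
  then show ?thesis unfolding basic_def atom_iff bottom_X using zero_closed by blast
qed

text \<open>Finitely many elements of the union lie in a common member, and the two conditions that characterize Boolean
  subalgebras involve at most three elements at a time.\<close>

lemma directed_Union:
  assumes D: "directed_in X D"
  shows "boolean_subalgebra (\<Union>D) A"
proof -
  have DB: "\<And>S. S \<in> D \<Longrightarrow> boolean_subalgebra S A" and ne: "D \<noteq> {}"
    and dir: "\<And>S T. S \<in> D \<Longrightarrow> T \<in> D \<Longrightarrow> \<exists>U\<in>D. S \<subseteq> U \<and> T \<subseteq> U"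
    using D unfolding directed_in_def BSub_incl_order incl_order_simps by blast+
  have two: "\<exists>U\<in>D. a \<in> U \<and> b \<in> U" if ab: "a \<in> \<Union>D" "b \<in> \<Union>D" for a b
  proof -
    obtain S T where "S \<in> D" "T \<in> D" "a \<in> S" "b \<in> T" using ab by blast
    then show ?thesis using dir[of S T] by blast
  qed
  have three: "\<exists>U\<in>D. a \<in> U \<and> b \<in> U \<and> c \<in> U" if abc: "a \<in> \<Union>D" "b \<in> \<Union>D" "c \<in> \<Union>D" for a b c
  proof -
    obtain S T where "S \<in> D" "T \<in> D" "a \<in> S" "b \<in> S" "c \<in> T" using two[OF abc(1,2)] abc(3) by blast
    then show ?thesis using dir[of S T] by blast
  qed
  show ?thesis
    unfolding boolean_subalgebra_iff
  proof (intro conjI)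
    show "orthoalg_subalgebra (\<Union>D) A"
      unfolding orthoalg_subalgebra_def
    proof (intro conjI ballI allI impI)
      show "\<Union>D \<subseteq> carrier A" using boolean_memD(1) DB by blast
      show "\<zero> \<in> \<Union>D" "\<one> \<in> \<Union>D" using boolean_memD(2,3) DB ne by blast+
      show "ocompl A a \<in> \<Union>D" if "a \<in> \<Union>D" for a using boolean_memD(4) DB that by blast
      show "c \<in> \<Union>D" if ab: "a \<in> \<Union>D" "b \<in> \<Union>D" "osum A a b = Some c" for a b c
        using two[OF ab(1,2)] boolean_memD(5)[OF DB _ _ ab(3)] by blast
    qed
    show "mackey (\<Union>D)"
      unfolding mackey_def
    proof (intro ballI)
      fix a b assume ab: "a \<in> \<Union>D" "b \<in> \<Union>D"
      obtain U where U: "U \<in> D" "a \<in> U" "b \<in> U" using two[OF ab] by blast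
      then have "\<exists>p\<in>U. \<exists>q\<in>U. \<exists>r\<in>U. osum A p q = Some a \<and> osum A q r = Some b \<and> orth a r"
        using DB boolean_subalgebra_iff unfolding mackey_def by blast
      then show "\<exists>p\<in>\<Union>D. \<exists>q\<in>\<Union>D. \<exists>r\<in>\<Union>D. osum A p q = Some a \<and> osum A q r = Some b \<and> orth a r"
        using U by blast
    qed
    show "coherent (\<Union>D)"
      unfolding coherent_def
    proof (intro ballI allI impI)
      fix a b c u assume abc: "a \<in> \<Union>D" "b \<in> \<Union>D" "c \<in> \<Union>D" "osum A a b = Some u" "orth a c" "orth b c"
      obtain U where U: "U \<in> D" "a \<in> U" "b \<in> U" "c \<in> U" using three[OF abc(1-3)] by blast
      have "coherent U" using DB[OF U(1)] boolean_subalgebra_iff by blast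
      then show "orth u c" using U abc(4-6) unfolding coherent_def by blast
    qed
  qed
qed

lemma directed_lub: "directed_in X D \<Longrightarrow> is_lub X (\<Union>D) D"
  using directed_Union[of D] unfolding BSub_incl_order is_lub_incl_order directed_in_def incl_order_simps by blast

lemma is_lub_pairI:
  assumes "boolean_subalgebra s A" "x \<subseteq> s" "y \<subseteq> s" "boolean_subalgebra x A" "boolean_subalgebra y A"
    and "\<And>t. boolean_subalgebra t A \<Longrightarrow> x \<subseteq> t \<Longrightarrow> y \<subseteq> t \<Longrightarrow> s \<subseteq> t"
  shows "is_lub X s {x, y}"
  unfolding BSub_incl_order is_lub_incl_order using assms by (intro conjI ballI impI) blast+

text \<open>In the common cover \<open>w\<close>, one of \<open>a\<close>, \<open>a'\<close> is an atom, and one of \<open>b\<close>,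
  \<open>b'\<close> is orthogonal to it. These two elements determine the third member of a partition that
  generates \<open>w\<close>, so every Boolean subalgebra containing both contains \<open>w\<close>.\<close>

lemma atoms_join_lub:
  assumes x: "atom X x" and y: "atom X y" and xy: "x \<noteq> y" and cov: "covers X x w" "covers X y w"
  shows "is_lub X w {x, y}"
proof -
  have wb: "boolean_subalgebra w A" "x \<subseteq> w" "y \<subseteq> w"
    using cov unfolding BSub_incl_order covers_incl_order by blast+
  obtain b where b: "b \<in> carrier A" "b \<noteq> \<zero>" "b \<noteq> \<one>" "y = quad b" using y atom_iff by blast
  obtain a0 where a0: "a0 \<in> carrier A" "a0 \<noteq> \<zero>" "a0 \<noteq> \<one>" "x = quad a0" using x atom_iff by blast
  have a0w: "a0 \<in> w" using wb a0 by (auto simp: quad_def)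
  note Q0 = down_up_in_props[OF wb(1) a0w]
  have "down_up_in w a0 = quad a0 \<or> down_up_in w a0 = w"
    using cov(1) Q0 a0 unfolding BSub_incl_order covers_incl_order by blast
  moreover have "down_up_in w (ocompl A a0) \<subseteq> w" by (auto simp: down_up_in_def)
  ultimately have "down_up_in w a0 = quad a0 \<or> down_up_in w (ocompl A a0) = quad a0" using Q0(3) by blast
  then have "\<exists>a. a \<in> carrier A \<and> a \<noteq> \<zero> \<and> a \<noteq> \<one> \<and> x = quad a \<and> down_up_in w a = quad a"
  proof
    assume "down_up_in w a0 = quad a0" then show ?thesis using a0 by blast
  next
    assume *: "down_up_in w (ocompl A a0) = quad a0"
    have "ocompl A a0 \<noteq> \<zero>" "ocompl A a0 \<noteq> \<one>" using a0 compl_compl[of a0] compl_zero compl_one by metis+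
    then show ?thesis using * a0 quad_compl[OF a0(1)] by (intro exI[of _ "ocompl A a0"]) simp
  qed
  then obtain a where a: "a \<in> carrier A" "a \<noteq> \<zero>" "a \<noteq> \<one>" "x = quad a" "down_up_in w a = quad a" by blast
  have bw: "b \<in> w" "b \<notin> quad a"
    using wb b a xy quad_eq_iff[OF a(1) b(1)] by (auto simp: quad_def)
  obtain d c where d: "d = b \<or> d = ocompl A b" "d \<in> carrier A" "c \<in> carrier A" "d \<noteq> \<zero>" "c \<noteq> \<zero>"
    "osum A d c = Some (ocompl A a)" "w = span {a, d, c}"
    using covers_quad_shape[OF cov(1)[unfolded a(4)] a(5) a(1-3) bw] by blast
  note P = partition_three[OF a(1) d(2,3) a(2) d(4,5,6)]
  have s: "osum A a d = Some (ocompl A c)" using partition_three_sum(1)[OF P] .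
  have "w \<subseteq> T" if T: "boolean_subalgebra T A" "x \<subseteq> T" "y \<subseteq> T" for T
  proof -
    have "a \<in> T" "d \<in> T" using T a b d(1) by (auto simp: quad_def)
    moreover have "c \<in> T"
      using boolean_memD(4)[OF T(1) boolean_memD(5)[OF T(1) calculation s]] d by simp
    ultimately show ?thesis using span_least[OF P(1) boolean_imp_sub[OF T(1)]] d(7) by simp
  qed
  then show ?thesis
    using wb a(4) b(4) quad_bool[OF a(1)] quad_bool[OF b(1)] by (intro is_lub_pairI) simp_all
qed

lemma orthodomain_X: "orthodomain X"
proof -
  interpret partial_order X unfolding BSub_incl_order by (rule partial_order_incl_order)
  show ?thesis
  proof
    show "\<exists>b. least X b (carrier X)"
      using quad_bool[OF zero_closed] quad_zero_least unfolding least_def BSub_incl_order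
      by (intro exI[of _ "quad \<zero>"]) auto
    show "\<exists>s. is_lub X s D" if "directed_in X D" for D
      using directed_lub[OF that] by blast
    show "is_lub X x {a. atom X a \<and> a \<sqsubseteq>\<^bsub>X\<^esub> x}" if "x \<in> carrier X" for x
    proof -
      have x: "boolean_subalgebra x A" using that X_carrier by simp
      have "x \<subseteq> t" if t: "boolean_subalgebra t A"
        "\<forall>y\<in>{a. atom X a \<and> a \<subseteq> x} \<inter> {S. boolean_subalgebra S A}. y \<subseteq> t" for t
      proof
        fix a assume a: "a \<in> x"
        have aA: "a \<in> carrier A" by (rule boolean_memD(6)[OF x a])
        show "a \<in> t"
        proof (cases "a = \<zero> \<or> a = \<one>")
          case True then show ?thesis using boolean_memD(2,3)[OF t(1)] by blast
        next
          case False
          then have "atom X (quad a)" using atom_iff aA by blast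
          then have "quad a \<subseteq> t" using t(2) boolean_memD(7)[OF x a] quad_bool[OF aA] by blast
          then show ?thesis by (auto simp: quad_def)
        qed
      qed
      then have "is_lub (incl_order {S. boolean_subalgebra S A}) x {a. atom X a \<and> a \<subseteq> x}"
        using x unfolding is_lub_incl_order by blast
      then show ?thesis by (simp add: BSub_incl_order)
    qed
    show "compact_in X a" if at: "atom X a" for a
      unfolding compact_in_def
    proof (intro conjI allI impI)
      obtain b where b: "b \<in> carrier A" "a = quad b" using at atom_iff by blast
      show "a \<in> carrier X" using b quad_bool X_carrier by simp
      fix D s assume D: "directed_in X D" "is_lub X s D" "a \<sqsubseteq>\<^bsub>X\<^esub> s"
      then have "s = \<Union>D" using directed_lub[OF D(1)] least_unique by blast
      then have "b \<in> \<Union>D" using D b unfolding BSub_incl_order by (auto simp: quad_def)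
      then obtain y where y: "y \<in> D" "b \<in> y" by blast
      moreover have "boolean_subalgebra y A" using y D(1) X_carrier by (auto simp: directed_in_def)
      ultimately show "\<exists>y\<in>D. a \<sqsubseteq>\<^bsub>X\<^esub> y"
        using boolean_memD(7)[of y b] b unfolding BSub_incl_order incl_order_simps by blast
    qed
    show "boolean_domain (downset X x)" if x: "x \<in> carrier X" for x
    proof -
      have "boolean_subalgebra x A" using x X_carrier by simp
      then obtain h :: "'a \<Rightarrow> 'a set set" where "boolean_representation A x h"
        using boolean_subalgebra_representation by blast
      then interpret R: boolean_representation A x h .
      show ?thesis unfolding R.downset_BSub by (rule R.Sub_boolean_domain)
    qed
    show "is_lub X w {x, y}" if "atom X x" "atom X y" "x \<noteq> y" "covers X x w" "covers X y w" for x y w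
      using atoms_join_lub[OF that] .
  qed
qed

lemma proper_X: "proper_poset X"
  unfolding proper_poset_def
proof (intro ballI impI notI)
  fix x assume x: "x \<in> carrier X" "\<forall>y\<in>carrier X. x \<sqsubseteq>\<^bsub>X\<^esub> y \<longrightarrow> y = x" "basic X x"
  obtain a where a: "x = quad a" using x(3) basic_iff by blast
  have "block A x" using x(1,2) unfolding block_def BSub_incl_order incl_order_simps by blast
  moreover have "finite x" "card x \<le> 4"
    unfolding a quad_def by (simp_all add: card_insert_if)
  ultimately show False using proper by (auto simp: proper_orthoalgebra_def)
qed

end

section \<open>Directions\<close>

context proper_orthoalg
begin

lemma is_direction_basic: "is_direction X x d \<Longrightarrow> basic X x"
  by (simp only: is_direction_def)

lemma is_direction_dom: "is_direction X x d \<Longrightarrow> dom d = upset X x"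
  by (simp only: is_direction_def)

definition direction_of :: "'a \<Rightarrow> 'a set direction" where
  "direction_of a = (\<lambda>y. if boolean_subalgebra y A \<and> a \<in> y then Some (down_up_in y a, down_up_in y (ocompl A a)) else None)"

lemma direction_of_Some: "boolean_subalgebra y A \<Longrightarrow> a \<in> y \<Longrightarrow> direction_of a y = Some (down_up_in y a, down_up_in y (ocompl A a))"
  by (simp add: direction_of_def)

lemma upset_quad: "upset X (quad a) = {y. boolean_subalgebra y A \<and> a \<in> y}"
proof -
  have "quad a \<subseteq> y \<longleftrightarrow> a \<in> y" if "boolean_subalgebra y A" for y
    using boolean_memD(7)[OF that, of a] by (auto simp: quad_def)
  then show ?thesis unfolding BSub_incl_order upset_incl_order by blast
qed

lemma meet_X:
  assumes "boolean_subalgebra z A" "boolean_subalgebra y A" "boolean_subalgebra v A" "y \<subseteq> z" "v \<subseteq> z"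
  shows "y \<sqinter>\<^bsub>X\<^esub> v = y \<inter> v"
proof -
  obtain h :: "'a \<Rightarrow> 'a set set" where "boolean_representation A z h"
    using boolean_subalgebra_representation[OF assms(1)] .
  then interpret R: boolean_representation A z h .
  have "boolean_subalgebra (y \<inter> v) A" using R.sub_Int R.sub_iff assms by blast
  then show ?thesis unfolding BSub_incl_order using assms by (intro meet_incl_order) simp_all
qed

lemma meet_down_up_in:
  assumes z: "boolean_subalgebra z A" and y: "boolean_subalgebra y A" and yz: "y \<subseteq> z" and a: "a \<in> z"
  shows "y \<sqinter>\<^bsub>X\<^esub> down_up_in z a = down_up_in y a"
proof -
  have "y \<sqinter>\<^bsub>X\<^esub> down_up_in z a = y \<inter> down_up_in z a"
    using meet_X[OF z y _ yz] down_up_in_props(1,2)[OF z a] by simp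
  also have "\<dots> = down_up_in y a" using down_up_in_restrict[OF yz] by simp
  finally show ?thesis .
qed

lemma down_up_in_neq:
  assumes y: "boolean_subalgebra y A" and a: "a \<in> y" and "y \<noteq> quad a"
  shows "down_up_in y a \<noteq> down_up_in y (ocompl A a)"
proof
  assume eq: "down_up_in y a = down_up_in y (ocompl A a)"
  then have "down_up_in y a = quad a" using down_up_in_props(3)[OF y a] by simp
  then show False using down_up_in_props(4)[OF y a] eq \<open>y \<noteq> quad a\<close> by simp
qed

lemma covers_down_up_in:
  assumes cov: "covers (BSub A) (quad a) y"
  shows "down_up_in y a = quad a \<and> down_up_in y (ocompl A a) = y \<or> down_up_in y a = y \<and> down_up_in y (ocompl A a) = quad a"
proof -
  have y: "boolean_subalgebra y A" "quad a \<subseteq> y"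
    and cov': "\<And>z. boolean_subalgebra z A \<Longrightarrow> quad a \<subseteq> z \<Longrightarrow> z \<subseteq> y \<Longrightarrow> z = quad a \<or> z = y"
    using cov unfolding BSub_incl_order covers_incl_order by blast+
  have a: "a \<in> y" using y(2) by (auto simp: quad_def)
  note Q = down_up_in_props[OF y(1) a]
  have "down_up_in y a = quad a \<or> down_up_in y a = y" using cov'[OF Q(1) Q(5) Q(2)] .
  moreover have "down_up_in y (ocompl A a) \<subseteq> y" by (auto simp: down_up_in_def)
  ultimately show ?thesis using Q(3,4) by blast
qed

text \<open>The third axiom holds because its hypotheses put \<open>y\<close> and \<open>z\<close> on opposite sides of
  \<open>a\<close>.\<close>

lemma direction_of_direction:
  assumes a: "a \<in> carrier A"
  shows "is_direction X (quad a) (direction_of a)"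
  unfolding is_direction_def
proof (intro conjI ballI allI impI)
  show "basic X (quad a)" using basic_iff a by blast
  show "dom (direction_of a) = upset X (quad a)" unfolding upset_quad by (auto simp: direction_of_def split: if_splits)
next
  fix y assume "y \<in> upset X (quad a)"
  then have y: "boolean_subalgebra y A" "a \<in> y" unfolding upset_quad by auto
  have "principal_pair_for (downset X y) (quad a) (down_up_in y a) (down_up_in y (ocompl A a))"
    using down_up_in_props(6)[OF y] by blast
  then show "\<exists>v w. direction_of a y = Some (v, w) \<and> principal_pair_for (downset X y) (quad a) v w"
    using direction_of_Some[OF y] by blast
next
  fix y z v w assume "y \<in> upset X (quad a)" "z \<in> upset X (quad a)" and le: "y \<sqsubseteq>\<^bsub>X\<^esub> z" and d: "direction_of a z = Some (v, w)"
  then have y: "boolean_subalgebra y A" "a \<in> y" and z: "boolean_subalgebra z A" "a \<in> z" unfolding upset_quad by auto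
  have yz: "y \<subseteq> z" using le by (simp add: BSub_incl_order)
  have vw: "v = down_up_in z a" "w = down_up_in z (ocompl A a)" using d direction_of_Some[OF z] by auto
  show "direction_of a y = Some (y \<sqinter>\<^bsub>X\<^esub> v, y \<sqinter>\<^bsub>X\<^esub> w)"
    unfolding direction_of_Some[OF y] vw
    using meet_down_up_in[OF z(1) y(1) yz z(2)] meet_down_up_in[OF z(1) y(1) yz boolean_memD(4)[OF z]] by simp
next
  fix y z assume "y \<in> upset X (quad a)" "z \<in> upset X (quad a)"
    and cov: "covers X (quad a) y" "covers X (quad a) z"
    and d: "direction_of a y = Some (quad a, y)" "direction_of a z = Some (z, quad a)"
  then have y: "boolean_subalgebra y A" "a \<in> y" and z: "boolean_subalgebra z A" "a \<in> z" unfolding upset_quad by auto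
  show "\<exists>s. is_lub X s {y, z} \<and> covers X y s \<and> covers X z s"
    using opposite_covers_join[OF a cov(1) _ cov(2)] d direction_of_Some[OF y] direction_of_Some[OF z] by simp
qed

text \<open>At each \<open>y\<close> the value is one of the two orders of the pair cut out by \<open>a\<close>. Suppose both orders occur, with
  a genuine difference. By restriction, they occur at covers of \<open>quad a\<close>. These covers have a
  common upper bound, and its order restricts to both.\<close>

lemma direction_eq_direction_of:
  assumes d: "is_direction X x d"
  shows "\<exists>a\<in>carrier A. x = quad a \<and> d = direction_of a"
proof -
  obtain a where a: "a \<in> carrier A" "x = quad a"
    using is_direction_basic[OF d] basic_iff by blast
  define up where "up y \<longleftrightarrow> boolean_subalgebra y A \<and> a \<in> y" for y
  \<comment> \<open>\<open>P y\<close>: at \<open>y\<close> the direction agrees with that of \<open>a\<close>; \<open>N y\<close>: with that of \<open>a'\<close>.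
    Both hold only at \<open>y = quad a\<close>.\<close>
  define P where "P y \<longleftrightarrow> d y = Some (down_up_in y a, down_up_in y (ocompl A a))" for y
  define N where "N y \<longleftrightarrow> d y = Some (down_up_in y (ocompl A a), down_up_in y a)" for y
  have up: "y \<in> upset X x \<longleftrightarrow> up y" for y unfolding a upset_quad up_def by simp
  have dom: "dom d = Collect up" using is_direction_dom[OF d] up by blast
  note d' = d[unfolded is_direction_def, THEN conjunct2, THEN conjunct2]
  note dpair = d'[THEN conjunct1] and dmono = d'[THEN conjunct2, THEN conjunct1]
    and dopp = d'[THEN conjunct2, THEN conjunct2]
  have PN: "P y \<or> N y" if y: "up y" for y
  proof -
    obtain v w where vw: "d y = Some (v, w)" "principal_pair_for (downset X y) x v w"
      using dpair y up by metis
    then show ?thesis using down_up_in_props(6)[of y a v w] y unfolding P_def N_def up_def a(2) by auto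
  qed
  have mono: "d y = Some (y \<sqinter>\<^bsub>X\<^esub> v, y \<sqinter>\<^bsub>X\<^esub> w)" if "up y" "up z" "y \<subseteq> z" "d z = Some (v, w)" for y z v w
  proof -
    have "y \<sqsubseteq>\<^bsub>X\<^esub> z" using that by (simp add: BSub_incl_order)
    then show ?thesis using dmono up that by blast
  qed
  have Pm: "P y" if "up y" "up z" "y \<subseteq> z" "P z" for y z
    using mono[OF that(1-3)] that meet_down_up_in[of z y a] meet_down_up_in[of z y "ocompl A a"] boolean_memD(4)[of z a]
    unfolding P_def up_def by simp
  have Nm: "N y" if "up y" "up z" "y \<subseteq> z" "N z" for y z
    using mono[OF that(1-3)] that meet_down_up_in[of z y a] meet_down_up_in[of z y "ocompl A a"] boolean_memD(4)[of z a]
    unfolding N_def up_def by simp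
  have both: "y = quad a" if "up y" "P y" "N y" for y
  proof (rule ccontr)
    assume "y \<noteq> quad a"
    then have "down_up_in y a \<noteq> down_up_in y (ocompl A a)" using that(1) down_up_in_neq unfolding up_def by blast
    then show False using that(2,3) unfolding P_def N_def by simp
  qed
  have opp: "\<exists>s. is_lub X s {y, z} \<and> covers X y s \<and> covers X z s"
    if "covers X x y" "covers X x z" "up y" "up z" "d y = Some (x, y)" "d z = Some (z, x)" for y z
    using that by (intro dopp[rule_format]) (simp_all add: up)
  \<comment> \<open>Covers on opposite sides of \<open>a\<close> have a join in any case. Covers on the same side have one by
    the third axiom for directions, which applies because the choices at \<open>y\<close> and \<open>z\<close> differ.\<close>
  have join: "\<exists>s. boolean_subalgebra s A \<and> y \<subseteq> s \<and> z \<subseteq> s"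
    if yz: "covers X x y" "covers X x z" "up y" "up z" "N y" "P z" for y z
  proof -
    have cy: "covers X (quad a) y" and cz: "covers X (quad a) z" using yz a by simp_all
    have "\<exists>s. covers X y s \<and> covers X z s"
      using covers_down_up_in[OF cy]
    proof
      assume y: "down_up_in y a = quad a \<and> down_up_in y (ocompl A a) = y"
      show ?thesis using covers_down_up_in[OF cz]
      proof
        assume "down_up_in z a = quad a \<and> down_up_in z (ocompl A a) = z"
        then show ?thesis using opp[OF yz(2,1,4,3)] y yz a unfolding P_def N_def by auto
      next
        assume "down_up_in z a = z \<and> down_up_in z (ocompl A a) = quad a"
        then show ?thesis using opposite_covers_join[OF a(1) cy _ cz] y by blast
      qed
    next
      assume y: "down_up_in y a = y \<and> down_up_in y (ocompl A a) = quad a"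
      show ?thesis using covers_down_up_in[OF cz]
      proof
        assume "down_up_in z a = quad a \<and> down_up_in z (ocompl A a) = z"
        then show ?thesis using opposite_covers_join[OF a(1) cz _ cy] y by blast
      next
        assume "down_up_in z a = z \<and> down_up_in z (ocompl A a) = quad a"
        then show ?thesis using opp[OF yz(1-4)] y yz a unfolding P_def N_def by auto
      qed
    qed
    then show ?thesis unfolding BSub_incl_order covers_incl_order by blast
  qed
  have "(\<forall>y. up y \<longrightarrow> P y) \<or> (\<forall>y. up y \<longrightarrow> N y)"
  proof (rule ccontr)
    assume "\<not> ?thesis"
    then obtain y z where y: "up y" "\<not> P y" and z: "up z" "\<not> N z" by blast
    then have Ny: "N y" and Pz: "P z" using PN by blast+
    have below: "\<exists>y0. covers X x y0 \<and> y0 \<subseteq> u \<and> up y0 \<and> y0 \<noteq> quad a"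
      if u: "up u" "\<not> (P u \<and> N u)" for u
    proof -
      have ub: "boolean_subalgebra u A" "a \<in> u" using u(1) by (auto simp: up_def)
      have "u \<noteq> quad a"
      proof
        assume "u = quad a"
        then have "down_up_in u a = down_up_in u (ocompl A a)"
          using down_up_in_props(2,5)[OF ub] down_up_in_props(2,5)[OF ub(1) boolean_memD(4)[OF ub]] quad_compl[OF a(1)] by simp
        then show False using PN[OF u(1)] u(2) unfolding P_def N_def by simp
      qed
      then have "quad a \<subset> u" using boolean_memD(7)[OF ub] by blast
      then obtain w where w: "covers X (quad a) w" "w \<subseteq> u"
        using exists_cover_below[OF zero_neq_one(1) ub(1)] by blast
      then have "boolean_subalgebra w A" "quad a \<subset> w" unfolding BSub_incl_order covers_incl_order by blast+
      then show ?thesis using w a unfolding up_def by (intro exI[of _ w]) (auto simp: quad_def)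
    qed
    obtain y0 where y0: "covers X x y0" "y0 \<subseteq> y" "up y0" "y0 \<noteq> quad a" using below[OF y(1)] y(2) by blast
    obtain z0 where z0: "covers X x z0" "z0 \<subseteq> z" "up z0" "z0 \<noteq> quad a" using below[OF z(1)] z(2) by blast
    have "N y0" using Nm[OF y0(3) y(1) y0(2) Ny] .
    moreover have "P z0" using Pm[OF z0(3) z(1) z0(2) Pz] .
    ultimately obtain s where s: "boolean_subalgebra s A" "y0 \<subseteq> s" "z0 \<subseteq> s"
      using join[OF y0(1) z0(1) y0(3) z0(3)] by blast
    then have us: "up s" using y0(3) unfolding up_def by blast
    from PN[OF us] show False
    proof
      assume "P s" then show False using Pm[OF y0(3) us s(2)] both[OF y0(3)] \<open>N y0\<close> y0(4) by blast
    next
      assume "N s" then show False using Nm[OF z0(3) us s(3)] both[OF z0(3)] \<open>P z0\<close> z0(4) by blast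
    qed
  qed
  then show ?thesis
  proof
    assume all: "\<forall>y. up y \<longrightarrow> P y"
    have "d y = direction_of a y" for y
    proof (cases "up y")
      case True then show ?thesis using all by (simp add: P_def direction_of_def up_def)
    next
      case False
      then have "y \<notin> dom d" using dom by blast
      then have "d y = None" by (metis domIff)
      then show ?thesis using False by (simp add: direction_of_def up_def)
    qed
    then show ?thesis using a by blast
  next
    assume all: "\<forall>y. up y \<longrightarrow> N y"
    have "d y = direction_of (ocompl A a) y" for y
    proof (cases "up y")
      case True
      then have "boolean_subalgebra y A" "ocompl A a \<in> y" using boolean_memD(4)[of y a] True by (simp_all add: up_def)
      then show ?thesis using all True a by (simp add: N_def direction_of_def)
    next
      case False
      then have "y \<notin> dom d" using dom by blast
      then have "d y = None" by (metis domIff)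
      moreover have "\<not> (boolean_subalgebra y A \<and> ocompl A a \<in> y)"
        using False boolean_memD(4)[of y "ocompl A a"] a by (auto simp: up_def)
      ultimately show ?thesis by (auto simp: direction_of_def)
    qed
    then have "d = direction_of (ocompl A a)" by blast
    then show ?thesis using a quad_compl[OF a(1)] by (intro bexI[of _ "ocompl A a"]) auto
  qed
qed

lemma directions_X: "directions X = direction_of ` carrier A"
proof
  show "directions X \<subseteq> direction_of ` carrier A"
  proof
    fix d assume "d \<in> directions X"
    then obtain x where "is_direction X x d" unfolding directions_def by (elim CollectE exE)
    then show "d \<in> direction_of ` carrier A" using direction_eq_direction_of by blast
  qed
  show "direction_of ` carrier A \<subseteq> directions X"
  proof
    fix d assume "d \<in> direction_of ` carrier A"
    then obtain a where "a \<in> carrier A" "d = direction_of a" by blast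
    then show "d \<in> directions X"
      using direction_of_direction[of a] unfolding directions_def by (intro CollectI exI[of _ "quad a"]) simp
  qed
qed

lemma enough_directions_X: "enough_directions X"
  unfolding enough_directions_def
proof (intro conjI allI impI)
  show "proper_poset X" by (rule proper_X)
  fix x assume "basic X x"
  then obtain a where a: "a \<in> carrier A" "x = quad a" using basic_iff by blast
  show "\<exists>d. is_direction X x d" unfolding a(2) by (rule exI, rule direction_of_direction[OF a(1)])
qed

lemma direction_of_base:
  assumes "is_direction X x (direction_of a)" "a \<in> carrier A"
  shows "x = quad a"
proof -
  obtain b where b: "b \<in> carrier A" "x = quad b" using is_direction_basic[OF assms(1)] basic_iff by blast
  have "upset X x = upset X (quad a)"
    using is_direction_dom[OF assms(1)] is_direction_dom[OF direction_of_direction[OF assms(2)]] by simp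
  then have "upset X (quad b) = upset X (quad a)" using b by simp
  moreover have "quad b \<in> upset X (quad b)" "quad a \<in> upset X (quad a)"
    using quad_bool b assms(2) unfolding upset_quad by (auto simp: quad_def)
  ultimately show ?thesis using b unfolding BSub_incl_order upset_incl_order by blast
qed

lemma strictly_above:
  assumes "a \<in> carrier A" shows "\<exists>y. boolean_subalgebra y A \<and> quad a \<subset> y"
proof -
  have "basic X (quad a)" using basic_iff assms by blast
  moreover have "quad a \<in> carrier X" using quad_bool[OF assms] X_carrier by simp
  ultimately obtain y where "y \<in> carrier X" "quad a \<sqsubseteq>\<^bsub>X\<^esub> y" "y \<noteq> quad a"
    using proper_X unfolding proper_poset_def by blast
  then show ?thesis unfolding BSub_incl_order incl_order_simps by blast
qed

text \<open>This is where properness enters: some \<open>y\<close> lies strictly above \<open>quad a\<close>, and there the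
  two pieces differ.\<close>

lemma direction_of_neq_compl:
  assumes a: "a \<in> carrier A" shows "direction_of a \<noteq> direction_of (ocompl A a)"
proof
  assume *: "direction_of a = direction_of (ocompl A a)"
  obtain y where y: "boolean_subalgebra y A" "quad a \<subset> y" using strictly_above[OF a] by blast
  then have ay: "a \<in> y" by (auto simp: quad_def)
  have "direction_of a y = Some (down_up_in y (ocompl A a), down_up_in y a)"
    unfolding * using direction_of_Some[OF y(1) boolean_memD(4)[OF y(1) ay]] a by simp
  then show False using direction_of_Some[OF y(1) ay] down_up_in_neq[OF y(1) ay] y(2) by auto
qed

lemma inj_direction_of: "inj_on direction_of (carrier A)"
proof (rule inj_onI)
  fix a b assume ab: "a \<in> carrier A" "b \<in> carrier A" "direction_of a = direction_of b"
  have "quad b = quad a"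
    using direction_of_base[of "quad b" a] direction_of_direction[of b] ab by simp
  then consider "b = a" | "b = ocompl A a" | "a \<in> {\<zero>, \<one>}" "b \<in> {\<zero>, \<one>}"
    using quad_eq_iff[OF ab(1,2)] by metis
  then show "a = b"
  proof cases
    case 1 then show ?thesis by simp
  next
    case 2 then show ?thesis using direction_of_neq_compl[OF ab(1)] ab(3) by blast
  next
    case 3
    then have "b = a \<or> b = ocompl A a" by auto
    then show ?thesis using direction_of_neq_compl[OF ab(1)] ab(3) by blast
  qed
qed

lemma dir_compl_direction_of: "a \<in> carrier A \<Longrightarrow> dir_compl (direction_of a) = direction_of (ocompl A a)"
proof
  fix y assume a: "a \<in> carrier A"
  have "a \<in> y \<longleftrightarrow> ocompl A a \<in> y" if "boolean_subalgebra y A"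
    using boolean_memD(4)[OF that] compl_compl[OF a] by metis
  then show "dir_compl (direction_of a) y = direction_of (ocompl A a) y" using a by (auto simp: dir_compl_def direction_of_def)
qed

lemma down_up_in_bounds:
  assumes y: "boolean_subalgebra y A" shows "down_up_in y \<zero> = quad \<zero>" "down_up_in y \<one> = y"
proof -
  show "down_up_in y \<one> = y" using leq_one boolean_memD(6)[OF y] unfolding down_up_in_def by blast
  then show "down_up_in y \<zero> = quad \<zero>"
    using down_up_in_props(2,3)[OF y boolean_memD(2)[OF y]] by auto
qed

lemma dir_zero_direction_of: "dir_zero X = direction_of \<zero>"
proof
  fix y show "dir_zero X y = direction_of \<zero> y"
    using boolean_memD(2)[of y] down_up_in_bounds[of y]
    by (cases "boolean_subalgebra y A") (simp_all add: dir_zero_def direction_of_def bottom_X X_carrier)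
qed

lemma dir_one_direction_of: "dir_one X = direction_of \<one>"
proof
  fix y show "dir_one X y = direction_of \<one> y"
    using boolean_memD(3)[of y] down_up_in_bounds[of y]
    by (cases "boolean_subalgebra y A") (simp_all add: dir_one_def direction_of_def bottom_X X_carrier)
qed

end

section \<open>Sums of directions\<close>

context orthoalgebra
begin

text \<open>The sums match in definedness as well as in value. This is what makes the inverse of \<open>f\<close> a morphism.\<close>

lemma transport:
  assumes bij: "bij_betw f (carrier A) (carrier C)"
    and sum: "\<And>a b. a \<in> carrier A \<Longrightarrow> b \<in> carrier A \<Longrightarrow> osum C (f a) (f b) = map_option f (osum A a b)"
    and cm: "\<And>a. a \<in> carrier A \<Longrightarrow> ocompl C (f a) = f (ocompl A a)"
    and zo: "ozero C = f \<zero>" "oone C = f \<one>"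
  shows "orthoalgebra C \<and> orthoalg_isomorphic C A"
proof
  have C: "carrier C = f ` carrier A" and io: "inj_on f (carrier A)"
    using bij by (simp_all add: bij_betw_def)
  have fC: "f a \<in> carrier C" if "a \<in> carrier A" for a unfolding C by (rule imageI[OF that])
  show "orthoalgebra C"
  proof
    show "ozero C \<in> carrier C" "oone C \<in> carrier C" using zo fC[of \<zero>] fC[of \<one>] by simp_all
    fix d assume "d \<in> carrier C"
    then obtain a where a: "a \<in> carrier A" "d = f a" unfolding C by blast
    show "ocompl C d \<in> carrier C" using a(2) cm[OF a(1)] fC[OF compl_closed[OF a(1)]] by simp
    show "osum C d (ocompl C d) = Some (oone C)"
      using a(2) cm[OF a(1)] sum[OF a(1) compl_closed[OF a(1)]] sum_compl[OF a(1)] zo by simp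
    show "osum C d d \<noteq> None \<longleftrightarrow> d = ozero C"
      using a(2) sum[OF a(1) a(1)] sum_self[OF a(1)] inj_on_eq_iff[OF io a(1) zero_closed] zo by simp
    fix e assume "e \<in> carrier C"
    then obtain b where b: "b \<in> carrier A" "e = f b" unfolding C by blast
    have de: "osum C d e = map_option f (osum A a b)" using sum[OF a(1) b(1)] a(2) b(2) by simp
    show "osum C d e = osum C e d"
      unfolding de using a(2) b(2) sum[OF b(1) a(1)] sum_comm[OF a(1) b(1)] by simp
    show "e = ocompl C d" if de1: "osum C d e = Some (oone C)"
    proof -
      have "map_option f (osum A a b) = Some (f \<one>)" using de1 de zo by simp
      then obtain c where c: "osum A a b = Some c" "f c = f \<one>" by (cases "osum A a b") auto
      have "c = \<one>" using inj_onD[OF io c(2) sum_closed[OF a(1) b(1) c(1)] one_closed] .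
      then show ?thesis using compl_unique[OF a(1) b(1)] c(1) a(2) b(2) cm[OF a(1)] by simp
    qed
    show "g \<in> carrier C" if g: "osum C d e = Some g" for g
    proof -
      obtain c where c: "osum A a b = Some c" "g = f c" using g de by (cases "osum A a b") auto
      show ?thesis unfolding c(2) by (rule fC[OF sum_closed[OF a(1) b(1) c(1)]])
    qed
    fix g assume "g \<in> carrier C"
    then obtain c where c: "c \<in> carrier A" "g = f c" unfolding C by blast
    have eg: "osum C e g = map_option f (osum A b c)" using sum[OF b(1) c(1)] b(2) c(2) by simp
    have "Option.bind (osum C d e) (\<lambda>u. osum C u g) = map_option f (Option.bind (osum A a b) (\<lambda>u. osum A u c))"
      using de c(2) sum[OF sum_closed[OF a(1) b(1)] c(1)] by (cases "osum A a b") simp_all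
    moreover have "Option.bind (osum C e g) (\<lambda>v. osum C d v) = map_option f (Option.bind (osum A b c) (\<lambda>v. osum A a v))"
      using eg a(2) sum[OF a(1) sum_closed[OF b(1) c(1)]] by (cases "osum A b c") simp_all
    ultimately show "Option.bind (osum C d e) (\<lambda>u. osum C u g) = Option.bind (osum C e g) (\<lambda>v. osum C d v)"
      using sum_assoc[OF a(1) b(1) c(1)] by simp
  qed
  define g where "g = inv_into (carrier A) f"
  have gf: "g (f a) = a" if "a \<in> carrier A" for a
    unfolding g_def by (rule inv_into_f_f[OF io that])
  have "f \<in> orthoalg_hom A C"
    unfolding orthoalg_hom_def
  proof (intro CollectI conjI ballI allI impI)
    show "f \<in> carrier A \<rightarrow> carrier C" using fC by blast
    show "f (ocompl A a) = ocompl C (f a)" if "a \<in> carrier A" for a using cm[OF that] by simp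
    show "osum C (f a) (f b) = Some (f c)"
      if "a \<in> carrier A" "b \<in> carrier A" "osum A a b = Some c" for a b c
      using sum[OF that(1,2)] that(3) by simp
  qed
  moreover have "g \<in> orthoalg_hom C A"
    unfolding orthoalg_hom_def
  proof (intro CollectI conjI ballI allI impI)
    show "g \<in> carrier C \<rightarrow> carrier A"
    proof
      fix d assume "d \<in> carrier C"
      then obtain a where "a \<in> carrier A" "d = f a" unfolding C by blast
      then show "g d \<in> carrier A" using gf[of a] by simp
    qed
    fix d assume "d \<in> carrier C"
    then obtain a where a: "a \<in> carrier A" "d = f a" unfolding C by blast
    show "g (ocompl C d) = ocompl A (g d)"
      using a(2) cm[OF a(1)] gf[OF a(1)] gf[OF compl_closed[OF a(1)]] by simp
    fix e k assume "e \<in> carrier C" and k: "osum C d e = Some k"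
    then obtain b where b: "b \<in> carrier A" "e = f b" unfolding C by blast
    have "map_option f (osum A a b) = Some k" using k a(2) b(2) sum[OF a(1) b(1)] by simp
    then obtain c where c: "osum A a b = Some c" "k = f c" by (cases "osum A a b") auto
    then show "osum A (g d) (g e) = Some (g k)"
      using a(2) b(2) gf[OF a(1)] gf[OF b(1)] gf[OF sum_closed[OF a(1) b(1) c(1)]] by simp
  qed
  moreover have "f (g c) = c" if c: "c \<in> carrier C" for c
    unfolding g_def using c C by (intro f_inv_into_f) simp
  ultimately show "orthoalg_isomorphic C A"
    unfolding orthoalg_isomorphic_def using gf by blast
qed

end

context proper_orthoalg
begin

lemma join_X: "is_lub X w {x, y} \<Longrightarrow> x \<squnion>\<^bsub>X\<^esub> y = w"
  unfolding BSub_incl_order by (rule join_eqI[OF partial_order_incl_order])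

lemma covers_XD:
  assumes "covers X x y" shows "boolean_subalgebra x A" "boolean_subalgebra y A" "x \<subset> y"
  using assms unfolding BSub_incl_order covers_incl_order by simp_all

text \<open>The prescribed values at \<open>w\<close> say that \<open>a\<close> and \<open>b\<close> are atoms of the Boolean algebra
  \<open>w\<close>. Being distinct, they are orthogonal.\<close>

lemma near_summableD:
  assumes a: "a \<in> carrier A" and b: "b \<in> carrier A" and ns: "near_summable X (direction_of a) (direction_of b) x y"
  shows "x = quad a" "y = quad b" "orth a b"
proof -
  show x: "x = quad a" using ns direction_of_base[OF _ a] unfolding near_summable_def by blast
  show y: "y = quad b" using ns direction_of_base[OF _ b] unfolding near_summable_def by blast
  obtain w where w: "is_lub X w {x, y}" "covers X x w" "covers X y w" and ne: "x \<noteq> y"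
    and at: "atom X x" "atom X y"
    using ns unfolding near_summable_def near_def by blast
  have wb: "boolean_subalgebra w A" "quad a \<subseteq> w" "quad b \<subseteq> w"
    using covers_XD[OF w(2)] covers_XD[OF w(3)] x y by blast+
  have aw: "a \<in> w" "b \<in> w" using wb(2,3) by (auto simp: quad_def)
  have "direction_of a w = Some (x, w)" "direction_of b w = Some (y, w)"
    using ns join_X[OF w(1)] unfolding near_summable_def by simp_all
  then have Q: "down_up_in w a = quad a" "down_up_in w b = quad b"
    using direction_of_Some[OF wb(1) aw(1)] direction_of_Some[OF wb(1) aw(2)] x y by simp_all
  obtain h :: "'a \<Rightarrow> 'a set set" where "boolean_representation A w h"
    using boolean_subalgebra_representation[OF wb(1)] .
  then interpret R: boolean_representation A w h .
  define m where "m = R.mt a b"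
  have mw: "m \<in> w" "h m = h a \<inter> h b" using aw by (auto simp: m_def)
  have "m \<in> quad a \<inter> quad b"
    using Q mw aw R.leq_h[of m a] R.leq_h[of m b] by (auto simp: down_up_in_def)
  moreover have "quad a \<inter> quad b \<subseteq> {\<zero>, \<one>}"
  proof
    fix t assume t: "t \<in> quad a \<inter> quad b"
    show "t \<in> {\<zero>, \<one>}"
    proof (rule ccontr)
      assume "t \<notin> {\<zero>, \<one>}"
      then have "t = a \<or> t = ocompl A a" "t = b \<or> t = ocompl A b" using t by (auto simp: quad_def)
      then have "quad t = quad a" "quad t = quad b" using quad_compl[OF a] quad_compl[OF b] by auto
      then show False using ne x y by simp
    qed
  qed
  moreover have "m \<noteq> \<one>"
  proof
    assume "m = \<one>"
    then have "h a = h \<one>" "h b = h \<one>" using mw(2) R.h_le_one aw by auto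
    then have "a = b" using R.h_eq_iff aw by simp
    then show False using ne x y by simp
  qed
  ultimately have "m = \<zero>" by blast
  then have "h a \<inter> h b = {}" using mw(2) by simp
  then show "orth a b" using R.orth_h[OF aw] by (simp add: orth_def)
qed

lemma quad_span_three:
  assumes P: "partition {a, b, c}" "a \<noteq> b" "a \<noteq> c" "b \<noteq> c" and t: "t \<in> span {a, b, c}"
  shows "quad t \<in> {quad \<zero>, quad a, quad b, quad c}"
proof -
  have car: "a \<in> carrier A" "b \<in> carrier A" "c \<in> carrier A" using P(1) by (auto simp: partition_def)
  obtain X where X: "X \<subseteq> {a, b, c}" "t = fsum X" using t by (auto simp: span_def)
  have *: "quad (fsum Y) = quad x" if "Y = {x} \<or> {a, b, c} - Y = {x}" "Y \<subseteq> {a, b, c}" for Y x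
    using that(1)
  proof
    assume "{a, b, c} - Y = {x}"
    then have "ocompl A (fsum Y) = x" using fsum_compl[OF P(1) that(2)] by simp
    then show ?thesis using quad_compl[OF fsum_carrier[OF P(1) that(2)]] by simp
  qed simp
  have "(\<exists>x\<in>{a, b, c}. X = {x} \<or> {a, b, c} - X = {x}) \<or> X = {} \<or> X = {a, b, c}"
    by (cases "a \<in> X"; cases "b \<in> X"; cases "c \<in> X") (use X(1) P(2-4) in blast)+
  then consider "X = {}" | "X = {a, b, c}" | x where "x \<in> {a, b, c}" "X = {x} \<or> {a, b, c} - X = {x}"
    by blast
  then show ?thesis
  proof cases
    case 1 then show ?thesis using X by simp
  next
    case 2
    then have "t = \<one>" using X fsum_all[OF P(1)] by simp
    then have "quad t = quad \<zero>" by (auto simp: quad_def)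
    then show ?thesis by simp
  next
    case 3 then show ?thesis using *[OF _ X(1)] X(2) by auto
  qed
qed

text \<open>With \<open>c = s'\<close>, the family \<open>a, b, c\<close> is a partition, and the algebra \<open>w\<close> it generates
  is the join of \<open>quad a\<close> and \<open>quad b\<close>. The third atom below \<open>w\<close> is \<open>quad c\<close>, and of its two
  directions the one with value \<open>(w, quad c)\<close> at \<open>w\<close> belongs to \<open>c' = s\<close>, not to \<open>c\<close>.\<close>

lemma dir_sum_orth:
  assumes a: "a \<in> carrier A" "a \<noteq> \<zero>" and b: "b \<in> carrier A" "b \<noteq> \<zero>"
    and nc: "b \<noteq> ocompl A a" and s: "osum A a b = Some s"
  shows "dir_sum X (direction_of a) (direction_of b) = Some (direction_of s)"
proof -
  define c where "c = ocompl A s"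
  have sA: "s \<in> carrier A" using sum_closed a b s by blast
  have cA: "c \<in> carrier A" using sA by (simp add: c_def)
  have s': "ocompl A c = s" using sA by (simp add: c_def)
  have c0: "c \<noteq> \<zero>"
  proof
    assume "c = \<zero>"
    then have "s = \<one>" using s' by simp
    then show False using compl_unique[OF a(1) b(1)] s nc by simp
  qed
  have sc: "osum A a b = Some (ocompl A c)" using s s' by simp
  note P' = partition_three[OF cA a(1) b(1) c0 a(2) b(2) sc]
  have eq: "{c, a, b} = {a, b, c}" by blast
  have P: "partition {a, b, c}" "a \<noteq> b" "a \<noteq> c" "b \<noteq> c" using P' eq by auto
  note ps = partition_three_sum[OF P]
  let ?w = "span {a, b, c}"
  have cov: "covers X (quad a) ?w" "covers X (quad b) ?w" "covers X (quad c) ?w"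
    using covers_quad_three[OF a(1) b(1) cA a(2) b(2) c0 ps(2)]
      covers_quad_three[OF b(1) a(1) cA b(2) a(2) c0 ps(3)]
      covers_quad_three[OF cA a(1) b(1) c0 a(2) b(2) ps(1)]
    by (simp_all add: insert_commute)
  have wb: "boolean_subalgebra ?w A" by (rule span_boolean[OF P(1)])
  have sub: "quad a \<subseteq> ?w" "quad b \<subseteq> ?w" "quad c \<subset> ?w"
    using covers_XD(3)[OF cov(1)] covers_XD(3)[OF cov(2)] covers_XD(3)[OF cov(3)] by blast+
  have abw: "a \<in> ?w" "b \<in> ?w" "c \<in> ?w" using span_upper[of "{a, b, c}"] by auto
  have one: "a \<noteq> \<one>" "b \<noteq> \<one>" "c \<noteq> \<one>"
    using ps a(2) b(2) sum_eq_zero(1)[OF a(1) b(1)] sum_eq_zero(1)[OF b(1) cA] sum_eq_zero(1)[OF a(1) cA]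
    by auto
  have at: "atom X (quad a)" "atom X (quad b)" "atom X (quad c)" unfolding atom_iff using a b cA c0 one by blast+
  have ne: "quad a \<noteq> quad b"
  proof
    assume "quad a = quad b"
    then show False using quad_eq_iff[OF a(1) b(1)] P(2) nc a(2) one by simp
  qed
  have in_quad: "x = y" if "x \<in> {a, b, c}" "y \<in> {a, b, c}" "x \<in> quad y" for x y
  proof (rule ccontr)
    assume "x \<noteq> y"
    have xy: "x \<in> carrier A" "y \<in> carrier A" "x \<noteq> \<zero>" "x \<noteq> \<one>" using that a b cA c0 one by auto
    then have "x = ocompl A y" using that(3) \<open>x \<noteq> y\<close> by (auto simp: quad_def)
    then have "fsum {x} = fsum ({a, b, c} - {y})" using fsum_compl[OF P(1), of "{y}"] that(2) by simp
    then have "{x} = {a, b, c} - {y}"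
      using inj_onD[OF inj_on_fsum[OF P(1)], of "{x}" "{a, b, c} - {y}"] that(1) by auto
    then have "{a, b, c} = {x, y}" using that(1,2) by blast
    moreover have "card {a, b, c} = 3" using P(2-4) by simp
    moreover have "card {x, y} \<le> 2" by (simp add: card_insert_if)
    ultimately show False by simp
  qed
  have nec: "quad c \<noteq> quad a" "quad c \<noteq> quad b"
    using in_quad[of c a] in_quad[of c b] P(3,4) unfolding quad_def by blast+
  have lub: "is_lub X ?w {quad a, quad b}"
    using atoms_join_lub[OF at(1,2) ne cov(1,2)] .
  note j = join_X[OF lub]
  have Q: "down_up_in ?w x = quad x" "down_up_in ?w (ocompl A x) = ?w" if "x \<in> {a, b, c}" for x
    using down_up_in_span[OF P(1) that] down_up_in_props(4)[OF wb] that abw by auto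
  have drw: "direction_of a ?w = Some (quad a, ?w)" "direction_of b ?w = Some (quad b, ?w)" "direction_of c ?w = Some (quad c, ?w)"
    "direction_of s ?w = Some (?w, quad c)"
    using direction_of_Some[OF wb abw(1)] direction_of_Some[OF wb abw(2)] direction_of_Some[OF wb abw(3)] Q
      direction_of_Some[OF wb boolean_memD(4)[OF wb abw(3)]] s' c_def[symmetric] by auto
  have ns: "near_summable X (direction_of a) (direction_of b) (quad a) (quad b)"
    unfolding near_summable_def near_def j
    using direction_of_direction[OF a(1)] direction_of_direction[OF b(1)] at(1,2) ne lub cov(1,2) drw(1,2)
    by (intro conjI exI[of _ ?w])
  define F where "F f \<longleftrightarrow> (\<exists>x y z. near_summable X (direction_of a) (direction_of b) x y \<and>
          atom X z \<and> z \<sqsubseteq>\<^bsub>X\<^esub> x \<squnion>\<^bsub>X\<^esub> y \<and> z \<noteq> x \<and> z \<noteq> y \<and>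
          is_direction X z f \<and> f (x \<squnion>\<^bsub>X\<^esub> y) = Some (x \<squnion>\<^bsub>X\<^esub> y, z))" for f
  have "F (direction_of s)"
    unfolding F_def
  proof (intro exI conjI)
    show "near_summable X (direction_of a) (direction_of b) (quad a) (quad b)" by (rule ns)
    show "atom X (quad c)" by (rule at(3))
    show "quad c \<sqsubseteq>\<^bsub>X\<^esub> quad a \<squnion>\<^bsub>X\<^esub> quad b" unfolding j using sub(3) by (simp add: BSub_incl_order less_imp_le)
    show "quad c \<noteq> quad a" "quad c \<noteq> quad b" by (rule nec)+
    show "is_direction X (quad c) (direction_of s)" using direction_of_direction[OF sA] quad_compl[OF cA] s' by simp
    show "direction_of s (quad a \<squnion>\<^bsub>X\<^esub> quad b) = Some (quad a \<squnion>\<^bsub>X\<^esub> quad b, quad c)" unfolding j by (rule drw(4))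
  qed
  moreover have "f = direction_of s" if "F f" for f
  proof -
    obtain x y z where f: "near_summable X (direction_of a) (direction_of b) x y" "atom X z" "z \<sqsubseteq>\<^bsub>X\<^esub> x \<squnion>\<^bsub>X\<^esub> y"
      "z \<noteq> x" "z \<noteq> y" "is_direction X z f" "f (x \<squnion>\<^bsub>X\<^esub> y) = Some (x \<squnion>\<^bsub>X\<^esub> y, z)"
      using \<open>F f\<close> unfolding F_def by blast
    have xy: "x = quad a" "y = quad b" using near_summableD[OF a(1) b(1) f(1)] by blast+
    have zw: "z \<subseteq> ?w" and fw: "f ?w = Some (?w, z)" using f(3,7) xy j by (simp_all add: BSub_incl_order)
    obtain t where t: "t \<in> carrier A" "z = quad t" "f = direction_of t" using direction_eq_direction_of[OF f(6)] by blast
    have "t \<in> ?w" using zw t by (auto simp: quad_def)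
    then have "z \<in> {quad \<zero>, quad a, quad b, quad c}" using quad_span_three[OF P] t by blast
    moreover have "z \<noteq> quad \<zero>"
      using f(2) covers_XD(3) unfolding atom_def bottom_X by blast
    ultimately have "z = quad c" using f(4,5) xy by blast
    then have "t = c \<or> t = ocompl A c"
      using quad_eq_iff[OF cA t(1)] t(2) c0 one(3) by auto
    moreover have "t \<noteq> c"
    proof
      assume "t = c"
      then have "?w = quad c" using fw drw(3) t(3) by simp
      then show False using sub(3) by simp
    qed
    ultimately show ?thesis using t s' by simp
  qed
  ultimately have THE: "(THE f. F f) = direction_of s" by (rule the_equality)
  have n: "direction_of b \<noteq> dir_zero X" "direction_of a \<noteq> dir_zero X" "direction_of b \<noteq> dir_compl (direction_of a)"
    using inj_on_eq_iff[OF inj_direction_of] a b nc dir_zero_direction_of dir_compl_direction_of[OF a(1)] by simp_all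
  have ex: "\<exists>x y. near_summable X (direction_of a) (direction_of b) x y" using ns by blast
  show ?thesis
    unfolding dir_sum_def if_not_P[OF n(1)] if_not_P[OF n(2)] if_not_P[OF n(3)] if_P[OF ex]
      THE[unfolded F_def] by (rule refl)
qed

lemma dir_sum_direction_of:
  assumes a: "a \<in> carrier A" and b: "b \<in> carrier A"
  shows "dir_sum X (direction_of a) (direction_of b) = map_option direction_of (osum A a b)"
proof -
  have inj: "direction_of x = direction_of y \<longleftrightarrow> x = y" if "x \<in> carrier A" "y \<in> carrier A" for x y
    using inj_on_eq_iff[OF inj_direction_of that] .
  note simps = dir_zero_direction_of dir_one_direction_of dir_compl_direction_of[OF a]
  consider "b = \<zero>" | "b \<noteq> \<zero>" "a = \<zero>" | "a \<noteq> \<zero>" "b \<noteq> \<zero>" "b = ocompl A a"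
    | "a \<noteq> \<zero>" "b \<noteq> \<zero>" "b \<noteq> ocompl A a" "osum A a b = None"
    | s where "a \<noteq> \<zero>" "b \<noteq> \<zero>" "b \<noteq> ocompl A a" "osum A a b = Some s" by blast
  then show ?thesis
  proof cases
    case 1 then show ?thesis using a by (simp add: dir_sum_def simps)
  next
    case 2 then show ?thesis using b by (simp add: dir_sum_def simps)
  next
    case 3
    then have "direction_of b \<noteq> direction_of \<zero>" "direction_of a \<noteq> direction_of \<zero>" using inj a b by simp_all
    then show ?thesis using 3 sum_compl[OF a] by (simp add: dir_sum_def simps)
  next
    case 4
    then have "direction_of b \<noteq> direction_of \<zero>" "direction_of a \<noteq> direction_of \<zero>" "direction_of b \<noteq> direction_of (ocompl A a)" using inj a b by simp_all
    moreover have "\<not> (\<exists>x y. near_summable X (direction_of a) (direction_of b) x y)"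
      using near_summableD(3)[OF a b] 4 unfolding orth_def by blast
    ultimately show ?thesis using 4 by (simp add: dir_sum_def simps)
  next
    case 5 then show ?thesis using dir_sum_orth[OF a _ b] by simp
  qed
qed

end

theorem theorem1:
  fixes A :: "'a orthoalg"
  assumes "orthoalgebra A"
    and "proper_orthoalgebra A"
  shows "orthodomain (BSub A) \<and> enough_directions (BSub A) \<and>
    orthoalgebra (Dir (BSub A)) \<and> orthoalg_isomorphic (Dir (BSub A)) A"
proof -
  interpret proper_orthoalg A
    using assms by (simp add: proper_orthoalg_def proper_orthoalg_axioms_def)
  have "orthoalgebra (Dir (BSub A)) \<and> orthoalg_isomorphic (Dir (BSub A)) A"
  proof (rule transport[of direction_of])
    show "bij_betw direction_of (carrier A) (carrier (Dir (BSub A)))"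
      using inj_direction_of directions_X by (simp add: bij_betw_def Dir_def)
  qed (simp_all add: Dir_def dir_sum_direction_of dir_compl_direction_of dir_zero_direction_of dir_one_direction_of)
  then show ?thesis using orthodomain_X enough_directions_X by blast
qed

end
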